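(* Let $\mathcal{A}_a$ be an $H$-shift-invariant subspace of continuous functions on $G$ generated by a function $a\in L^2(G)$. For a fixed $g_0\in G$, consider the function $G_{g_0}=\sum_{h\in H}a(g_0+h)\,\chi_h\in L^2(\widehat H)$. The following statements are equivalent: (i) $0<\operatorname{ess\,inf}_{\gamma\in\widehat H}|G_{g_0}(\gamma)|\le\operatorname{ess\,sup}_{\gamma\in\widehat H}|G_{g_0}(\gamma)|<+\infty$. (ii) There exists a unique function $S_{g_0}\in\mathcal{A}_a$ such that the sequence $\{S_{g_0}(\cdot-m)\}_{m\in H}$ is a Riesz basis for $\mathcal{A}_a$, and the following sampling formula holds for every $x\in\mathcal{A}_a$: $$x(g)=\sum_{m\in H}x(g_0+m)\,S_{g_0}(g-m)\quad\text{in }L^2(G).$$ Moreover, in case the equivalent conditions (i) and (ii) hold, the convergence of the series $\sum_{m\in H}x(g_0+m)\,S_{g_0}(g-m)$ is, for every $x\in\mathcal{A}_a$, absolute and uniform on $G$.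
   Context: $G$ is a second countable locally compact abelian Hausdorff group, written additively, and $H$ is a countable uniform lattice in $G$ (a discrete subgroup with $G/H$ compact). $\widehat H$ is the compact dual group of $H$, with Haar measure normalized to total mass $1$; $\chi_h(\gamma)=(h,\gamma)$ is the value of the character $\gamma\in\widehat H$ at $h\in H$, so $\{\chi_h\}_{h\in H}$ is an orthonormal basis of $L^2(\widehat H)$. For $a\in L^2(G)$, $\mathcal{A}_a$ is the closed linear span in $L^2(G)$ of the translates $L_ha=a(\cdot-h)$, $h\in H$. It is assumed that $\{L_ha\}_{h\in H}$ is a Riesz sequence in $L^2(G)$, so that $\mathcal{A}_a=\{\sum_{h\in H}\alpha_h\,a(\cdot-h):\{\alpha_h\}\in\ell^2(H)\}$. That $\mathcal{A}_a$ is an $H$-shift-invariant subspace of continuous functions on $G$ means that $a$ is continuous on $G$ and $\sum_{h\in H}|a(g-h)|^2<\infty$ uniformly in $g\in G$, i.e. $\sup_{g\in G}\sum_{h\in H}|a(g-h)|^2<\infty$. Under these assumptions $\mathcal{A}_a$ is a reproducing kernel Hilbert space of continuous functions on $G$, each $x\in\mathcal{A}_a$ being identified with its continuous representative given by the pointwise convergent sum $x(g)=\sum_{h\in H}\alpha_h\,a(g-h)$. *)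

theory Defs
  imports "HOL-Probability.Essential_Supremum"
begin

section \<open>Square-integrable functions\<close>

text \<open>Elements of \<open>L\<^sup>2\<close> are represented by functions; two functions agreeing almost everywhere
  have \<open>L\<^sup>2\<close>-distance zero, and all notions below respect that identification.\<close>

definition L2 :: "'x measure \<Rightarrow> ('x \<Rightarrow> complex) set" where
  "L2 M = {f \<in> borel_measurable M. integrable M (\<lambda>x. (cmod (f x))\<^sup>2)}"

definition L2_norm :: "'x measure \<Rightarrow> ('x \<Rightarrow> complex) \<Rightarrow> real" where
  "L2_norm M f = sqrt (\<integral>x. (cmod (f x))\<^sup>2 \<partial>M)"

definition has_L2_sum ::
  "'x measure \<Rightarrow> 'i set \<Rightarrow> ('i \<Rightarrow> 'x \<Rightarrow> complex) \<Rightarrow> ('x \<Rightarrow> complex) \<Rightarrow> bool" where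
  "has_L2_sum M I f s \<longleftrightarrow> s \<in> L2 M \<and> (\<forall>i\<in>I. f i \<in> L2 M) \<and>
     ((\<lambda>X. L2_norm M (\<lambda>x. (\<Sum>i\<in>X. f i x) - s x)) \<longlongrightarrow> 0) (finite_subsets_at_top I)"

definition L2_closed_span ::
  "'x measure \<Rightarrow> 'i set \<Rightarrow> ('i \<Rightarrow> 'x \<Rightarrow> complex) \<Rightarrow> ('x \<Rightarrow> complex) set" where
  "L2_closed_span M I f = {u \<in> L2 M. \<forall>e>0. \<exists>X c. finite X \<and> X \<subseteq> I \<and>
     L2_norm M (\<lambda>x. u x - (\<Sum>i\<in>X. c i * f i x)) < e}"

definition riesz_sequence :: "'x measure \<Rightarrow> 'i set \<Rightarrow> ('i \<Rightarrow> 'x \<Rightarrow> complex) \<Rightarrow> bool" where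
  "riesz_sequence M I f \<longleftrightarrow> (\<forall>i\<in>I. f i \<in> L2 M) \<and>
     (\<exists>A>0. \<exists>B>0. \<forall>X c. finite X \<and> X \<subseteq> I \<longrightarrow>
        A * (\<Sum>i\<in>X. (cmod (c i))\<^sup>2) \<le> (L2_norm M (\<lambda>x. \<Sum>i\<in>X. c i * f i x))\<^sup>2 \<and>
        (L2_norm M (\<lambda>x. \<Sum>i\<in>X. c i * f i x))\<^sup>2 \<le> B * (\<Sum>i\<in>X. (cmod (c i))\<^sup>2))"

text \<open>Here \<open>V\<close> is a closed subspace, given as the set of all representatives of its elements.\<close>

definition riesz_basis ::
  "'x measure \<Rightarrow> 'i set \<Rightarrow> ('i \<Rightarrow> 'x \<Rightarrow> complex) \<Rightarrow> ('x \<Rightarrow> complex) set \<Rightarrow> bool" where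
  "riesz_basis M I f V \<longleftrightarrow> riesz_sequence M I f \<and> L2_closed_span M I f = V"

definition essinf :: "'x measure \<Rightarrow> ('x \<Rightarrow> ereal) \<Rightarrow> ereal" where
  "essinf M f = - esssup M (\<lambda>x. - f x)"

section \<open>Haar measure, uniform lattices and the dual group\<close>

text \<open>On a second countable locally compact Hausdorff space, every Borel measure that is finite on
  compact sets is regular, so regularity need not be required.\<close>

definition haar_measure :: "'g::topological_ab_group_add measure \<Rightarrow> bool" where
  "haar_measure M \<longleftrightarrow> sets M = sets borel \<and> emeasure M UNIV \<noteq> 0 \<and>
     (\<forall>K. compact K \<longrightarrow> emeasure M K < \<infinity>) \<and>
     (\<forall>g. \<forall>A\<in>sets M. emeasure M ((\<lambda>x. g + x) ` A) = emeasure M A)"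

definition coset :: "'g::topological_ab_group_add set \<Rightarrow> 'g \<Rightarrow> 'g set" where
  "coset H g = (\<lambda>h. g + h) ` H"

definition quotient_topology :: "'g::topological_ab_group_add set \<Rightarrow> 'g set topology" where
  "quotient_topology H = topology (\<lambda>U. U \<subseteq> range (coset H) \<and> open (coset H -` U))"

lemma openin_quotient_topology:
  "openin (quotient_topology H) U \<longleftrightarrow> U \<subseteq> range (coset H) \<and> open (coset H -` U)"
proof -
  have "istopology (\<lambda>U. U \<subseteq> range (coset H) \<and> open (coset H -` U))"
    unfolding istopology_def by (auto simp: vimage_Union)
  then show ?thesis
    by (simp add: quotient_topology_def)
qed

definition uniform_lattice :: "'g::topological_ab_group_add set \<Rightarrow> bool" where
  "uniform_lattice H \<longleftrightarrow> 0 \<in> H \<and> (\<forall>h\<in>H. \<forall>k\<in>H. h + k \<in> H) \<and> (\<forall>h\<in>H. - h \<in> H) \<and>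
     discrete H \<and> compact_space (quotient_topology H)"

text \<open>Characters of \<open>H\<close> are made \<open>undefined\<close> outside \<open>H\<close>, so that distinct functions are
  distinct characters.\<close>

definition dual_group :: "'g::topological_ab_group_add set \<Rightarrow> ('g \<Rightarrow> complex) set" where
  "dual_group H = {\<gamma> \<in> extensional H. continuous_on H \<gamma> \<and> (\<forall>h\<in>H. cmod (\<gamma> h) = 1) \<and>
     (\<forall>h\<in>H. \<forall>k\<in>H. \<gamma> (h + k) = \<gamma> h * \<gamma> k)}"

text \<open>As \<open>H\<close> is discrete, the compact-open topology is that of pointwise convergence on \<open>H\<close>.\<close>

definition dual_topology :: "'g::topological_ab_group_add set \<Rightarrow> ('g \<Rightarrow> complex) topology" where
  "dual_topology H = subtopology (product_topology (\<lambda>_. euclidean) H) (dual_group H)"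

text \<open>Regularity is again automatic, as \<open>H\<close> is countable and hence its dual metrizable.\<close>

definition normalized_dual_haar_measure ::
  "'g::topological_ab_group_add set \<Rightarrow> ('g \<Rightarrow> complex) measure \<Rightarrow> bool" where
  "normalized_dual_haar_measure H \<nu> \<longleftrightarrow> space \<nu> = dual_group H \<and>
     sets \<nu> = sigma_sets (dual_group H) {U. openin (dual_topology H) U} \<and>
     emeasure \<nu> (dual_group H) = 1 \<and>
     (\<forall>\<gamma>\<in>dual_group H. \<forall>A\<in>sets \<nu>.
        emeasure \<nu> ((\<lambda>\<eta>. restrict (\<lambda>h. \<gamma> h * \<eta> h) H) ` A) = emeasure \<nu> A)"

section \<open>Shift-invariant spaces and sampling\<close>

definition translate :: "'g::topological_ab_group_add \<Rightarrow> ('g \<Rightarrow> complex) \<Rightarrow> 'g \<Rightarrow> complex" where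
  "translate h f = (\<lambda>g. f (g - h))"

definition shift_space ::
  "'g::topological_ab_group_add measure \<Rightarrow> 'g set \<Rightarrow> ('g \<Rightarrow> complex) \<Rightarrow> ('g \<Rightarrow> complex) set" where
  "shift_space M H a = L2_closed_span M H (\<lambda>h. translate h a)"

text \<open>A Haar measure is positive on nonempty open sets, so a continuous representative is unique.
  Point values of elements of the shift-invariant space refer to it.\<close>

definition continuous_shift_space ::
  "'g::topological_ab_group_add measure \<Rightarrow> 'g set \<Rightarrow> ('g \<Rightarrow> complex) \<Rightarrow> ('g \<Rightarrow> complex) set" where
  "continuous_shift_space M H a = {x \<in> shift_space M H a. continuous_on UNIV x}"

definition generates_continuous_shift_space ::
  "'g::topological_ab_group_add measure \<Rightarrow> 'g set \<Rightarrow> ('g \<Rightarrow> complex) \<Rightarrow> bool" where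
  "generates_continuous_shift_space M H a \<longleftrightarrow>
     a \<in> L2 M \<and> riesz_sequence M H (\<lambda>h. translate h a) \<and> continuous_on UNIV a \<and>
     (\<forall>g. (\<lambda>h. (cmod (a (g - h)))\<^sup>2) summable_on H) \<and>
     bdd_above (range (\<lambda>g. \<Sum>\<^sub>\<infinity>h\<in>H. (cmod (a (g - h)))\<^sup>2))"

text \<open>A representative of the \<open>L\<^sup>2\<close>-sum of \<open>a (g\<^sub>0 + h)\<close> times the character value at \<open>h\<close>,
  which is determined up to almost everywhere equality.\<close>

definition sampling_symbol ::
  "('g::topological_ab_group_add \<Rightarrow> complex) measure \<Rightarrow> 'g set \<Rightarrow> ('g \<Rightarrow> complex) \<Rightarrow> 'g \<Rightarrow>
   ('g \<Rightarrow> complex) \<Rightarrow> complex" where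
  "sampling_symbol \<nu> H a g\<^sub>0 = (SOME F. has_L2_sum \<nu> H (\<lambda>h \<gamma>. a (g\<^sub>0 + h) * \<gamma> h) F)"

definition sampling_function ::
  "'g::topological_ab_group_add measure \<Rightarrow> 'g set \<Rightarrow> ('g \<Rightarrow> complex) \<Rightarrow> 'g \<Rightarrow>
   ('g \<Rightarrow> complex) \<Rightarrow> bool" where
  "sampling_function M H a g\<^sub>0 S \<longleftrightarrow>
     S \<in> continuous_shift_space M H a \<and>
     riesz_basis M H (\<lambda>m. translate m S) (shift_space M H a) \<and>
     (\<forall>x\<in>continuous_shift_space M H a.
        has_L2_sum M H (\<lambda>m g. x (g\<^sub>0 + m) * S (g - m)) x)"

end

theory Submission
  imports Defs "HOL-Probability.Probability_Measure"
begin

text \<open>Write \<open>G\<close> for the symbol and \<open>\<chi>\<^sub>h\<close> for the evaluation of characters at \<open>h\<close>. A finitely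
  supported coefficient family \<open>c\<close> defines a function \<open>p = \<Sum>c\<^sub>h a (\<cdot> - h)\<close> on the group and a
  trigonometric polynomial \<open>P = \<Sum>c\<^sub>h \<chi>\<^sub>h\<close> on the dual of \<open>H\<close>. The Riesz condition says that the
  \<open>L\<^sup>2\<close>-norms of \<open>p\<close> and \<open>P\<close> are equivalent. The samples \<open>p (g\<^sub>0 + m)\<close> are the convolution of
  \<open>c\<close> with \<open>a (g\<^sub>0 + \<cdot>)\<close>, so they are the Fourier coefficients of \<open>P G\<close>, and Parseval's identity
  gives \<open>\<Sum>\<^sub>m \<bar>p (g\<^sub>0 + m)\<bar>\<^sup>2 = \<integral> \<bar>P\<bar>\<^sup>2 \<bar>G\<bar>\<^sup>2\<close> (\<open>samples_isometry\<close>). Hence sampling is bounded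
  above and below exactly when multiplication by \<open>G\<close> is.

  If \<open>\<bar>G\<bar>\<close> is essentially bounded above and away from zero, sampling is a norm equivalence from the
  continuous elements of the space to square-summable families (\<open>samples_frame\<close>).
  Approximating \<open>1 / G\<close> by trigonometric polynomials produces a continuous element \<open>S\<close> whose
  samples are those of the unit at \<open>0\<close> (\<open>interpolating_function_exists\<close>). A combination of
  translates of \<open>S\<close> has its own coefficients as samples, and so the norm equivalence is the Riesz
  property of these translates and yields convergence of the sampling series.

  Conversely, if the translates of some \<open>S\<close> form a Riesz basis for which the sampling formula holds,
  then the samples are coefficients with respect to that basis, so that multiplication by \<open>G\<close> is
  bounded above and below on trigonometric polynomials (\<open>symbol_multiplication_bounds\<close>).
  These are dense in \<open>L\<^sup>2\<close> of the dual with the weight \<open>1 + \<bar>G\<bar>\<^sup>2\<close>, and testing on indicators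
  turns the two inequalities into essential bounds of \<open>\<bar>G\<bar>\<close>.

  Uniform convergence comes from the uniform bound on \<open>\<Sum>\<^sub>h \<bar>a (g - h)\<bar>\<^sup>2\<close>, by which the supremum
  norm of a continuous element is at most a constant times its \<open>L\<^sup>2\<close>-norm (\<open>CS_sup_bound\<close>).

  Two facts about the dual group have to be supplied: its elements separate the points of \<open>H\<close>, which
  makes the \<open>\<chi>\<^sub>h\<close> orthonormal, and trigonometric polynomials are dense in \<open>L\<^sup>2\<close> of every finite
  Borel measure on it (\<open>bounded_in_trig_closure\<close>).\<close>

section \<open>Square-integrable functions as a seminormed space\<close>

lemma L2_measurable [measurable_dest]: "f \<in> L2 M \<Longrightarrow> f \<in> borel_measurable M"
  by (simp add: L2_def)

lemma L2_integrable: "f \<in> L2 M \<Longrightarrow> integrable M (\<lambda>x. (cmod (f x))\<^sup>2)"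
  by (simp add: L2_def)

lemma L2_norm_nonneg [simp]: "0 \<le> L2_norm M f"
  by (simp add: L2_norm_def)

lemma L2_norm_square: "(L2_norm M f)\<^sup>2 = (\<integral>x. (cmod (f x))\<^sup>2 \<partial>M)"
  by (simp add: L2_norm_def)

lemma L2_zero [simp]: "(\<lambda>x. 0) \<in> L2 M"
  by (simp add: L2_def)

lemma L2_norm_zero [simp]: "L2_norm M (\<lambda>x. 0) = 0"
  by (simp add: L2_norm_def)

lemma L2_norm_minus_commute: "L2_norm M (\<lambda>x. f x - g x) = L2_norm M (\<lambda>x. g x - f x)"
  by (simp add: L2_norm_def norm_minus_commute)

lemma L2_cmult [intro]: "f \<in> L2 M \<Longrightarrow> (\<lambda>x. c * f x) \<in> L2 M"
  by (auto simp: L2_def norm_mult power_mult_distrib)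

lemma L2_norm_cmult: "L2_norm M (\<lambda>x. c * f x) = cmod c * L2_norm M f"
  by (simp add: L2_norm_def norm_mult power_mult_distrib real_sqrt_mult)

lemma L2_add [intro]:
  assumes "f \<in> L2 M" "g \<in> L2 M"
  shows "(\<lambda>x. f x + g x) \<in> L2 M"
proof -
  note [measurable] = assms[THEN L2_measurable]
  have "integrable M (\<lambda>x. (cmod (f x + g x))\<^sup>2)"
  proof (rule Bochner_Integration.integrable_bound)
    show "integrable M (\<lambda>x. 2 * (cmod (f x))\<^sup>2 + 2 * (cmod (g x))\<^sup>2)"
      by (intro Bochner_Integration.integrable_add integrable_mult_right L2_integrable assms)
    have "(cmod (f x + g x))\<^sup>2 \<le> 2 * (cmod (f x))\<^sup>2 + 2 * (cmod (g x))\<^sup>2" for x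
    proof -
      have "(cmod (f x + g x))\<^sup>2 \<le> (cmod (f x) + cmod (g x))\<^sup>2"
        by (simp add: norm_triangle_ineq)
      also have "\<dots> \<le> 2 * (cmod (f x))\<^sup>2 + 2 * (cmod (g x))\<^sup>2"
        using sum_squares_bound[of "cmod (f x)" "cmod (g x)"] by (simp add: power2_sum)
      finally show ?thesis .
    qed
    then show "AE x in M. norm ((cmod (f x + g x))\<^sup>2) \<le> norm (2 * (cmod (f x))\<^sup>2 + 2 * (cmod (g x))\<^sup>2)"
      by simp
  qed simp
  then show ?thesis
    by (simp add: L2_def)
qed

lemma L2_diff [intro]:
  assumes "f \<in> L2 M" "g \<in> L2 M"
  shows "(\<lambda>x. f x - g x) \<in> L2 M"
  using L2_add[OF assms(1) L2_cmult[OF assms(2), of "-1"]] by simp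

lemma L2_sum [intro]: "(\<And>i. i \<in> X \<Longrightarrow> f i \<in> L2 M) \<Longrightarrow> (\<lambda>x. \<Sum>i\<in>X. f i x) \<in> L2 M"
  by (induction X rule: infinite_finite_induct) auto

lemma L2_cong_AE:
  assumes "f \<in> L2 M" "g \<in> borel_measurable M" "AE x in M. f x = g x"
  shows "g \<in> L2 M"
proof -
  note [measurable] = L2_measurable[OF assms(1)] assms(2)
  have "integrable M (\<lambda>x. (cmod (g x))\<^sup>2) = integrable M (\<lambda>x. (cmod (f x))\<^sup>2)"
    by (rule integrable_cong_AE) (use assms(3) in auto)
  then show ?thesis
    using assms by (simp add: L2_def)
qed

lemma L2_norm_mono_AE:
  assumes "g \<in> L2 M" "f \<in> L2 M" "AE x in M. cmod (f x) \<le> C * cmod (g x)" "0 \<le> C"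
  shows "L2_norm M f \<le> C * L2_norm M g"
proof -
  have "(\<integral>x. (cmod (f x))\<^sup>2 \<partial>M) \<le> (\<integral>x. C\<^sup>2 * (cmod (g x))\<^sup>2 \<partial>M)"
  proof (rule integral_mono_AE)
    show "AE x in M. (cmod (f x))\<^sup>2 \<le> C\<^sup>2 * (cmod (g x))\<^sup>2"
      using assms(3)
    proof eventually_elim
      case (elim x)
      then show ?case
        using power_mono[OF elim norm_ge_zero, of 2] by (simp add: power_mult_distrib)
    qed
  qed (use assms in \<open>auto intro: L2_integrable\<close>)
  then have "(L2_norm M f)\<^sup>2 \<le> (C * L2_norm M g)\<^sup>2"
    by (simp add: L2_norm_square power_mult_distrib)
  then show ?thesis
    by (rule power2_le_imp_le) (use assms(4) in simp)
qed

lemma L2_mult_bounded: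
  assumes "f \<in> borel_measurable M" "g \<in> L2 M" "AE x in M. cmod (f x) \<le> C"
  shows "(\<lambda>x. f x * g x) \<in> L2 M"
proof -
  note [measurable] = assms(1) L2_measurable[OF assms(2)]
  have "integrable M (\<lambda>x. (cmod (f x * g x))\<^sup>2)"
  proof (rule Bochner_Integration.integrable_bound)
    show "integrable M (\<lambda>x. C\<^sup>2 * (cmod (g x))\<^sup>2)"
      using assms by (auto intro: L2_integrable)
    show "AE x in M. norm ((cmod (f x * g x))\<^sup>2) \<le> norm (C\<^sup>2 * (cmod (g x))\<^sup>2)"
      using assms(3)
    proof eventually_elim
      case (elim x)
      then have "(cmod (f x))\<^sup>2 \<le> C\<^sup>2"
        by (simp add: power_mono)
      then show ?case
        by (simp add: norm_mult power_mult_distrib mult_right_mono)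
    qed
  qed simp
  then show ?thesis
    by (simp add: L2_def)
qed

lemma L2_norm_mult_bounded_le:
  assumes "f \<in> borel_measurable M" "g \<in> L2 M" "AE x in M. cmod (f x) \<le> C" "0 \<le> C"
  shows "L2_norm M (\<lambda>x. f x * g x) \<le> C * L2_norm M g"
proof (rule L2_norm_mono_AE)
  show "AE x in M. cmod (f x * g x) \<le> C * cmod (g x)"
    using assms(3) by eventually_elim (simp add: norm_mult mult_right_mono)
qed (use assms L2_mult_bounded in auto)

text \<open>Cauchy--Schwarz, in the form in which it is used for Minkowski's inequality.\<close>

lemma integral_mult_le_L2_norm:
  assumes "f \<in> L2 M" "g \<in> L2 M"
  shows "integrable M (\<lambda>x. cmod (f x) * cmod (g x))"
    and "(\<integral>x. cmod (f x) * cmod (g x) \<partial>M) \<le> L2_norm M f * L2_norm M g"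
proof -
  note [measurable] = assms[THEN L2_measurable]
  show int: "integrable M (\<lambda>x. cmod (f x) * cmod (g x))"
  proof (rule Bochner_Integration.integrable_bound)
    show "integrable M (\<lambda>x. (cmod (f x))\<^sup>2 + (cmod (g x))\<^sup>2)"
      using assms by (auto intro: L2_integrable)
    have "cmod (f x) * cmod (g x) \<le> (cmod (f x))\<^sup>2 + (cmod (g x))\<^sup>2" for x
      using sum_squares_bound[of "cmod (f x)" "cmod (g x)"]
        mult_nonneg_nonneg[OF norm_ge_zero norm_ge_zero, of "f x" "g x"] by linarith
    then show "AE x in M. norm (cmod (f x) * cmod (g x)) \<le> norm ((cmod (f x))\<^sup>2 + (cmod (g x))\<^sup>2)"
      by simp
  qed simp
  have sq: "(\<integral>\<^sup>+x. ennreal (cmod (u x)) ^ 2 \<partial>M) = ennreal ((L2_norm M u)\<^sup>2)" if "u \<in> L2 M" for u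
    using that by (simp add: L2_norm_square ennreal_power nn_integral_eq_integral L2_integrable)
  have "ennreal ((\<integral>x. cmod (f x) * cmod (g x) \<partial>M)\<^sup>2)
      = (\<integral>\<^sup>+x. ennreal (cmod (f x)) * ennreal (cmod (g x)) \<partial>M)\<^sup>2"
    using int by (simp add: ennreal_mult[symmetric] nn_integral_eq_integral ennreal_power)
  also have "\<dots> \<le> (\<integral>\<^sup>+x. ennreal (cmod (f x)) ^ 2 \<partial>M) * (\<integral>\<^sup>+x. ennreal (cmod (g x)) ^ 2 \<partial>M)"
    by (rule Cauchy_Schwarz_nn_integral) auto
  also have "\<dots> = ennreal ((L2_norm M f * L2_norm M g)\<^sup>2)"
    using assms by (simp add: sq ennreal_mult[symmetric] power_mult_distrib)
  finally have "(\<integral>x. cmod (f x) * cmod (g x) \<partial>M)\<^sup>2 \<le> (L2_norm M f * L2_norm M g)\<^sup>2"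
    by (simp add: ennreal_le_iff)
  then show "(\<integral>x. cmod (f x) * cmod (g x) \<partial>M) \<le> L2_norm M f * L2_norm M g"
    by (rule power2_le_imp_le) simp
qed

lemma L2_norm_triangle:
  assumes "f \<in> L2 M" "g \<in> L2 M"
  shows "L2_norm M (\<lambda>x. f x + g x) \<le> L2_norm M f + L2_norm M g"
proof -
  note int = integral_mult_le_L2_norm[OF assms]
  have "(L2_norm M (\<lambda>x. f x + g x))\<^sup>2
      \<le> (\<integral>x. (cmod (f x))\<^sup>2 + (cmod (g x))\<^sup>2 + 2 * (cmod (f x) * cmod (g x)) \<partial>M)"
    unfolding L2_norm_square
  proof (rule integral_mono)
    show "(cmod (f x + g x))\<^sup>2 \<le> (cmod (f x))\<^sup>2 + (cmod (g x))\<^sup>2 + 2 * (cmod (f x) * cmod (g x))" for x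
      using power_mono[OF norm_triangle_ineq[of "f x" "g x"] norm_ge_zero, of 2]
      by (simp add: power2_sum)
  qed (use assms L2_add[OF assms] int(1) in \<open>auto intro!: L2_integrable\<close>)
  also have "\<dots> = (L2_norm M f)\<^sup>2 + (L2_norm M g)\<^sup>2 + 2 * (\<integral>x. cmod (f x) * cmod (g x) \<partial>M)"
    using assms int(1) by (simp add: L2_norm_square L2_integrable)
  also have "\<dots> \<le> (L2_norm M f + L2_norm M g)\<^sup>2"
    using int(2) by (simp add: power2_sum)
  finally show ?thesis
    by (rule power2_le_imp_le) simp
qed

lemma L2_norm_triangle_diff:
  assumes "f \<in> L2 M" "g \<in> L2 M" "h \<in> L2 M"
  shows "L2_norm M (\<lambda>x. f x - h x) \<le> L2_norm M (\<lambda>x. f x - g x) + L2_norm M (\<lambda>x. g x - h x)"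
  using L2_norm_triangle[OF L2_diff[OF assms(1,2)] L2_diff[OF assms(2,3)]] by simp

lemma L2_norm_diff_ge:
  assumes "f \<in> L2 M" "g \<in> L2 M"
  shows "\<bar>L2_norm M f - L2_norm M g\<bar> \<le> L2_norm M (\<lambda>x. f x - g x)"
  using L2_norm_triangle[OF L2_diff[OF assms] assms(2)]
    L2_norm_triangle[OF L2_diff[OF assms(2,1)] assms(1)]
  by (simp add: L2_norm_minus_commute[of M g f])

lemma L2_norm_tendsto:
  assumes "\<And>n. u n \<in> L2 M" "f \<in> L2 M"
    and "((\<lambda>n. L2_norm M (\<lambda>x. u n x - f x)) \<longlongrightarrow> 0) F"
  shows "((\<lambda>n. L2_norm M (u n)) \<longlongrightarrow> L2_norm M f) F"
proof (rule LIM_zero_cancel, rule Lim_null_comparison[OF _ assms(3)])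
  show "\<forall>\<^sub>F n in F. norm (L2_norm M (u n) - L2_norm M f) \<le> L2_norm M (\<lambda>x. u n x - f x)"
    using assms by (simp add: L2_norm_diff_ge)
qed

lemma L2_convergent_Cauchy:
  assumes u: "\<And>n. u n \<in> L2 M" and f: "f \<in> L2 M"
    and lim: "(\<lambda>n. L2_norm M (\<lambda>x. u n x - f x)) \<longlonglongrightarrow> 0" and e: "0 < e"
  shows "\<exists>N. \<forall>m\<ge>N. \<forall>n\<ge>N. L2_norm M (\<lambda>x. u m x - u n x) < e"
proof -
  obtain N where N: "\<And>n. n \<ge> N \<Longrightarrow> L2_norm M (\<lambda>x. u n x - f x) < e / 2"
    using LIMSEQ_D[OF lim, of "e / 2"] e by auto
  have "L2_norm M (\<lambda>x. u m x - u n x) < e" if mn: "m \<ge> N" "n \<ge> N" for m n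
    using L2_norm_triangle_diff[OF u[of m] f u[of n]] N[OF mn(1)] N[OF mn(2)]
      L2_norm_minus_commute[of M f "u n"] by linarith
  then show ?thesis
    by blast
qed

lemma L2_norm_eq_0_AE:
  assumes "f \<in> L2 M" "L2_norm M f = 0"
  shows "AE x in M. f x = 0"
proof -
  have "(\<integral>x. (cmod (f x))\<^sup>2 \<partial>M) = 0"
    using assms(2) by (simp add: L2_norm_def)
  then show ?thesis
    using assms(1) by (subst (asm) integral_nonneg_eq_0_iff_AE) (auto intro: L2_integrable)
qed

text \<open>By Fatou's lemma, an almost everywhere limit of an \<open>L\<^sup>2\<close>-Cauchy sequence is also its
  limit in \<open>L\<^sup>2\<close>.\<close>

lemma L2_Cauchy_limit:
  assumes u: "\<And>n. u n \<in> L2 M" and f [measurable]: "f \<in> borel_measurable M"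
    and lim: "AE x in M. (\<lambda>n. u n x) \<longlonglongrightarrow> f x"
    and Cauchy: "\<And>e. 0 < e \<Longrightarrow> \<exists>N. \<forall>m\<ge>N. \<forall>n\<ge>N. L2_norm M (\<lambda>x. u m x - u n x) < e"
  shows "f \<in> L2 M" and "(\<lambda>n. L2_norm M (\<lambda>x. u n x - f x)) \<longlonglongrightarrow> 0"
proof -
  note [measurable] = L2_measurable[OF u]
  have sq: "(\<integral>\<^sup>+x. ennreal ((cmod (v x))\<^sup>2) \<partial>M) = ennreal ((L2_norm M v)\<^sup>2)" if "v \<in> L2 M" for v
    using that by (simp add: L2_norm_square nn_integral_eq_integral L2_integrable)
  have tail: "(\<lambda>x. u m x - f x) \<in> L2 M \<and> L2_norm M (\<lambda>x. u m x - f x) \<le> e"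
    if e: "0 < e" and N: "\<forall>m\<ge>N. \<forall>n\<ge>N. L2_norm M (\<lambda>x. u m x - u n x) < e" and m: "m \<ge> N" for e N m
  proof -
    have "(\<integral>\<^sup>+x. ennreal ((cmod (u m x - f x))\<^sup>2) \<partial>M)
        = (\<integral>\<^sup>+x. liminf (\<lambda>n. ennreal ((cmod (u m x - u n x))\<^sup>2)) \<partial>M)"
    proof (rule nn_integral_cong_AE)
      show "AE x in M. ennreal ((cmod (u m x - f x))\<^sup>2)
          = liminf (\<lambda>n. ennreal ((cmod (u m x - u n x))\<^sup>2))"
        using lim
      proof eventually_elim
        case (elim x)
        have "(\<lambda>n. ennreal ((cmod (u m x - u n x))\<^sup>2)) \<longlonglongrightarrow> ennreal ((cmod (u m x - f x))\<^sup>2)"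
          by (intro tendsto_intros elim)
        then show ?case
          by (rule lim_imp_Liminf[OF trivial_limit_sequentially, symmetric])
      qed
    qed
    also have "\<dots> \<le> liminf (\<lambda>n. \<integral>\<^sup>+x. ennreal ((cmod (u m x - u n x))\<^sup>2) \<partial>M)"
      by (rule nn_integral_liminf) simp
    also have "\<dots> \<le> ennreal (e\<^sup>2)"
    proof (rule Liminf_le)
      show "\<forall>\<^sub>F n in sequentially. (\<integral>\<^sup>+x. ennreal ((cmod (u m x - u n x))\<^sup>2) \<partial>M) \<le> ennreal (e\<^sup>2)"
        using eventually_ge_at_top[of N]
      proof eventually_elim
        case (elim n)
        have "L2_norm M (\<lambda>x. u m x - u n x) \<le> e"
          using N m elim by (auto intro: less_imp_le)
        then show ?case
          using u by (simp add: sq L2_diff power_mono ennreal_leI)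
      qed
    qed simp
    finally have le: "(\<integral>\<^sup>+x. ennreal ((cmod (u m x - f x))\<^sup>2) \<partial>M) \<le> ennreal (e\<^sup>2)" .
    then have "(\<lambda>x. u m x - f x) \<in> L2 M"
      by (auto simp: L2_def integrable_iff_bounded intro: le_less_trans)
    moreover from this have "(L2_norm M (\<lambda>x. u m x - f x))\<^sup>2 \<le> e\<^sup>2"
      using le by (simp add: sq ennreal_le_iff)
    then have "L2_norm M (\<lambda>x. u m x - f x) \<le> e"
      by (rule power2_le_imp_le) (use e in simp)
    ultimately show ?thesis ..
  qed
  obtain N where "\<forall>m\<ge>N. \<forall>n\<ge>N. L2_norm M (\<lambda>x. u m x - u n x) < 1"
    using Cauchy[of 1] by auto
  then have "(\<lambda>x. u N x - f x) \<in> L2 M"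
    using tail[of 1 N N] by simp
  then have "(\<lambda>x. u N x - (u N x - f x)) \<in> L2 M"
    by (rule L2_diff[OF u])
  then show "f \<in> L2 M"
    by simp
  show "(\<lambda>n. L2_norm M (\<lambda>x. u n x - f x)) \<longlonglongrightarrow> 0"
  proof (rule LIMSEQ_I)
    fix e :: real assume "0 < e"
    then obtain N where "\<forall>m\<ge>N. \<forall>n\<ge>N. L2_norm M (\<lambda>x. u m x - u n x) < e / 2"
      using Cauchy[of "e / 2"] by auto
    then have "L2_norm M (\<lambda>x. u m x - f x) \<le> e / 2" if "m \<ge> N" for m
      using tail[of "e / 2" N m] that \<open>0 < e\<close> by simp
    then show "\<exists>N. \<forall>n\<ge>N. norm (L2_norm M (\<lambda>x. u n x - f x) - 0) < e"
      using \<open>0 < e\<close> by (intro exI[of _ N]) (fastforce intro: le_less_trans)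
  qed
qed

text \<open>On a finite measure space \<open>L\<^sup>2\<close>-convergence implies \<open>L\<^sup>1\<close>-convergence, so that completeness of
  \<open>L\<^sup>2\<close> reduces to almost everywhere convergence of a subsequence of an \<open>L\<^sup>1\<close>-Cauchy sequence.\<close>

lemma L2_complete:
  assumes "finite_measure M" and u: "\<And>n. u n \<in> L2 M"
    and Cauchy: "\<And>e. 0 < e \<Longrightarrow> \<exists>N. \<forall>m\<ge>N. \<forall>n\<ge>N. L2_norm M (\<lambda>x. u m x - u n x) < e"
  obtains f where "f \<in> L2 M" "(\<lambda>n. L2_norm M (\<lambda>x. u n x - f x)) \<longlonglongrightarrow> 0"
proof -
  interpret finite_measure M by fact
  note [measurable] = L2_measurable[OF u]
  define C where "C = L2_norm M (\<lambda>_. 1)"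
  have one: "(\<lambda>_. 1) \<in> L2 M"
    by (simp add: L2_def)
  have L1: "integrable M v" "(\<integral>x. cmod (v x) \<partial>M) \<le> L2_norm M v * C" if "v \<in> L2 M" for v
  proof -
    have [measurable]: "v \<in> borel_measurable M"
      using that by (rule L2_measurable)
    show "integrable M v"
      using integral_mult_le_L2_norm(1)[OF that one] by (subst integrable_norm_iff[symmetric]) simp_all
    show "(\<integral>x. cmod (v x) \<partial>M) \<le> L2_norm M v * C"
      using integral_mult_le_L2_norm(2)[OF that one] by (simp add: C_def)
  qed
  have "\<exists>N. \<forall>i\<ge>N. \<forall>j\<ge>N. (LINT x|M. norm (u i x - u j x)) < e" if e: "0 < e" for e
  proof -
    have "0 \<le> C"
      by (simp add: C_def)
    then obtain N where N: "\<forall>m\<ge>N. \<forall>n\<ge>N. L2_norm M (\<lambda>x. u m x - u n x) < e / (C + 1)"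
      using Cauchy[of "e / (C + 1)"] e by auto
    have "(LINT x|M. norm (u i x - u j x)) < e" if "i \<ge> N" "j \<ge> N" for i j
    proof -
      have "(LINT x|M. norm (u i x - u j x)) \<le> L2_norm M (\<lambda>x. u i x - u j x) * C"
        using L1(2)[OF L2_diff[OF u u]] by simp
      also have "\<dots> \<le> L2_norm M (\<lambda>x. u i x - u j x) * (C + 1)"
        by (simp add: mult_left_mono)
      also have "\<dots> < e"
        using N that \<open>0 \<le> C\<close> by (simp add: field_simps)
      finally show ?thesis .
    qed
    then show ?thesis
      by blast
  qed
  then obtain r where r: "strict_mono r" "AE x in M. Cauchy (\<lambda>i. u (r i) x)"
    by (rule cauchy_L1_AE_cauchy_subseq[OF L1(1)[OF u]])
  define f where "f x = lim (\<lambda>i. u (r i) x)" for x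
  have f: "f \<in> borel_measurable M"
    unfolding f_def by measurable
  have "AE x in M. (\<lambda>i. u (r i) x) \<longlonglongrightarrow> f x"
    using r(2) by eventually_elim (simp add: f_def Cauchy_convergent_iff convergent_LIMSEQ_iff)
  moreover have "\<exists>N. \<forall>m\<ge>N. \<forall>n\<ge>N. L2_norm M (\<lambda>x. u (r m) x - u (r n) x) < e" if "0 < e" for e
    using Cauchy[OF that] seq_suble[OF r(1)] by (meson le_trans)
  ultimately have lim: "f \<in> L2 M" "(\<lambda>n. L2_norm M (\<lambda>x. u (r n) x - f x)) \<longlonglongrightarrow> 0"
    using L2_Cauchy_limit[of "\<lambda>n. u (r n)" M f] u f by blast+
  have "(\<lambda>n. L2_norm M (\<lambda>x. u n x - f x)) \<longlonglongrightarrow> 0"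
  proof (rule LIMSEQ_I)
    fix e :: real assume "0 < e"
    then obtain N where N: "\<forall>m\<ge>N. \<forall>n\<ge>N. L2_norm M (\<lambda>x. u m x - u n x) < e / 2"
      using Cauchy[of "e / 2"] by auto
    obtain K where K: "L2_norm M (\<lambda>x. u (r n) x - f x) < e / 2" if "n \<ge> K" for n
      using LIMSEQ_D[OF lim(2), of "e / 2"] \<open>0 < e\<close> by auto
    have "L2_norm M (\<lambda>x. u n x - f x) < e" if "n \<ge> N" for n
    proof -
      have "r (max K N) \<ge> N"
        using seq_suble[OF r(1), of "max K N"] by simp
      then show ?thesis
        using L2_norm_triangle_diff[OF u[of n] u[of "r (max K N)"] lim(1)] K[of "max K N"] N that
        by fastforce
    qed
    then show "\<exists>N. \<forall>n\<ge>N. norm (L2_norm M (\<lambda>x. u n x - f x) - 0) < e"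
      by auto
  qed
  with lim(1) show ?thesis
    by (rule that)
qed

section \<open>Finite linear combinations, closed spans and Riesz sequences\<close>

text \<open>Finite combinations are indexed by finitely supported families, so that one and the same family
  can be applied to translates on the group and to characters on the dual.\<close>

definition fin_coeffs :: "'i set \<Rightarrow> ('i \<Rightarrow> complex) set" where
  "fin_coeffs I = {c. finite {i. c i \<noteq> 0} \<and> {i. c i \<noteq> 0} \<subseteq> I}"

definition lincomb :: "('i \<Rightarrow> 'x \<Rightarrow> complex) \<Rightarrow> ('i \<Rightarrow> complex) \<Rightarrow> 'x \<Rightarrow> complex" where
  "lincomb f c x = (\<Sum>i | c i \<noteq> 0. c i * f i x)"

definition coeff_norm2 :: "('i \<Rightarrow> complex) \<Rightarrow> real" where
  "coeff_norm2 c = (\<Sum>i | c i \<noteq> 0. (cmod (c i))\<^sup>2)"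

definition cutoff :: "('i \<Rightarrow> complex) \<Rightarrow> 'i set \<Rightarrow> 'i \<Rightarrow> complex" where
  "cutoff c X i = (if i \<in> X then c i else 0)"

lemma lincomb_eq_sum:
  assumes "finite X" "\<And>i. i \<notin> X \<Longrightarrow> c i = 0"
  shows "lincomb f c x = (\<Sum>i\<in>X. c i * f i x)"
  unfolding lincomb_def using assms by (intro sum.mono_neutral_left) auto

lemma coeff_norm2_eq_sum:
  assumes "finite X" "\<And>i. i \<notin> X \<Longrightarrow> c i = 0"
  shows "coeff_norm2 c = (\<Sum>i\<in>X. (cmod (c i))\<^sup>2)"
  unfolding coeff_norm2_def using assms by (intro sum.mono_neutral_left) auto

lemma fin_coeffs_finite: "c \<in> fin_coeffs I \<Longrightarrow> finite {i. c i \<noteq> 0}"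
  by (simp add: fin_coeffs_def)

lemma fin_coeffsI:
  assumes "finite X" "X \<subseteq> I" "\<And>i. i \<notin> X \<Longrightarrow> c i = 0"
  shows "c \<in> fin_coeffs I"
proof -
  have "{i. c i \<noteq> 0} \<subseteq> X"
    using assms(3) by blast
  then show ?thesis
    using assms(1,2) by (auto simp: fin_coeffs_def intro: finite_subset)
qed

lemma fin_coeffs_add:
  assumes "c \<in> fin_coeffs I" "d \<in> fin_coeffs I"
  shows "(\<lambda>i. c i + d i) \<in> fin_coeffs I"
    and "lincomb f (\<lambda>i. c i + d i) = (\<lambda>x. lincomb f c x + lincomb f d x)"
proof -
  let ?X = "{i. c i \<noteq> 0} \<union> {i. d i \<noteq> 0}"
  have X: "finite ?X" "?X \<subseteq> I"
    using assms by (auto simp: fin_coeffs_def)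
  show "(\<lambda>i. c i + d i) \<in> fin_coeffs I"
    by (rule fin_coeffsI[OF X]) auto
  show "lincomb f (\<lambda>i. c i + d i) = (\<lambda>x. lincomb f c x + lincomb f d x)"
  proof
    fix x
    have eq: "lincomb f e x = (\<Sum>i\<in>?X. e i * f i x)" if "\<And>i. c i = 0 \<Longrightarrow> d i = 0 \<Longrightarrow> e i = 0" for e
      by (rule lincomb_eq_sum[OF X(1)]) (use that in auto)
    show "lincomb f (\<lambda>i. c i + d i) x = lincomb f c x + lincomb f d x"
      by (simp add: eq distrib_right sum.distrib)
  qed
qed

lemma fin_coeffs_cmult:
  assumes "c \<in> fin_coeffs I"
  shows "(\<lambda>i. k * c i) \<in> fin_coeffs I"
    and "lincomb f (\<lambda>i. k * c i) = (\<lambda>x. k * lincomb f c x)"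
proof -
  let ?X = "{i. c i \<noteq> 0}"
  have X: "finite ?X" "?X \<subseteq> I"
    using assms by (auto simp: fin_coeffs_def)
  show "(\<lambda>i. k * c i) \<in> fin_coeffs I"
    by (rule fin_coeffsI[OF X]) auto
  show "lincomb f (\<lambda>i. k * c i) = (\<lambda>x. k * lincomb f c x)"
  proof
    fix x
    have "lincomb f (\<lambda>i. k * c i) x = (\<Sum>i\<in>?X. k * c i * f i x)"
      by (rule lincomb_eq_sum[OF X(1)]) simp
    then show "lincomb f (\<lambda>i. k * c i) x = k * lincomb f c x"
      by (simp add: lincomb_def sum_distrib_left mult.assoc)
  qed
qed

lemma fin_coeffs_diff:
  assumes "c \<in> fin_coeffs I" "d \<in> fin_coeffs I"
  shows "(\<lambda>i. c i - d i) \<in> fin_coeffs I"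
    and "lincomb f (\<lambda>i. c i - d i) = (\<lambda>x. lincomb f c x - lincomb f d x)"
  using fin_coeffs_add(1)[OF assms(1) fin_coeffs_cmult(1)[OF assms(2), of "-1"]]
    fin_coeffs_add(2)[OF assms(1) fin_coeffs_cmult(1)[OF assms(2), of "-1"], of f]
    fin_coeffs_cmult(2)[OF assms(2), of f "-1"] by simp_all

lemma cutoff_fin_coeffs:
  assumes "finite X" "X \<subseteq> I"
  shows "cutoff c X \<in> fin_coeffs I" "lincomb f (cutoff c X) = (\<lambda>x. \<Sum>i\<in>X. c i * f i x)"
    "coeff_norm2 (cutoff c X) = (\<Sum>i\<in>X. (cmod (c i))\<^sup>2)"
proof -
  show "cutoff c X \<in> fin_coeffs I"
    by (rule fin_coeffsI[OF assms]) (simp add: cutoff_def)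
  show "lincomb f (cutoff c X) = (\<lambda>x. \<Sum>i\<in>X. c i * f i x)"
    by (rule ext, subst lincomb_eq_sum[OF assms(1)]) (auto simp: cutoff_def intro: sum.cong)
  show "coeff_norm2 (cutoff c X) = (\<Sum>i\<in>X. (cmod (c i))\<^sup>2)"
    by (subst coeff_norm2_eq_sum[OF assms(1)]) (auto simp: cutoff_def intro: sum.cong)
qed

lemma lincomb_L2:
  assumes "c \<in> fin_coeffs I" "\<And>i. i \<in> I \<Longrightarrow> f i \<in> L2 M"
  shows "lincomb f c \<in> L2 M"
proof -
  have "(\<lambda>x. \<Sum>i | c i \<noteq> 0. c i * f i x) \<in> L2 M"
    using assms by (intro L2_sum L2_cmult) (auto simp: fin_coeffs_def)
  then show ?thesis
    by (simp add: lincomb_def[abs_def])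
qed

lemma L2_closed_span_iff:
  "u \<in> L2_closed_span M I f \<longleftrightarrow>
    u \<in> L2 M \<and> (\<forall>e>0. \<exists>c\<in>fin_coeffs I. L2_norm M (\<lambda>x. u x - lincomb f c x) < e)"
proof -
  have "(\<exists>X c. finite X \<and> X \<subseteq> I \<and> L2_norm M (\<lambda>x. u x - (\<Sum>i\<in>X. c i * f i x)) < e) \<longleftrightarrow>
      (\<exists>c\<in>fin_coeffs I. L2_norm M (\<lambda>x. u x - lincomb f c x) < e)" for e
  proof
    assume "\<exists>X c. finite X \<and> X \<subseteq> I \<and> L2_norm M (\<lambda>x. u x - (\<Sum>i\<in>X. c i * f i x)) < e"
    then obtain X c where X: "finite X" "X \<subseteq> I" "L2_norm M (\<lambda>x. u x - (\<Sum>i\<in>X. c i * f i x)) < e"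
      by blast
    then show "\<exists>c\<in>fin_coeffs I. L2_norm M (\<lambda>x. u x - lincomb f c x) < e"
      by (intro bexI[of _ "cutoff c X"]) (simp_all add: cutoff_fin_coeffs)
  next
    assume "\<exists>c\<in>fin_coeffs I. L2_norm M (\<lambda>x. u x - lincomb f c x) < e"
    then show "\<exists>X c. finite X \<and> X \<subseteq> I \<and> L2_norm M (\<lambda>x. u x - (\<Sum>i\<in>X. c i * f i x)) < e"
      by (auto simp: fin_coeffs_def lincomb_def)
  qed
  then show ?thesis
    by (simp add: L2_closed_span_def)
qed

lemma L2_closed_span_in_L2: "u \<in> L2_closed_span M I f \<Longrightarrow> u \<in> L2 M"
  by (simp add: L2_closed_span_def)

lemma L2_closed_span_closed:
  assumes f: "\<And>i. i \<in> I \<Longrightarrow> f i \<in> L2 M" and u: "u \<in> L2 M"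
    and approx: "\<And>e. 0 < e \<Longrightarrow> \<exists>v\<in>L2_closed_span M I f. L2_norm M (\<lambda>x. u x - v x) < e"
  shows "u \<in> L2_closed_span M I f"
  unfolding L2_closed_span_iff
proof (intro conjI u allI impI)
  fix e :: real assume "0 < e"
  then obtain v where v: "v \<in> L2_closed_span M I f" "L2_norm M (\<lambda>x. u x - v x) < e / 2"
    using approx[of "e / 2"] by auto
  then obtain c where c: "c \<in> fin_coeffs I" "L2_norm M (\<lambda>x. v x - lincomb f c x) < e / 2"
    using \<open>0 < e\<close> unfolding L2_closed_span_iff by (meson half_gt_zero)
  have "L2_norm M (\<lambda>x. u x - lincomb f c x) < e"
    using L2_norm_triangle_diff[OF u L2_closed_span_in_L2[OF v(1)] lincomb_L2[OF c(1) f]] v(2) c(2)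
    by force
  with c(1) show "\<exists>c\<in>fin_coeffs I. L2_norm M (\<lambda>x. u x - lincomb f c x) < e"
    by blast
qed

lemma L2_closed_span_tendsto:
  assumes f: "\<And>i. i \<in> I \<Longrightarrow> f i \<in> L2 M" and "u \<in> L2 M"
    and "\<forall>\<^sub>F n in F. v n \<in> L2_closed_span M I f" "F \<noteq> bot"
    and lim: "((\<lambda>n. L2_norm M (\<lambda>x. v n x - u x)) \<longlongrightarrow> 0) F"
  shows "u \<in> L2_closed_span M I f"
proof (rule L2_closed_span_closed[OF f])
  fix e :: real assume "0 < e"
  then have "\<forall>\<^sub>F n in F. L2_norm M (\<lambda>x. v n x - u x) < e"
    using lim by (intro order_tendstoD) auto
  with assms(3) have "\<forall>\<^sub>F n in F. v n \<in> L2_closed_span M I f \<and> L2_norm M (\<lambda>x. v n x - u x) < e"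
    by (rule eventually_conj)
  then show "\<exists>v\<in>L2_closed_span M I f. L2_norm M (\<lambda>x. u x - v x) < e"
    using assms(4) by (auto simp: L2_norm_minus_commute dest!: eventually_happens)
qed (use assms in auto)

lemma lincomb_in_closed_span:
  assumes "c \<in> fin_coeffs I" "\<And>i. i \<in> I \<Longrightarrow> f i \<in> L2 M"
  shows "lincomb f c \<in> L2_closed_span M I f"
  unfolding L2_closed_span_iff
proof (intro conjI allI impI)
  show "lincomb f c \<in> L2 M"
    by (rule lincomb_L2[OF assms])
  show "\<exists>d\<in>fin_coeffs I. L2_norm M (\<lambda>x. lincomb f c x - lincomb f d x) < e" if "0 < e" for e
    using assms(1) that by (intro bexI[of _ c]) simp_all
qed

lemma L2_closed_span_generator:
  assumes "i \<in> I" "\<And>i. i \<in> I \<Longrightarrow> f i \<in> L2 M"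
  shows "f i \<in> L2_closed_span M I f"
proof -
  have "lincomb f (cutoff (\<lambda>_. 1) {i}) \<in> L2_closed_span M I f"
    using assms by (intro lincomb_in_closed_span cutoff_fin_coeffs) auto
  then show ?thesis
    using assms(1) by (simp add: cutoff_fin_coeffs(2)[where I=I])
qed

lemma L2_closed_span_sequence:
  assumes "u \<in> L2_closed_span M I f"
  obtains c where "\<And>n. c n \<in> fin_coeffs I"
    "(\<lambda>n. L2_norm M (\<lambda>x. lincomb f (c n) x - u x)) \<longlonglongrightarrow> 0"
proof -
  have "\<exists>c\<in>fin_coeffs I. L2_norm M (\<lambda>x. u x - lincomb f c x) < inverse (real (Suc n))" for n
    using assms unfolding L2_closed_span_iff by (metis inverse_positive_iff_positive of_nat_0_less_iff zero_less_Suc)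
  then obtain c where c: "\<And>n. c n \<in> fin_coeffs I"
      "\<And>n. L2_norm M (\<lambda>x. u x - lincomb f (c n) x) < inverse (real (Suc n))"
    by metis
  have "(\<lambda>n. L2_norm M (\<lambda>x. lincomb f (c n) x - u x)) \<longlonglongrightarrow> 0"
  proof (rule Lim_null_comparison[OF _ LIMSEQ_inverse_real_of_nat])
    show "\<forall>\<^sub>F n in sequentially. norm (L2_norm M (\<lambda>x. lincomb f (c n) x - u x)) \<le> inverse (real (Suc n))"
      using c(2) by (simp add: L2_norm_minus_commute[of M _ u] less_imp_le)
  qed
  with c(1) show ?thesis
    by (rule that)
qed

lemma L2_closed_span_add:
  assumes f: "\<And>i. i \<in> I \<Longrightarrow> f i \<in> L2 M"
    and "u \<in> L2_closed_span M I f" "v \<in> L2_closed_span M I f"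
  shows "(\<lambda>x. u x + v x) \<in> L2_closed_span M I f"
  unfolding L2_closed_span_iff
proof (intro conjI allI impI)
  show "(\<lambda>x. u x + v x) \<in> L2 M"
    using assms by (auto intro: L2_closed_span_in_L2)
  fix e :: real assume "0 < e"
  then have "0 < e / 2"
    by simp
  then obtain c d where cd: "c \<in> fin_coeffs I" "L2_norm M (\<lambda>x. u x - lincomb f c x) < e / 2"
      "d \<in> fin_coeffs I" "L2_norm M (\<lambda>x. v x - lincomb f d x) < e / 2"
    using assms(2,3) unfolding L2_closed_span_iff by meson
  have "L2_norm M (\<lambda>x. (u x - lincomb f c x) + (v x - lincomb f d x)) \<le>
      L2_norm M (\<lambda>x. u x - lincomb f c x) + L2_norm M (\<lambda>x. v x - lincomb f d x)"
    using assms cd by (intro L2_norm_triangle L2_diff) (auto intro: L2_closed_span_in_L2 lincomb_L2)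
  then have "L2_norm M (\<lambda>x. u x + v x - lincomb f (\<lambda>i. c i + d i) x) < e"
    using cd by (simp add: fin_coeffs_add(2)[OF cd(1,3)] algebra_simps)
  then show "\<exists>c\<in>fin_coeffs I. L2_norm M (\<lambda>x. u x + v x - lincomb f c x) < e"
    using fin_coeffs_add(1)[OF cd(1,3)] by blast
qed

lemma L2_closed_span_cmult:
  assumes f: "\<And>i. i \<in> I \<Longrightarrow> f i \<in> L2 M" and u: "u \<in> L2_closed_span M I f"
  shows "(\<lambda>x. k * u x) \<in> L2_closed_span M I f"
proof -
  obtain c where c: "\<And>n. c n \<in> fin_coeffs I"
      "(\<lambda>n. L2_norm M (\<lambda>x. lincomb f (c n) x - u x)) \<longlonglongrightarrow> 0"
    using L2_closed_span_sequence[OF u] by blast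
  show ?thesis
  proof (rule L2_closed_span_tendsto[OF f])
    show "(\<lambda>x. k * u x) \<in> L2 M"
      using u by (auto intro: L2_closed_span_in_L2)
    show "\<forall>\<^sub>F n in sequentially. lincomb f (\<lambda>i. k * c n i) \<in> L2_closed_span M I f"
      using c(1) f by (intro always_eventually allI lincomb_in_closed_span fin_coeffs_cmult(1))
    have "(\<lambda>n. cmod k * L2_norm M (\<lambda>x. lincomb f (c n) x - u x)) \<longlonglongrightarrow> cmod k * 0"
      by (intro tendsto_intros c)
    then show "(\<lambda>n. L2_norm M (\<lambda>x. lincomb f (\<lambda>i. k * c n i) x - k * u x)) \<longlonglongrightarrow> 0"
      by (simp add: L2_norm_cmult[symmetric] fin_coeffs_cmult(2)[OF c(1)] right_diff_distrib)
  qed auto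
qed

lemma L2_closed_span_diff:
  assumes f: "\<And>i. i \<in> I \<Longrightarrow> f i \<in> L2 M"
    and "u \<in> L2_closed_span M I f" "v \<in> L2_closed_span M I f"
  shows "(\<lambda>x. u x - v x) \<in> L2_closed_span M I f"
  using L2_closed_span_add[OF f assms(2) L2_closed_span_cmult[OF f assms(3), of "-1"]] by simp

lemma L2_closed_span_sum:
  assumes f: "\<And>i. i \<in> I \<Longrightarrow> f i \<in> L2 M"
    and "\<And>j. j \<in> X \<Longrightarrow> u j \<in> L2_closed_span M I f"
  shows "(\<lambda>x. \<Sum>j\<in>X. u j x) \<in> L2_closed_span M I f"
proof -
  have zero: "(\<lambda>x. 0) \<in> L2_closed_span M I f"
    using lincomb_in_closed_span[OF _ f, of "\<lambda>_. 0"]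
    by (simp add: lincomb_def[abs_def] fin_coeffs_def)
  show ?thesis
    using assms(2) by (induction X rule: infinite_finite_induct)
      (auto simp: zero intro!: L2_closed_span_add[OF f])
qed

lemma L2_closed_span_subset:
  assumes f: "\<And>i. i \<in> I \<Longrightarrow> f i \<in> L2_closed_span M J g"
    and g: "\<And>j. j \<in> J \<Longrightarrow> g j \<in> L2 M"
  shows "L2_closed_span M I f \<subseteq> L2_closed_span M J g"
proof
  fix u assume u: "u \<in> L2_closed_span M I f"
  obtain c where c: "\<And>n. c n \<in> fin_coeffs I"
      "(\<lambda>n. L2_norm M (\<lambda>x. lincomb f (c n) x - u x)) \<longlonglongrightarrow> 0"
    using L2_closed_span_sequence[OF u] by blast
  show "u \<in> L2_closed_span M J g"
  proof (rule L2_closed_span_tendsto[OF g _ _ _ c(2)])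
    have "(\<lambda>x. \<Sum>i | c n i \<noteq> 0. c n i * f i x) \<in> L2_closed_span M J g" for n
      using c(1)[of n] f by (intro L2_closed_span_sum L2_closed_span_cmult g) (auto simp: fin_coeffs_def)
    then show "\<forall>\<^sub>F n in sequentially. lincomb f (c n) \<in> L2_closed_span M J g"
      by (simp add: lincomb_def[abs_def])
  qed (use u L2_closed_span_in_L2 in auto)
qed

subsection \<open>Unconditional sums\<close>

lemma has_L2_sumD:
  assumes "has_L2_sum M I f u"
  shows "u \<in> L2 M" "\<And>i. i \<in> I \<Longrightarrow> f i \<in> L2 M"
    "((\<lambda>X. L2_norm M (\<lambda>x. (\<Sum>i\<in>X. f i x) - u x)) \<longlongrightarrow> 0) (finite_subsets_at_top I)"
  using assms by (auto simp: has_L2_sum_def)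

lemma eventually_finite_subset: "\<forall>\<^sub>F X in finite_subsets_at_top I. finite X \<and> X \<subseteq> I"
  by (rule eventually_finite_subsets_at_top_weakI) simp

lemma has_L2_sum_finite:
  assumes "\<And>i. i \<in> I \<Longrightarrow> f i \<in> L2 M" "finite Y" "Y \<subseteq> I" "\<And>i. i \<in> I - Y \<Longrightarrow> f i = (\<lambda>x. 0)"
  shows "has_L2_sum M I f (\<lambda>x. \<Sum>i\<in>Y. f i x)"
proof -
  have "\<forall>\<^sub>F X in finite_subsets_at_top I. L2_norm M (\<lambda>x. (\<Sum>i\<in>X. f i x) - (\<Sum>i\<in>Y. f i x)) = 0"
  proof (rule eventually_finite_subsets_at_top[THEN iffD2], intro exI[of _ Y] conjI allI impI)
    fix X assume X: "finite X \<and> Y \<subseteq> X \<and> X \<subseteq> I"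
    have "(\<Sum>i\<in>X. f i x) = (\<Sum>i\<in>Y. f i x)" for x
      using X assms(4) by (intro sum.mono_neutral_right) (auto simp: fun_eq_iff subset_iff)
    then show "L2_norm M (\<lambda>x. (\<Sum>i\<in>X. f i x) - (\<Sum>i\<in>Y. f i x)) = 0"
      by simp
  qed (use assms in auto)
  from tendsto_cong[OF this] show ?thesis
    using assms by (auto simp: has_L2_sum_def intro!: L2_sum)
qed

lemma has_L2_sum_add:
  assumes f: "has_L2_sum M I f u" and g: "has_L2_sum M I g v"
  shows "has_L2_sum M I (\<lambda>i x. f i x + g i x) (\<lambda>x. u x + v x)"
  unfolding has_L2_sum_def
proof (intro conjI ballI)
  show "((\<lambda>X. L2_norm M (\<lambda>x. (\<Sum>i\<in>X. f i x + g i x) - (u x + v x))) \<longlongrightarrow> 0) (finite_subsets_at_top I)"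
  proof (rule Lim_null_comparison)
    have "((\<lambda>X. L2_norm M (\<lambda>x. (\<Sum>i\<in>X. f i x) - u x) + L2_norm M (\<lambda>x. (\<Sum>i\<in>X. g i x) - v x)) \<longlongrightarrow> 0 + 0)
        (finite_subsets_at_top I)"
      by (intro tendsto_add has_L2_sumD[OF f] has_L2_sumD[OF g])
    then show "((\<lambda>X. L2_norm M (\<lambda>x. (\<Sum>i\<in>X. f i x) - u x) + L2_norm M (\<lambda>x. (\<Sum>i\<in>X. g i x) - v x)) \<longlongrightarrow> 0)
        (finite_subsets_at_top I)"
      by simp
    show "\<forall>\<^sub>F X in finite_subsets_at_top I. norm (L2_norm M (\<lambda>x. (\<Sum>i\<in>X. f i x + g i x) - (u x + v x)))
        \<le> L2_norm M (\<lambda>x. (\<Sum>i\<in>X. f i x) - u x) + L2_norm M (\<lambda>x. (\<Sum>i\<in>X. g i x) - v x)"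
      using eventually_finite_subset
    proof eventually_elim
      case (elim X)
      have "L2_norm M (\<lambda>x. ((\<Sum>i\<in>X. f i x) - u x) + ((\<Sum>i\<in>X. g i x) - v x))
          \<le> L2_norm M (\<lambda>x. (\<Sum>i\<in>X. f i x) - u x) + L2_norm M (\<lambda>x. (\<Sum>i\<in>X. g i x) - v x)"
        using elim has_L2_sumD(1,2)[OF f] has_L2_sumD(1,2)[OF g]
        by (intro L2_norm_triangle L2_diff L2_sum) auto
      then show ?case
        by (simp add: sum.distrib algebra_simps)
    qed
  qed
qed (use has_L2_sumD[OF f] has_L2_sumD[OF g] in auto)

lemma has_L2_sum_mult_bounded:
  assumes f: "has_L2_sum M I f u"
    and w: "w \<in> borel_measurable M" "AE x in M. cmod (w x) \<le> C" "0 \<le> C"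
  shows "has_L2_sum M I (\<lambda>i x. w x * f i x) (\<lambda>x. w x * u x)"
  unfolding has_L2_sum_def
proof (intro conjI ballI)
  show "((\<lambda>X. L2_norm M (\<lambda>x. (\<Sum>i\<in>X. w x * f i x) - w x * u x)) \<longlongrightarrow> 0) (finite_subsets_at_top I)"
  proof (rule Lim_null_comparison)
    have "((\<lambda>X. C * L2_norm M (\<lambda>x. (\<Sum>i\<in>X. f i x) - u x)) \<longlongrightarrow> C * 0) (finite_subsets_at_top I)"
      by (intro tendsto_intros has_L2_sumD[OF f])
    then show "((\<lambda>X. C * L2_norm M (\<lambda>x. (\<Sum>i\<in>X. f i x) - u x)) \<longlongrightarrow> 0) (finite_subsets_at_top I)"
      by simp
    show "\<forall>\<^sub>F X in finite_subsets_at_top I. norm (L2_norm M (\<lambda>x. (\<Sum>i\<in>X. w x * f i x) - w x * u x))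
        \<le> C * L2_norm M (\<lambda>x. (\<Sum>i\<in>X. f i x) - u x)"
      using eventually_finite_subset
    proof eventually_elim
      case (elim X)
      have "L2_norm M (\<lambda>x. w x * ((\<Sum>i\<in>X. f i x) - u x)) \<le> C * L2_norm M (\<lambda>x. (\<Sum>i\<in>X. f i x) - u x)"
        using elim has_L2_sumD(1,2)[OF f] w by (intro L2_norm_mult_bounded_le L2_diff L2_sum) auto
      then show ?case
        by (simp add: right_diff_distrib sum_distrib_left)
    qed
  qed
qed (use has_L2_sumD[OF f] L2_mult_bounded[OF w(1) _ w(2)] in auto)

lemma has_L2_sum_cmult:
  assumes "has_L2_sum M I f u"
  shows "has_L2_sum M I (\<lambda>i x. k * f i x) (\<lambda>x. k * u x)"
  by (rule has_L2_sum_mult_bounded[OF assms, of "\<lambda>_. k" "cmod k"]) auto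

lemma has_L2_sum_diff:
  assumes "has_L2_sum M I f u" "has_L2_sum M I g v"
  shows "has_L2_sum M I (\<lambda>i x. f i x - g i x) (\<lambda>x. u x - v x)"
  using has_L2_sum_add[OF assms(1) has_L2_sum_cmult[OF assms(2), of "-1"]] by simp

lemma has_L2_sum_sum:
  assumes "\<And>j. j \<in> X \<Longrightarrow> has_L2_sum M I (f j) (u j)"
  shows "has_L2_sum M I (\<lambda>i x. \<Sum>j\<in>X. f j i x) (\<lambda>x. \<Sum>j\<in>X. u j x)"
  using assms
proof (induction X rule: infinite_finite_induct)
  case (insert j X)
  then show ?case
    using has_L2_sum_add[of M I "f j" "u j"] by simp
qed (use has_L2_sum_finite[of I "\<lambda>_ _. 0" M "{}"] in simp_all)

lemma has_L2_sum_reindex: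
  assumes f: "has_L2_sum M I f u" and bij: "bij_betw \<phi> J I"
  shows "has_L2_sum M J (\<lambda>j. f (\<phi> j)) u"
proof -
  have I: "I = \<phi> ` J" and inj: "inj_on \<phi> J"
    using bij by (auto simp: bij_betw_def)
  have "((\<lambda>X. L2_norm M (\<lambda>x. (\<Sum>i\<in>X. f i x) - u x)) \<longlongrightarrow> 0)
      (filtermap ((`) \<phi>) (finite_subsets_at_top J))"
    using has_L2_sumD(3)[OF f] inj by (simp add: I filtermap_image_finite_subsets_at_top)
  then have "((\<lambda>X. L2_norm M (\<lambda>x. (\<Sum>i\<in>\<phi> ` X. f i x) - u x)) \<longlongrightarrow> 0) (finite_subsets_at_top J)"
    by (simp add: filterlim_filtermap)
  moreover have "\<forall>\<^sub>F X in finite_subsets_at_top J. L2_norm M (\<lambda>x. (\<Sum>i\<in>\<phi> ` X. f i x) - u x)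
      = L2_norm M (\<lambda>x. (\<Sum>j\<in>X. f (\<phi> j) x) - u x)"
    using eventually_finite_subset
  proof eventually_elim
    case (elim X)
    then have "inj_on \<phi> X"
      using inj by (auto intro: inj_on_subset)
    then show ?case
      by (simp add: sum.reindex)
  qed
  ultimately have "((\<lambda>X. L2_norm M (\<lambda>x. (\<Sum>j\<in>X. f (\<phi> j) x) - u x)) \<longlongrightarrow> 0) (finite_subsets_at_top J)"
    using tendsto_cong by fastforce
  then show ?thesis
    using has_L2_sumD(1,2)[OF f] by (auto simp: has_L2_sum_def I)
qed

subsection \<open>Square-summable families\<close>

text \<open>Square-summable families are treated as the \<open>L\<^sup>2\<close>-space of the counting measure, so that the
  triangle inequality and the limit lemma above apply to sequences of samples.\<close>

lemma L2_count_spaceI: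
  assumes "\<And>X. finite X \<Longrightarrow> X \<subseteq> I \<Longrightarrow> (\<Sum>i\<in>X. (cmod (d i))\<^sup>2) \<le> C"
  shows "d \<in> L2 (count_space I)" "(L2_norm (count_space I) d)\<^sup>2 \<le> C"
proof -
  let ?s = "\<lambda>i. (cmod (d i))\<^sup>2"
  have sum: "?s summable_on I"
    using assms by (intro nonneg_bdd_above_summable_on bdd_aboveI) auto
  then have "Infinite_Sum.abs_summable_on ?s I"
    by simp
  then have abs: "Infinite_Set_Sum.abs_summable_on ?s I"
    using abs_summable_equivalent by blast
  then show "d \<in> L2 (count_space I)"
    by (simp add: L2_def abs_summable_on_def)
  have "(L2_norm (count_space I) d)\<^sup>2 = infsetsum ?s I"
    by (simp add: L2_norm_square infsetsum_def)
  also have "\<dots> = infsum ?s I"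
    by (rule infsetsum_infsum[OF abs])
  also have "\<dots> \<le> C"
    by (rule infsum_le_finite_sums[OF sum]) (use assms in auto)
  finally show "(L2_norm (count_space I) d)\<^sup>2 \<le> C" .
qed

lemma sum_le_L2_norm_count_space:
  assumes "d \<in> L2 (count_space I)" "finite X" "X \<subseteq> I"
  shows "(\<Sum>i\<in>X. (cmod (d i))\<^sup>2) \<le> (L2_norm (count_space I) d)\<^sup>2"
proof -
  let ?s = "\<lambda>i. (cmod (d i))\<^sup>2"
  have abs: "Infinite_Set_Sum.abs_summable_on ?s I"
    using L2_integrable[OF assms(1)] by (simp add: abs_summable_on_def)
  then have "Infinite_Sum.abs_summable_on ?s I"
    by (rule abs_summable_equivalent[THEN iffD2])
  then have "(\<Sum>i\<in>X. ?s i) \<le> infsum ?s I"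
    using assms(2,3) by (intro finite_sum_le_infsum) auto
  also have "\<dots> = (L2_norm (count_space I) d)\<^sup>2"
    by (simp add: L2_norm_square infsetsum_infsum[OF abs, symmetric] infsetsum_def)
  finally show ?thesis .
qed

lemma norm_le_L2_norm_count_space:
  assumes "d \<in> L2 (count_space I)" "i \<in> I"
  shows "cmod (d i) \<le> L2_norm (count_space I) d"
  by (rule power2_le_imp_le) (use sum_le_L2_norm_count_space[OF assms(1), of "{i}"] assms(2) in auto)

subsection \<open>Riesz bounds\<close>

definition riesz_bounds ::
  "'x measure \<Rightarrow> 'i set \<Rightarrow> ('i \<Rightarrow> 'x \<Rightarrow> complex) \<Rightarrow> real \<Rightarrow> real \<Rightarrow> bool" where
  "riesz_bounds M I f A B \<longleftrightarrow> (\<forall>i\<in>I. f i \<in> L2 M) \<and> (\<forall>c\<in>fin_coeffs I.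
     A * coeff_norm2 c \<le> (L2_norm M (lincomb f c))\<^sup>2 \<and> (L2_norm M (lincomb f c))\<^sup>2 \<le> B * coeff_norm2 c)"

lemma riesz_sequence_iff: "riesz_sequence M I f \<longleftrightarrow> (\<exists>A>0. \<exists>B>0. riesz_bounds M I f A B)"
proof -
  have "(\<forall>X c. finite X \<and> X \<subseteq> I \<longrightarrow>
        A * (\<Sum>i\<in>X. (cmod (c i))\<^sup>2) \<le> (L2_norm M (\<lambda>x. \<Sum>i\<in>X. c i * f i x))\<^sup>2 \<and>
        (L2_norm M (\<lambda>x. \<Sum>i\<in>X. c i * f i x))\<^sup>2 \<le> B * (\<Sum>i\<in>X. (cmod (c i))\<^sup>2)) \<longleftrightarrow>
     (\<forall>c\<in>fin_coeffs I. A * coeff_norm2 c \<le> (L2_norm M (lincomb f c))\<^sup>2 \<and>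
        (L2_norm M (lincomb f c))\<^sup>2 \<le> B * coeff_norm2 c)" (is "?L \<longleftrightarrow> ?R") for A B
  proof
    assume ?L
    show ?R
    proof
      fix c assume "c \<in> fin_coeffs I"
      then show "A * coeff_norm2 c \<le> (L2_norm M (lincomb f c))\<^sup>2 \<and>
          (L2_norm M (lincomb f c))\<^sup>2 \<le> B * coeff_norm2 c"
        using \<open>?L\<close>[rule_format, of "{i. c i \<noteq> 0}" c]
        by (simp add: fin_coeffs_def coeff_norm2_def lincomb_def[abs_def])
    qed
  next
    assume R: ?R
    show ?L
    proof (intro allI impI)
      fix X and c :: "'b \<Rightarrow> complex" assume "finite X \<and> X \<subseteq> I"
      then show "A * (\<Sum>i\<in>X. (cmod (c i))\<^sup>2) \<le> (L2_norm M (\<lambda>x. \<Sum>i\<in>X. c i * f i x))\<^sup>2 \<and>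
          (L2_norm M (\<lambda>x. \<Sum>i\<in>X. c i * f i x))\<^sup>2 \<le> B * (\<Sum>i\<in>X. (cmod (c i))\<^sup>2)"
        using R[rule_format, of "cutoff c X"] cutoff_fin_coeffs(1)[of X I c] cutoff_fin_coeffs(2)[of X I f c]
          cutoff_fin_coeffs(3)[of X I c] by simp
    qed
  qed
  then show ?thesis
    by (auto simp: riesz_sequence_def riesz_bounds_def)
qed

lemma riesz_boundsD:
  assumes "riesz_bounds M I f A B"
  shows "i \<in> I \<Longrightarrow> f i \<in> L2 M"
    and "c \<in> fin_coeffs I \<Longrightarrow> A * coeff_norm2 c \<le> (L2_norm M (lincomb f c))\<^sup>2"
    and "c \<in> fin_coeffs I \<Longrightarrow> (L2_norm M (lincomb f c))\<^sup>2 \<le> B * coeff_norm2 c"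
  using assms by (auto simp: riesz_bounds_def)

text \<open>Partial sums are finite combinations with truncated coefficients, so they satisfy the Riesz
  inequalities, and both sides converge along the net of finite sets.\<close>

lemma riesz_bounds_has_L2_sum:
  assumes rb: "riesz_bounds M I f A B" and "0 < A" "0 < B"
    and sum: "has_L2_sum M I (\<lambda>i x. d i * f i x) u"
  shows "d \<in> L2 (count_space I)"
    and "A * (L2_norm (count_space I) d)\<^sup>2 \<le> (L2_norm M u)\<^sup>2"
    and "(L2_norm M u)\<^sup>2 \<le> B * (L2_norm (count_space I) d)\<^sup>2"
proof -
  let ?N = "\<lambda>X. (L2_norm M (\<lambda>x. \<Sum>i\<in>X. d i * f i x))\<^sup>2"
  let ?F = "finite_subsets_at_top I"
  have lim: "(?N \<longlongrightarrow> (L2_norm M u)\<^sup>2) ?F"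
  proof (intro tendsto_power)
    have "((\<lambda>X. L2_norm M (\<lambda>x. \<Sum>i\<in>X \<inter> I. d i * f i x)) \<longlongrightarrow> L2_norm M u) ?F"
    proof (rule L2_norm_tendsto)
      have "\<forall>\<^sub>F X in ?F. L2_norm M (\<lambda>x. (\<Sum>i\<in>X. d i * f i x) - u x)
          = L2_norm M (\<lambda>x. (\<Sum>i\<in>X \<inter> I. d i * f i x) - u x)"
        using eventually_finite_subset by eventually_elim (simp add: Int_absorb2)
      from tendsto_cong[OF this]
      show "((\<lambda>X. L2_norm M (\<lambda>x. (\<Sum>i\<in>X \<inter> I. d i * f i x) - u x)) \<longlongrightarrow> 0) ?F"
        using has_L2_sumD(3)[OF sum] by simp
    qed (use has_L2_sumD[OF sum] in auto)
    moreover have "\<forall>\<^sub>F X in ?F. L2_norm M (\<lambda>x. \<Sum>i\<in>X \<inter> I. d i * f i x) = L2_norm M (\<lambda>x. \<Sum>i\<in>X. d i * f i x)"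
      using eventually_finite_subset by eventually_elim (simp add: Int_absorb2)
    ultimately show "((\<lambda>X. L2_norm M (\<lambda>x. \<Sum>i\<in>X. d i * f i x)) \<longlongrightarrow> L2_norm M u) ?F"
      using tendsto_cong by fastforce
  qed
  have bounds: "A * (\<Sum>i\<in>X. (cmod (d i))\<^sup>2) \<le> ?N X" "?N X \<le> B * (\<Sum>i\<in>X. (cmod (d i))\<^sup>2)"
    if "finite X" "X \<subseteq> I" for X
    using riesz_boundsD(2,3)[OF rb cutoff_fin_coeffs(1)[OF that, of d]]
    by (simp_all add: cutoff_fin_coeffs[OF that])
  have fin: "(\<Sum>i\<in>X. (cmod (d i))\<^sup>2) \<le> (L2_norm M u)\<^sup>2 / A" if X: "finite X" "X \<subseteq> I" for X
  proof -
    have "A * (\<Sum>i\<in>X. (cmod (d i))\<^sup>2) \<le> (L2_norm M u)\<^sup>2"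
    proof (rule tendsto_lowerbound[OF lim])
      show "\<forall>\<^sub>F Y in ?F. A * (\<Sum>i\<in>X. (cmod (d i))\<^sup>2) \<le> ?N Y"
      proof (rule eventually_finite_subsets_at_top[THEN iffD2], intro exI[of _ X] conjI allI impI X)
        fix Y assume Y: "finite Y \<and> X \<subseteq> Y \<and> Y \<subseteq> I"
        have "A * (\<Sum>i\<in>X. (cmod (d i))\<^sup>2) \<le> A * (\<Sum>i\<in>Y. (cmod (d i))\<^sup>2)"
          using Y \<open>0 < A\<close> by (intro mult_left_mono sum_mono2) auto
        also have "\<dots> \<le> ?N Y"
          using Y by (intro bounds) auto
        finally show "A * (\<Sum>i\<in>X. (cmod (d i))\<^sup>2) \<le> ?N Y" .
      qed
    qed simp
    then show ?thesis
      using \<open>0 < A\<close> by (simp add: field_simps)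
  qed
  show d: "d \<in> L2 (count_space I)"
    by (rule L2_count_spaceI[OF fin])
  show "A * (L2_norm (count_space I) d)\<^sup>2 \<le> (L2_norm M u)\<^sup>2"
    using L2_count_spaceI(2)[OF fin] \<open>0 < A\<close> by (simp add: field_simps)
  show "(L2_norm M u)\<^sup>2 \<le> B * (L2_norm (count_space I) d)\<^sup>2"
  proof (rule tendsto_upperbound[OF lim])
    show "\<forall>\<^sub>F X in ?F. ?N X \<le> B * (L2_norm (count_space I) d)\<^sup>2"
      using eventually_finite_subset
    proof eventually_elim
      case (elim X)
      then have "?N X \<le> B * (\<Sum>i\<in>X. (cmod (d i))\<^sup>2)"
        by (intro bounds) auto
      also have "\<dots> \<le> B * (L2_norm (count_space I) d)\<^sup>2"
        using elim \<open>0 < B\<close> by (intro mult_left_mono sum_le_L2_norm_count_space[OF d]) auto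
      finally show ?case .
    qed
  qed simp
qed

lemma summable_on_tail:
  fixes s :: "'i \<Rightarrow> real"
  assumes "s summable_on I" "0 < e"
  obtains F where "finite F" "F \<subseteq> I"
    "\<And>Y. finite Y \<Longrightarrow> Y \<subseteq> I \<Longrightarrow> Y \<inter> F = {} \<Longrightarrow> sum s Y < e"
proof -
  obtain t where "(sum s \<longlongrightarrow> t) (finite_subsets_at_top I)"
    using assms(1) by (auto simp: summable_on_def has_sum_def)
  then have "\<forall>\<^sub>F X in finite_subsets_at_top I. dist (sum s X) t < e / 2"
    using assms(2) by (intro tendstoD) auto
  then obtain F where F: "finite F" "F \<subseteq> I"
      "\<And>X. finite X \<Longrightarrow> F \<subseteq> X \<Longrightarrow> X \<subseteq> I \<Longrightarrow> dist (sum s X) t < e / 2"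
    unfolding eventually_finite_subsets_at_top by metis
  have "sum s Y < e" if "finite Y" "Y \<subseteq> I" "Y \<inter> F = {}" for Y
  proof -
    have "sum s (F \<union> Y) = sum s F + sum s Y"
      using that F by (intro sum.union_disjoint) auto
    then show ?thesis
      using F(3)[of F] F(3)[of "F \<union> Y"] F(1,2) that(1,2) by (simp add: dist_real_def abs_if split: if_splits)
  qed
  with F(1,2) show ?thesis
    by (rule that)
qed

text \<open>By the upper Riesz bound the partial sums form a Cauchy net, since the square sums over finite
  sets avoiding a suitable finite set are small. A sequence of partial sums over growing sets has a
  limit by completeness, and the whole net follows it.\<close>

lemma summable_square_has_L2_sum:
  assumes "finite_measure M" and rb: "riesz_bounds M I f A B" "0 < B"
    and b: "(\<lambda>i. (cmod (b i))\<^sup>2) summable_on I"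
  shows "\<exists>u. has_L2_sum M I (\<lambda>i x. b i * f i x) u"
proof -
  let ?p = "\<lambda>X x. \<Sum>i\<in>X. b i * f i x"
  have p: "?p X \<in> L2 M" if "X \<subseteq> I" for X
    using that riesz_boundsD(1)[OF rb(1)] by (intro L2_sum L2_cmult) auto
  define settled where "settled e F \<longleftrightarrow> finite F \<and> F \<subseteq> I \<and> (\<forall>X Y. finite X \<longrightarrow> X \<subseteq> I \<longrightarrow> F \<subseteq> X \<longrightarrow>
      finite Y \<longrightarrow> Y \<subseteq> I \<longrightarrow> F \<subseteq> Y \<longrightarrow> L2_norm M (\<lambda>x. ?p X x - ?p Y x) < e)" for e F
  have tail: "\<exists>F. settled e F" if e: "0 < e" for e
  proof -
    obtain F where F: "finite F" "F \<subseteq> I"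
        "\<And>Y. finite Y \<Longrightarrow> Y \<subseteq> I \<Longrightarrow> Y \<inter> F = {} \<Longrightarrow> (\<Sum>i\<in>Y. (cmod (b i))\<^sup>2) < e\<^sup>2 / B"
      by (rule summable_on_tail[OF b, of "e\<^sup>2 / B"]) (use e rb(2) in auto)
    have "L2_norm M (\<lambda>x. ?p X x - ?p Y x) < e"
      if XY: "finite X" "X \<subseteq> I" "F \<subseteq> X" "finite Y" "Y \<subseteq> I" "F \<subseteq> Y" for X Y
    proof -
      define c where "c i = cutoff b X i - cutoff b Y i" for i
      have c: "c \<in> fin_coeffs I" "lincomb f c = (\<lambda>x. ?p X x - ?p Y x)"
        using fin_coeffs_diff(1)[OF cutoff_fin_coeffs(1)[OF XY(1,2), of b] cutoff_fin_coeffs(1)[OF XY(4,5), of b]]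
          fin_coeffs_diff(2)[OF cutoff_fin_coeffs(1)[OF XY(1,2), of b] cutoff_fin_coeffs(1)[OF XY(4,5), of b], of f]
        by (simp_all add: c_def[abs_def] cutoff_fin_coeffs(2)[OF XY(1,2)] cutoff_fin_coeffs(2)[OF XY(4,5)])
      have "coeff_norm2 c = (\<Sum>i\<in>X \<union> Y - F. (cmod (c i))\<^sup>2)"
        by (rule coeff_norm2_eq_sum) (use XY in \<open>auto simp: c_def cutoff_def\<close>)
      also have "\<dots> \<le> (\<Sum>i\<in>X \<union> Y - F. (cmod (b i))\<^sup>2)"
        by (rule sum_mono) (auto simp: c_def cutoff_def)
      also have "\<dots> < e\<^sup>2 / B"
        using XY by (intro F) auto
      finally have "B * coeff_norm2 c < e\<^sup>2"
        using rb(2) by (simp add: field_simps)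
      then have "(L2_norm M (lincomb f c))\<^sup>2 < e\<^sup>2"
        using riesz_boundsD(3)[OF rb(1) c(1)] by linarith
      then show ?thesis
        using power2_less_imp_less[of "L2_norm M (lincomb f c)" e] e by (simp add: c(2))
    qed
    with F(1,2) have "settled e F"
      unfolding settled_def by blast
    then show ?thesis ..
  qed
  obtain F where F: "\<And>n. finite (F n)" "\<And>n. F n \<subseteq> I"
      "\<And>n X Y. finite X \<Longrightarrow> X \<subseteq> I \<Longrightarrow> F n \<subseteq> X \<Longrightarrow> finite Y \<Longrightarrow> Y \<subseteq> I \<Longrightarrow> F n \<subseteq> Y
        \<Longrightarrow> L2_norm M (\<lambda>x. ?p X x - ?p Y x) < inverse (real (Suc n))"
  proof -
    have "\<forall>n. \<exists>F. settled (inverse (real (Suc n))) F"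
      by (intro allI tail) simp
    from choice[OF this] obtain F where "\<forall>n. settled (inverse (real (Suc n))) (F n)" ..
    then show ?thesis
      by (intro that[of F]) (simp_all only: settled_def)
  qed
  \<comment> \<open>Monotone in \<open>n\<close>, so that one sequence of sets is eventually fine enough for every tolerance.\<close>
  define Z where "Z n = (\<Union>k\<le>n. F k)" for n
  have Z: "finite (Z n)" "Z n \<subseteq> I" "\<And>k. k \<le> n \<Longrightarrow> F k \<subseteq> Z n" for n
    using F(1,2) by (auto simp: Z_def)
  obtain u where u: "u \<in> L2 M" "(\<lambda>n. L2_norm M (\<lambda>x. ?p (Z n) x - u x)) \<longlonglongrightarrow> 0"
  proof (rule L2_complete[OF assms(1), of "\<lambda>n. ?p (Z n)"])
    show "?p (Z n) \<in> L2 M" for n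
      using Z(2) by (rule p)
    fix e :: real assume "0 < e"
    then obtain N where N: "inverse (real (Suc N)) < e"
      using reals_Archimedean by blast
    have "L2_norm M (\<lambda>x. ?p (Z m) x - ?p (Z n) x) < e" if "m \<ge> N" "n \<ge> N" for m n
      using F(3)[OF Z(1,2) Z(3)[OF that(1)] Z(1,2) Z(3)[OF that(2)]] N by linarith
    then show "\<exists>N. \<forall>m\<ge>N. \<forall>n\<ge>N. L2_norm M (\<lambda>x. ?p (Z m) x - ?p (Z n) x) < e"
      by blast
  qed blast
  have "((\<lambda>X. L2_norm M (\<lambda>x. ?p X x - u x)) \<longlongrightarrow> 0) (finite_subsets_at_top I)"
  proof (rule tendstoI)
    fix e :: real assume "0 < e"
    then obtain N where N: "inverse (real (Suc N)) < e / 2"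
      using reals_Archimedean[of "e / 2"] by auto
    obtain K where K: "\<And>n. n \<ge> K \<Longrightarrow> L2_norm M (\<lambda>x. ?p (Z n) x - u x) < e / 2"
      using LIMSEQ_D[OF u(2), of "e / 2"] \<open>0 < e\<close> by auto
    define n where "n = max K N"
    have "L2_norm M (\<lambda>x. ?p X x - u x) < e" if X: "finite X" "Z n \<subseteq> X" "X \<subseteq> I" for X
    proof -
      have "F N \<subseteq> Z n"
        by (rule Z(3)) (simp add: n_def)
      then have "L2_norm M (\<lambda>x. ?p X x - ?p (Z n) x) < inverse (real (Suc N))"
        using X Z by (intro F(3)) auto
      then show ?thesis
        using L2_norm_triangle_diff[OF p[OF X(3)] p[OF Z(2)[of n]] u(1)] N K[of n] by (simp add: n_def)
    qed
    then show "\<forall>\<^sub>F X in finite_subsets_at_top I. dist (L2_norm M (\<lambda>x. ?p X x - u x)) 0 < e"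
      unfolding eventually_finite_subsets_at_top using Z(1,2) by (intro exI[of _ "Z n"]) auto
  qed
  then have "has_L2_sum M I (\<lambda>i x. b i * f i x) u"
    using u(1) riesz_boundsD(1)[OF rb(1)] by (auto simp: has_L2_sum_def)
  then show ?thesis
    by blast
qed

section \<open>Characters of a discrete abelian group separate points\<close>

primrec nmul :: "nat \<Rightarrow> 'a::ab_group_add \<Rightarrow> 'a" where
  "nmul 0 x = 0"
| "nmul (Suc n) x = x + nmul n x"

lemma nmul_add: "nmul (m + n) x = nmul m x + nmul n x"
  by (induction m) (simp_all add: add.assoc)

lemma nmul_diff: "m \<le> n \<Longrightarrow> nmul n x - nmul m x = nmul (n - m) x"
  using nmul_add[of "n - m" m x] by (simp add: algebra_simps)

lemma nmul_mult: "nmul (m * n) x = nmul m (nmul n x)"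
  by (induction m) (simp_all add: nmul_add)

lemma nmul_zero [simp]: "nmul n 0 = 0"
  by (induction n) simp_all

text \<open>The graph of a unimodular character of a subgroup of \<open>H\<close>. Ordering such graphs by inclusion
  makes extension of characters accessible to Zorn's lemma.\<close>

definition char_graph :: "'a::ab_group_add set \<Rightarrow> ('a \<times> complex) set \<Rightarrow> bool" where
  "char_graph H F \<longleftrightarrow> F \<subseteq> H \<times> sphere 0 1 \<and> (0, 1) \<in> F \<and>
     (\<forall>x z y w. (x, z) \<in> F \<longrightarrow> (y, w) \<in> F \<longrightarrow> (x - y, z / w) \<in> F) \<and> (\<forall>z. (0, z) \<in> F \<longrightarrow> z = 1)"

context
  fixes H F :: "_ set"
  assumes F: "char_graph H F"
begin

lemma char_graph_mem:
  assumes "(x, z) \<in> F"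
  shows "x \<in> H" "cmod z = 1" "z \<noteq> 0"
  using F assms by (force simp: char_graph_def)+

lemma char_graph_zero: "(0, 1) \<in> F"
  using F by (simp add: char_graph_def)

lemma char_graph_zeroD: "(0, z) \<in> F \<Longrightarrow> z = 1"
  using F by (simp add: char_graph_def)

lemma char_graph_diff: "(x, z) \<in> F \<Longrightarrow> (y, w) \<in> F \<Longrightarrow> (x - y, z / w) \<in> F"
  using F unfolding char_graph_def by blast

lemma char_graph_uminus: "(x, z) \<in> F \<Longrightarrow> (- x, inverse z) \<in> F"
  using char_graph_diff[OF char_graph_zero, of x z] by (simp add: inverse_eq_divide)

lemma char_graph_add: "(x, z) \<in> F \<Longrightarrow> (y, w) \<in> F \<Longrightarrow> (x + y, z * w) \<in> F"
  using char_graph_diff[OF _ char_graph_uminus, of x z y w] by (simp add: divide_inverse)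

lemma char_graph_nmul: "(x, z) \<in> F \<Longrightarrow> (nmul n x, z ^ n) \<in> F"
  by (induction n) (auto intro: char_graph_zero char_graph_add)

lemma char_graph_unique: "(x, z) \<in> F \<Longrightarrow> (x, w) \<in> F \<Longrightarrow> z = w"
  using char_graph_zeroD char_graph_diff[of x z x w] char_graph_mem(3)[of x w] by force

text \<open>The value at a new element \<open>y\<close> is constrained only by the least positive multiple of \<open>y\<close> in
  the domain, and there by a single root extraction.\<close>

lemma char_graph_value_exists:
  obtains v where "cmod v = 1" "\<And>n w. (nmul n y, w) \<in> F \<Longrightarrow> w = v ^ n"
proof (cases "\<exists>n>0. \<exists>w. (nmul n y, w) \<in> F")
  case False
  have "w = 1 ^ n" if "(nmul n y, w) \<in> F" for n w
    using False that char_graph_zeroD[of w] by (cases "n = 0") (simp, blast)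
  then show ?thesis
    using that[of 1] by simp
next
  case True
  define n where "n = (LEAST n. 0 < n \<and> (\<exists>w. (nmul n y, w) \<in> F))"
  have "0 < n \<and> (\<exists>w. (nmul n y, w) \<in> F)"
    unfolding n_def by (rule LeastI_ex) (use True in auto)
  then obtain w where n: "0 < n" and w: "(nmul n y, w) \<in> F"
    by blast
  have least: "m = 0" if "m < n" "(nmul m y, u) \<in> F" for m u
    using not_less_Least[of m "\<lambda>n. 0 < n \<and> (\<exists>w. (nmul n y, w) \<in> F)"] that by (auto simp: n_def)
  define v where "v = cis (Arg w / n)"
  have "cis (Arg w) = w"
    using char_graph_mem[OF w] cis_Arg[of w] by (simp add: sgn_div_norm)
  moreover have "v ^ n = cis (real n * (Arg w / n))"
    unfolding v_def by (rule Complex.DeMoivre)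
  ultimately have v: "cmod v = 1" "v ^ n = w"
    using n by (simp_all add: v_def)
  have "u = v ^ m" if u: "(nmul m y, u) \<in> F" for m u
  proof -
    have "nmul m y = nmul (m div n) (nmul n y) + nmul (m mod n) y"
      by (simp add: nmul_mult[symmetric] nmul_add[symmetric])
    then have "(nmul (m mod n) y, u / w ^ (m div n)) \<in> F"
      using char_graph_diff[OF u char_graph_nmul[OF w, of "m div n"]] by simp
    moreover from this have "m mod n = 0"
      by (rule least[rotated]) (use n in simp)
    ultimately have "u / w ^ (m div n) = 1"
      using char_graph_zeroD[of "u / w ^ (m div n)"] by simp
    then have "u = v ^ (n * (m div n))"
      using char_graph_mem(3)[OF w] by (simp add: power_mult v(2))
    then show ?thesis
      using \<open>m mod n = 0\<close> by auto
  qed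
  with v(1) show ?thesis
    by (rule that)
qed

text \<open>The new value has to be consistent: if \<open>x + n y - m y = 0\<close> with \<open>x\<close> in the domain, then \<open>(n - m) y\<close>
  or \<open>(m - n) y\<close> lies in the domain too, where the choice of \<open>v\<close> agrees with the old values.\<close>

lemma char_graph_extend:
  assumes H: "\<And>x y. x \<in> H \<Longrightarrow> y \<in> H \<Longrightarrow> x - y \<in> H" and "y \<in> H" "cmod v = 1"
    and v: "\<And>n w. (nmul n y, w) \<in> F \<Longrightarrow> w = v ^ n"
  obtains F' where "char_graph H F'" "F \<subseteq> F'" "(y, v) \<in> F'"
proof
  let ?F = "{(x + nmul n y - nmul m y, z * v ^ n / v ^ m) | x z n m. (x, z) \<in> F}"
  have [simp]: "v \<noteq> 0"
    using assms(3) by auto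
  have "0 \<in> H"
    using char_graph_mem(1)[OF char_graph_zero] .
  have add: "a + b \<in> H" if "a \<in> H" "b \<in> H" for a b
    using H[OF that(1) H[OF \<open>0 \<in> H\<close> that(2)]] by simp
  have nmul: "nmul n y \<in> H" for n
    by (induction n) (auto intro: add \<open>0 \<in> H\<close> \<open>y \<in> H\<close>)
  show "char_graph H ?F"
    unfolding char_graph_def
  proof (intro conjI allI impI)
    show "?F \<subseteq> H \<times> sphere 0 1"
      using char_graph_mem assms(3)
      by (auto simp: norm_mult norm_divide norm_power intro!: H add nmul)
    show "(0, 1) \<in> ?F"
      using char_graph_zero by (auto intro!: exI[of _ 0] exI[of _ "1::complex"])
  next
    fix a z b w assume "(a, z) \<in> ?F" "(b, w) \<in> ?F"
    then obtain x1 z1 n1 m1 x2 z2 n2 m2 where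
      eqs: "a = x1 + nmul n1 y - nmul m1 y" "z = z1 * v ^ n1 / v ^ m1" "(x1, z1) \<in> F"
        "b = x2 + nmul n2 y - nmul m2 y" "w = z2 * v ^ n2 / v ^ m2" "(x2, z2) \<in> F"
      by blast
    have "a - b = (x1 - x2) + nmul (n1 + m2) y - nmul (m1 + n2) y"
      by (simp add: eqs nmul_add algebra_simps)
    moreover have "z / w = (z1 / z2) * v ^ (n1 + m2) / v ^ (m1 + n2)"
      by (simp add: eqs power_add ac_simps)
    ultimately show "(a - b, z / w) \<in> ?F"
      using char_graph_diff[OF eqs(3,6)] by blast
  next
    fix u assume "(0, u) \<in> ?F"
    then obtain x z n m where eqs: "x + nmul n y - nmul m y = 0" "u = z * v ^ n / v ^ m" "(x, z) \<in> F"
      by auto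
    show "u = 1"
    proof (cases "m \<le> n")
      case True
      then have "- x = nmul (n - m) y"
        using eqs(1) by (simp add: nmul_diff[symmetric] algebra_simps eq_neg_iff_add_eq_0)
      then have "inverse z = v ^ (n - m)"
        using v char_graph_uminus[OF eqs(3)] by simp
      then show ?thesis
        using True char_graph_mem(3)[OF eqs(3)] by (simp add: eqs(2) power_diff field_simps)
    next
      case False
      then have "x = nmul (m - n) y"
        using eqs(1) by (simp add: nmul_diff[symmetric] algebra_simps)
      then have "z = v ^ (m - n)"
        using v eqs(3) by simp
      then show ?thesis
        using False by (simp add: eqs(2) power_diff)
    qed
  qed
  show "F \<subseteq> ?F"
    by (force intro!: exI[of _ "0::nat"])
  have "(y, v) = (0 + nmul 1 y - nmul 0 y, 1 * v ^ 1 / v ^ 0)"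
    by simp
  then show "(y, v) \<in> ?F"
    using char_graph_zero by blast
qed

end

text \<open>The subgroup generated by \<open>h\<close> has a character with value \<open>v \<noteq> 1\<close> at \<open>h\<close>: take \<open>v = -1\<close> if \<open>h\<close> has
  infinite order, and otherwise a nontrivial root of unity. A maximal extension is defined on all
  of \<open>H\<close>, as it could be extended further at any missing element; discreteness makes it continuous.\<close>

lemma characters_separate_points:
  fixes H :: "'g::topological_ab_group_add set"
  assumes "uniform_lattice H" "h \<in> H" "h \<noteq> 0"
  obtains \<gamma> where "\<gamma> \<in> dual_group H" "\<gamma> h \<noteq> 1"
proof -
  have H: "0 \<in> H" "\<And>x y. x \<in> H \<Longrightarrow> y \<in> H \<Longrightarrow> x + y \<in> H" "\<And>x. x \<in> H \<Longrightarrow> - x \<in> H" "discrete H"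
    using assms(1) by (auto simp: uniform_lattice_def)
  have Hdiff: "x - y \<in> H" if "x \<in> H" "y \<in> H" for x y
    using H(2)[OF that(1) H(3)[OF that(2)]] by simp
  have triv: "char_graph H {(0, 1)}"
    using H(1) by (simp add: char_graph_def)
  obtain v :: complex where v: "v \<noteq> 1" "cmod v = 1" "\<And>n. nmul n h = 0 \<Longrightarrow> v ^ n = 1"
  proof (cases "\<exists>n>0. nmul n h = 0")
    case False
    then have zero: "n = 0" if "nmul n h = 0" for n
      using that neq0_conv[of n] by blast
    show ?thesis
    proof (rule that[of "-1"])
      show "(- 1) ^ n = (1::complex)" if "nmul n h = 0" for n
        using zero[OF that] by simp
    qed simp_all
  next
    case True
    define n where "n = (LEAST n. 0 < n \<and> nmul n h = 0)"
    have n: "0 < n" "nmul n h = 0"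
      using LeastI_ex[of "\<lambda>n. 0 < n \<and> nmul n h = 0"] True by (auto simp: n_def)
    have "n \<noteq> 1"
      using n assms(3) by auto
    then have "2 \<le> n"
      using n by simp
    have "{z::complex. z ^ n = 1} \<noteq> {1}"
    proof
      assume "{z::complex. z ^ n = 1} = {1}"
      then have "card {z::complex. z ^ n = 1} = 1"
        by simp
      then show False
        using card_roots_unity_eq[OF n(1)] \<open>2 \<le> n\<close> by simp
    qed
    moreover have "(1::complex) \<in> {z. z ^ n = 1}"
      by simp
    ultimately obtain z :: complex where z: "z ^ n = 1" "z \<noteq> 1"
      by blast
    have "cmod z ^ n = 1"
      using z(1) by (metis norm_one norm_power)
    then have "cmod z = 1"
      using n(1) power_eq_imp_eq_base[of "cmod z" n 1] by simp
    moreover have "z ^ m = 1" if "nmul m h = 0" for m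
    proof -
      have "nmul (m mod n) h = 0"
        using that nmul_add[of "(m div n) * n" "m mod n" h] by (simp add: nmul_mult n(2) del: nmul_add)
      moreover have "m mod n < n"
        using n(1) by simp
      ultimately have "m mod n = 0"
        using not_less_Least[of "m mod n" "\<lambda>n. 0 < n \<and> nmul n h = 0"] by (auto simp: n_def)
      then have "m = n * (m div n)"
        by auto
      then show ?thesis
        by (metis z(1) power_mult power_one)
    qed
    ultimately show ?thesis
      using that z(2) by blast
  qed
  obtain F1 where F1: "char_graph H F1" "(h, v) \<in> F1"
    by (rule char_graph_extend[OF triv Hdiff assms(2) v(2)]) (use v(3) in auto)
  let ?\<A> = "{F. char_graph H F \<and> F1 \<subseteq> F}"
  have "\<exists>F\<in>?\<A>. \<forall>X\<in>?\<A>. F \<subseteq> X \<longrightarrow> X = F"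
  proof (rule subset_Zorn_nonempty)
    show "?\<A> \<noteq> {}"
      using F1(1) by blast
    fix \<C> assume "\<C> \<noteq> {}" "subset.chain ?\<A> \<C>"
    then have mem: "\<And>C. C \<in> \<C> \<Longrightarrow> char_graph H C \<and> F1 \<subseteq> C"
      and chain: "\<And>C D. C \<in> \<C> \<Longrightarrow> D \<in> \<C> \<Longrightarrow> C \<subseteq> D \<or> D \<subseteq> C"
      by (auto simp: subset_chain_def)
    have "char_graph H (\<Union>\<C>)"
      unfolding char_graph_def
    proof (intro conjI allI impI)
      show "\<Union>\<C> \<subseteq> H \<times> sphere 0 1"
        using mem unfolding char_graph_def by blast
      show "(0, 1) \<in> \<Union>\<C>"
        using mem \<open>\<C> \<noteq> {}\<close> char_graph_zero by blast
      show "z = 1" if "(0, z) \<in> \<Union>\<C>" for z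
        using that mem char_graph_zeroD by blast
      fix x z y w assume "(x, z) \<in> \<Union>\<C>" "(y, w) \<in> \<Union>\<C>"
      then obtain C D where "C \<in> \<C>" "(x, z) \<in> C" "D \<in> \<C>" "(y, w) \<in> D"
        by blast
      then obtain E where "E \<in> \<C>" "(x, z) \<in> E" "(y, w) \<in> E"
        using chain[of C D] by blast
      then show "(x - y, z / w) \<in> \<Union>\<C>"
        using mem char_graph_diff by blast
    qed
    then show "\<Union>\<C> \<in> ?\<A>"
      using mem \<open>\<C> \<noteq> {}\<close> by blast
  qed
  then obtain F where F0: "F \<in> ?\<A>" and max0: "\<forall>X\<in>?\<A>. F \<subseteq> X \<longrightarrow> X = F"
    by (elim bexE)
  have F: "char_graph H F" "F1 \<subseteq> F"
    using F0 by simp_all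
  have max: "X = F" if "char_graph H X" "F \<subseteq> X" for X
    using max0 that subset_trans[OF F(2) that(2)] by simp
  have total: "\<exists>z. (y, z) \<in> F" if y: "y \<in> H" for y
  proof -
    obtain w where w: "cmod w = 1" "\<And>n u. (nmul n y, u) \<in> F \<Longrightarrow> u = w ^ n"
      using char_graph_value_exists[OF F(1)] by blast
    obtain F' where "char_graph H F'" "F \<subseteq> F'" "(y, w) \<in> F'"
      using char_graph_extend[OF F(1) Hdiff y w] by blast
    then show ?thesis
      using max by blast
  qed
  define \<gamma> where "\<gamma> = restrict (\<lambda>x. SOME z. (x, z) \<in> F) H"
  have graph: "(x, \<gamma> x) \<in> F" if "x \<in> H" for x
    using someI_ex[OF total[OF that]] that by (simp add: \<gamma>_def)
  have "\<gamma> (x + y) = \<gamma> x * \<gamma> y" if "x \<in> H" "y \<in> H" for x y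
    using char_graph_unique[OF F(1) graph[OF H(2)[OF that]] char_graph_add[OF F(1) graph[OF that(1)] graph[OF that(2)]]] .
  then have "\<gamma> \<in> dual_group H"
    using char_graph_mem(2)[OF F(1) graph] continuous_on_discrete[OF H(4)]
    by (simp add: dual_group_def \<gamma>_def)
  moreover have "\<gamma> h = v"
    using char_graph_unique[OF F(1) graph[OF assms(2)]] F1(2) F(2) by blast
  ultimately show ?thesis
    using that v(1) by simp
qed

section \<open>The dual group as a probability space\<close>

text \<open>The function \<open>\<chi>\<^sub>h\<close> on the dual; a named constant makes the characters an indexed family.\<close>

definition char_value :: "'g \<Rightarrow> ('g \<Rightarrow> complex) \<Rightarrow> complex" where
  "char_value h \<gamma> = \<gamma> h"

locale lattice_dual =
  fixes H :: "'g::topological_ab_group_add set" and \<nu> :: "('g \<Rightarrow> complex) measure"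
  assumes lattice: "uniform_lattice H" and countable_H: "countable H"
    and dual_haar: "normalized_dual_haar_measure H \<nu>"
begin

abbreviation trig_poly :: "('g \<Rightarrow> complex) \<Rightarrow> ('g \<Rightarrow> complex) \<Rightarrow> complex" where
  "trig_poly \<equiv> lincomb char_value"

lemma zero_H [simp]: "0 \<in> H"
  and add_H: "x \<in> H \<Longrightarrow> y \<in> H \<Longrightarrow> x + y \<in> H"
  and minus_H: "x \<in> H \<Longrightarrow> - x \<in> H"
  and discrete_H: "discrete H"
  using lattice by (auto simp: uniform_lattice_def)

lemma diff_H: "x \<in> H \<Longrightarrow> y \<in> H \<Longrightarrow> x - y \<in> H"
  using add_H[OF _ minus_H, of x y] by simp

lemma space_dual: "space \<nu> = dual_group H"
  and sets_dual: "sets \<nu> = sigma_sets (dual_group H) {U. openin (dual_topology H) U}"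
  using dual_haar by (auto simp: normalized_dual_haar_measure_def)

lemma prob_space_dual: "prob_space \<nu>"
  using dual_haar by (intro prob_spaceI) (simp add: normalized_dual_haar_measure_def)

lemma finite_measure_dual: "finite_measure \<nu>"
  using prob_space_dual by (rule prob_space.axioms(1))

context
  fixes \<gamma> assumes \<gamma>: "\<gamma> \<in> dual_group H"
begin

lemma dual_norm: "h \<in> H \<Longrightarrow> cmod (\<gamma> h) = 1"
  and dual_add: "h \<in> H \<Longrightarrow> k \<in> H \<Longrightarrow> \<gamma> (h + k) = \<gamma> h * \<gamma> k"
  using \<gamma> by (auto simp: dual_group_def)

lemma dual_nonzero: "h \<in> H \<Longrightarrow> \<gamma> h \<noteq> 0"
  using dual_norm by fastforce

lemma dual_zero: "\<gamma> 0 = 1"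
  using dual_add[of 0 0] dual_nonzero[of 0] by simp

lemma dual_minus: assumes "h \<in> H" shows "\<gamma> (- h) = cnj (\<gamma> h)"
proof -
  have "\<gamma> h * \<gamma> (- h) = \<gamma> h * cnj (\<gamma> h)"
    using dual_add[OF assms minus_H[OF assms]] dual_norm[OF assms]
    by (simp add: dual_zero complex_norm_square[symmetric])
  then show ?thesis
    using dual_nonzero[OF assms] by simp
qed

lemma dual_diff: "h \<in> H \<Longrightarrow> k \<in> H \<Longrightarrow> \<gamma> (h - k) = \<gamma> h * cnj (\<gamma> k)"
  using dual_add[of h "- k"] by (simp add: minus_H dual_minus)

end

lemma dual_groupI:
  assumes "\<gamma> \<in> extensional H" "\<And>h. h \<in> H \<Longrightarrow> cmod (\<gamma> h) = 1"
    "\<And>h k. h \<in> H \<Longrightarrow> k \<in> H \<Longrightarrow> \<gamma> (h + k) = \<gamma> h * \<gamma> k"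
  shows "\<gamma> \<in> dual_group H"
  using assms continuous_on_discrete[OF discrete_H] by (simp add: dual_group_def)

lemma openin_cylinder:
  assumes "h \<in> H" "open V"
  shows "openin (dual_topology H) {\<gamma> \<in> dual_group H. \<gamma> h \<in> V}"
proof -
  have "openin (product_topology (\<lambda>_. euclidean) H)
      {\<gamma> \<in> topspace (product_topology (\<lambda>_. euclidean) H). \<gamma> h \<in> V}"
    by (rule openin_continuous_map_preimage[OF continuous_map_product_projection[OF assms(1)]])
      (use assms(2) in simp)
  moreover have "{\<gamma> \<in> dual_group H. \<gamma> h \<in> V}
      = {\<gamma> \<in> topspace (product_topology (\<lambda>_. euclidean) H). \<gamma> h \<in> V} \<inter> dual_group H"
    by (auto simp: dual_group_def PiE_def)
  ultimately show ?thesis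
    unfolding dual_topology_def openin_subtopology by blast
qed

text \<open>Since \<open>H\<close> is countable, every open set of the dual is a countable union of finite
  intersections of cylinders, so cylinders already generate the Borel sets.\<close>

lemma sets_dual_subset:
  assumes S: "sigma_algebra (dual_group H) S"
    and cyl: "\<And>h V. h \<in> H \<Longrightarrow> open V \<Longrightarrow> {\<gamma> \<in> dual_group H. \<gamma> h \<in> V} \<in> S"
  shows "sets \<nu> \<subseteq> S"
proof -
  interpret S: sigma_algebra "dual_group H" S by fact
  obtain B :: "complex set set" where B: "countable B" "topological_basis B"
    using ex_countable_basis by blast
  define box where "box Q = {\<gamma> \<in> dual_group H. \<forall>(h, V)\<in>Q. \<gamma> h \<in> V}" for Q :: "('g \<times> complex set) set"
  have box: "box Q \<in> S" if "finite Q" "Q \<subseteq> H \<times> B" for Q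
    using that
  proof (induction Q)
    case empty
    then show ?case
      by (simp add: box_def)
  next
    case (insert p Q)
    obtain h V where p: "p = (h, V)" "h \<in> H" "V \<in> B"
      using insert.prems by auto
    have "box (insert p Q) = {\<gamma> \<in> dual_group H. \<gamma> h \<in> V} \<inter> box Q"
      by (auto simp: box_def p(1))
    then show ?case
      using insert p topological_basis_open[OF B(2)] by (auto intro!: S.Int cyl)
  qed
  have "U \<in> S" if U: "openin (dual_topology H) U" for U
  proof -
    let ?Q = "{Q. Q \<in> {Q. finite Q \<and> Q \<subseteq> H \<times> B} \<and> box Q \<subseteq> U}"
    obtain T where T: "openin (product_topology (\<lambda>_. euclidean) H) T" "U = T \<inter> dual_group H"
      using U by (auto simp: dual_topology_def openin_subtopology)
    have "U \<subseteq> (\<Union>Q\<in>?Q. box Q)"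
    proof
      fix \<gamma> assume "\<gamma> \<in> U"
      then have \<gamma>: "\<gamma> \<in> T" "\<gamma> \<in> dual_group H"
        by (auto simp: T(2))
      obtain W where W: "finite {i \<in> H. W i \<noteq> UNIV}" "\<And>i. i \<in> H \<Longrightarrow> open (W i)"
          "\<gamma> \<in> Pi\<^sub>E H W" "Pi\<^sub>E H W \<subseteq> T"
        using T(1) \<gamma>(1) unfolding openin_product_topology_alt by auto
      define J where "J = {i \<in> H. W i \<noteq> UNIV}"
      have "\<exists>V\<in>B. \<gamma> i \<in> V \<and> V \<subseteq> W i" if "i \<in> H" for i
      proof (rule topological_basisE[OF B(2) W(2)[OF that]])
        show "\<gamma> i \<in> W i"
          using W(3) that by (auto simp: PiE_iff)
      qed blast
      then obtain V where V: "\<And>i. i \<in> H \<Longrightarrow> V i \<in> B \<and> \<gamma> i \<in> V i \<and> V i \<subseteq> W i"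
        by metis
      let ?q = "(\<lambda>i. (i, V i)) ` J"
      have "box ?q \<subseteq> U"
      proof
        fix \<eta> assume \<eta>: "\<eta> \<in> box ?q"
        have "\<eta> i \<in> W i" if "i \<in> H" for i
          using that \<eta> V by (cases "i \<in> J") (auto simp: box_def J_def)
        then have "\<eta> \<in> Pi\<^sub>E H W"
          using \<eta> by (auto simp: box_def dual_group_def PiE_iff)
        then show "\<eta> \<in> U"
          using W(4) \<eta> by (auto simp: T(2) box_def)
      qed
      moreover have "finite ?q" "?q \<subseteq> H \<times> B" "\<gamma> \<in> box ?q"
        using W(1) V \<gamma>(2) by (auto simp: J_def box_def)
      ultimately show "\<gamma> \<in> (\<Union>Q\<in>?Q. box Q)"
        by blast
    qed
    then have "U = (\<Union>Q\<in>?Q. box Q)"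
      by blast
    also have "\<dots> \<in> S"
    proof (rule S.countable_UN')
      have "countable {Q. finite Q \<and> Q \<subseteq> H \<times> B}"
        using countable_H B(1) by (intro countable_Collect_finite_subset countable_SIGMA)
      then show "countable ?Q"
        by (rule countable_subset[rotated]) auto
    qed (use box in auto)
    finally show ?thesis .
  qed
  then show ?thesis
    unfolding sets_dual by (intro S.sigma_sets_subset) auto
qed

lemma cylinder_in_sets: "h \<in> H \<Longrightarrow> open V \<Longrightarrow> {\<gamma> \<in> dual_group H. \<gamma> h \<in> V} \<in> sets \<nu>"
  unfolding sets_dual using openin_cylinder by (intro sigma_sets.Basic) simp

lemma char_value_measurable [measurable]: "h \<in> H \<Longrightarrow> char_value h \<in> borel_measurable \<nu>"
  by (rule borel_measurableI)
    (use cylinder_in_sets in \<open>simp add: char_value_def vimage_def Int_def space_dual conj_commute\<close>)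

lemma char_value_L2: "h \<in> H \<Longrightarrow> char_value h \<in> L2 \<nu>"
proof -
  assume h: "h \<in> H"
  interpret prob_space \<nu> by (rule prob_space_dual)
  have "integrable \<nu> (\<lambda>\<gamma>. (cmod (char_value h \<gamma>))\<^sup>2)"
  proof (rule integrable_const_bound[of _ 1])
    show "AE \<gamma> in \<nu>. norm ((cmod (char_value h \<gamma>))\<^sup>2) \<le> 1"
      by (rule AE_I2) (use h dual_norm in \<open>simp add: space_dual char_value_def\<close>)
  qed (use h in measurable)
  then show ?thesis
    using h by (simp add: L2_def)
qed

definition dual_mult :: "('g \<Rightarrow> complex) \<Rightarrow> ('g \<Rightarrow> complex) \<Rightarrow> 'g \<Rightarrow> complex" where
  "dual_mult \<gamma> \<eta> = restrict (\<lambda>h. \<gamma> h * \<eta> h) H"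

lemma dual_mult_closed: "\<gamma> \<in> dual_group H \<Longrightarrow> \<eta> \<in> dual_group H \<Longrightarrow> dual_mult \<gamma> \<eta> \<in> dual_group H"
  by (rule dual_groupI) (auto simp: dual_mult_def dual_norm dual_add norm_mult add_H)

lemma dual_mult_measurable:
  assumes "\<gamma> \<in> dual_group H"
  shows "dual_mult \<gamma> \<in> measurable \<nu> \<nu>"
proof -
  let ?S = "{A. A \<subseteq> dual_group H \<and> dual_mult \<gamma> -` A \<inter> space \<nu> \<in> sets \<nu>}"
  have "sigma_algebra (dual_group H) ?S"
    unfolding sigma_algebra_iff2
  proof (intro conjI ballI allI impI)
    show "?S \<subseteq> Pow (dual_group H)" "{} \<in> ?S"
      by auto
    show "dual_group H - A \<in> ?S" if "A \<in> ?S" for A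
    proof -
      have "dual_mult \<gamma> -` (dual_group H - A) \<inter> space \<nu> = space \<nu> - (dual_mult \<gamma> -` A \<inter> space \<nu>)"
        using dual_mult_closed[OF assms] by (auto simp: space_dual)
      then show ?thesis
        using that by auto
    qed
    show "(\<Union>i::nat. A i) \<in> ?S" if "range A \<subseteq> ?S" for A
    proof -
      have "dual_mult \<gamma> -` (\<Union>i. A i) \<inter> space \<nu> = (\<Union>i. dual_mult \<gamma> -` A i \<inter> space \<nu>)"
        by auto
      also have "\<dots> \<in> sets \<nu>"
        using that by (intro sets.countable_UN) auto
      finally show ?thesis
        using that by blast
    qed
  qed
  moreover have "{\<eta> \<in> dual_group H. \<eta> h \<in> V} \<in> ?S" if h: "h \<in> H" and V: "open V" for h V
  proof -
    have "dual_mult \<gamma> -` {\<eta> \<in> dual_group H. \<eta> h \<in> V} \<inter> space \<nu>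
        = (\<lambda>\<eta>. \<gamma> h * char_value h \<eta>) -` V \<inter> space \<nu>"
      using dual_mult_closed[OF assms] h by (auto simp: space_dual dual_mult_def char_value_def)
    also have "\<dots> \<in> sets \<nu>"
      by (rule measurable_sets[where A=borel]) (use h V in \<open>auto intro!: borel_measurable_times char_value_measurable\<close>)
    finally show ?thesis by simp
  qed
  ultimately have "sets \<nu> \<subseteq> ?S"
    by (rule sets_dual_subset)
  then show ?thesis
    using dual_mult_closed[OF assms] by (intro measurableI) (auto simp: space_dual)
qed

text \<open>Invariance of the Haar measure in the form needed for the change of variables formula: preimages
  under multiplication by \<open>\<gamma>\<close> are images under multiplication by its conjugate.\<close>

lemma distr_dual_mult:
  assumes \<gamma>: "\<gamma> \<in> dual_group H"
  shows "distr \<nu> \<nu> (dual_mult \<gamma>) = \<nu>"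
proof (rule measure_eqI)
  fix A assume "A \<in> sets (distr \<nu> \<nu> (dual_mult \<gamma>))"
  then have A: "A \<in> sets \<nu>" "A \<subseteq> dual_group H"
    using sets.sets_into_space[of A \<nu>] by (auto simp: space_dual)
  define \<delta> where "\<delta> = restrict (\<lambda>h. cnj (\<gamma> h)) H"
  have \<delta>: "\<delta> \<in> dual_group H"
    by (rule dual_groupI) (auto simp: \<delta>_def dual_norm[OF \<gamma>] dual_add[OF \<gamma>] add_H)
  have inv: "dual_mult \<gamma> (dual_mult \<delta> \<eta>) = \<eta>" "dual_mult \<delta> (dual_mult \<gamma> \<eta>) = \<eta>" if "\<eta> \<in> dual_group H" for \<eta>
  proof -
    have "\<gamma> h * cnj (\<gamma> h) = 1" if "h \<in> H" for h
      using dual_norm[OF \<gamma> that] by (simp add: complex_norm_square[symmetric])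
    moreover from this have "cnj (\<gamma> h) * \<gamma> h = 1" if "h \<in> H" for h
      using that by (simp add: mult.commute)
    ultimately show "dual_mult \<gamma> (dual_mult \<delta> \<eta>) = \<eta>" "dual_mult \<delta> (dual_mult \<gamma> \<eta>) = \<eta>"
      using that by (auto simp: dual_mult_def \<delta>_def fun_eq_iff dual_group_def extensional_def mult.assoc[symmetric])
  qed
  have "dual_mult \<gamma> -` A \<inter> space \<nu> = dual_mult \<delta> ` A"
  proof
    show "dual_mult \<gamma> -` A \<inter> space \<nu> \<subseteq> dual_mult \<delta> ` A"
      using inv(2) by (force simp: space_dual)
    show "dual_mult \<delta> ` A \<subseteq> dual_mult \<gamma> -` A \<inter> space \<nu>"
      using inv(1) A(2) dual_mult_closed[OF \<delta>] by (auto simp: space_dual subset_iff)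
  qed
  moreover have "emeasure \<nu> (dual_mult \<delta> ` A) = emeasure \<nu> A"
    using dual_haar \<delta> A(1) by (simp add: normalized_dual_haar_measure_def dual_mult_def[abs_def])
  ultimately show "emeasure (distr \<nu> \<nu> (dual_mult \<gamma>)) A = emeasure \<nu> A"
    using A(1) by (simp add: emeasure_distr dual_mult_measurable[OF \<gamma>])
qed simp

lemma integrable_char_value: "h \<in> H \<Longrightarrow> integrable \<nu> (char_value h)"
proof -
  interpret prob_space \<nu> by (rule prob_space_dual)
  show "h \<in> H \<Longrightarrow> integrable \<nu> (char_value h)"
    by (rule integrable_const_bound[of _ 1]) (auto simp: space_dual char_value_def dual_norm)
qed

text \<open>Substituting \<open>\<gamma> \<eta>\<close> for \<open>\<eta>\<close> multiplies the integral by \<open>\<gamma> h\<close>, which for \<open>h \<noteq> 0\<close> can be chosen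
  different from \<open>1\<close>.\<close>

lemma integral_char_value:
  assumes h: "h \<in> H"
  shows "(\<integral>\<gamma>. char_value h \<gamma> \<partial>\<nu>) = (if h = 0 then 1 else 0)"
proof (cases "h = 0")
  case True
  interpret prob_space \<nu> by (rule prob_space_dual)
  have "(\<integral>\<gamma>. char_value h \<gamma> \<partial>\<nu>) = (\<integral>\<gamma>. 1 \<partial>\<nu>)"
    by (rule Bochner_Integration.integral_cong) (auto simp: char_value_def True space_dual dual_zero)
  then show ?thesis
    using True prob_space by simp
next
  case False
  then obtain \<gamma> where \<gamma>: "\<gamma> \<in> dual_group H" "\<gamma> h \<noteq> 1"
    using characters_separate_points[OF lattice h] by blast
  have "(\<integral>\<eta>. char_value h \<eta> \<partial>\<nu>) = (\<integral>\<eta>. char_value h (dual_mult \<gamma> \<eta>) \<partial>\<nu>)"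
    using integral_distr[OF dual_mult_measurable[OF \<gamma>(1)] char_value_measurable[OF h]]
    by (simp add: distr_dual_mult[OF \<gamma>(1)])
  also have "\<dots> = (\<integral>\<eta>. \<gamma> h * char_value h \<eta> \<partial>\<nu>)"
    using h by (simp add: dual_mult_def char_value_def)
  also have "\<dots> = \<gamma> h * (\<integral>\<eta>. char_value h \<eta> \<partial>\<nu>)"
    using integrable_char_value[OF h] by simp
  finally show ?thesis
    using \<gamma>(2) False by simp
qed

text \<open>Parseval's identity for trigonometric polynomials.\<close>

lemma L2_norm_trig_polynomial:
  assumes "c \<in> fin_coeffs H"
  shows "(L2_norm \<nu> (trig_poly c))\<^sup>2 = coeff_norm2 c"
proof -
  let ?X = "{i. c i \<noteq> 0}"
  have X: "finite ?X" "?X \<subseteq> H"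
    using assms by (auto simp: fin_coeffs_def)
  have "complex_of_real ((L2_norm \<nu> (trig_poly c))\<^sup>2)
      = (\<integral>\<gamma>. complex_of_real ((cmod (trig_poly c \<gamma>))\<^sup>2) \<partial>\<nu>)"
    by (simp only: L2_norm_square integral_complex_of_real)
  also have "\<dots> = (\<integral>\<gamma>. (\<Sum>i\<in>?X. \<Sum>j\<in>?X. c i * cnj (c j) * char_value (i - j) \<gamma>) \<partial>\<nu>)"
  proof (rule Bochner_Integration.integral_cong)
    fix \<gamma> assume "\<gamma> \<in> space \<nu>"
    then have \<gamma>: "\<gamma> \<in> dual_group H"
      by (simp add: space_dual)
    have "complex_of_real ((cmod (trig_poly c \<gamma>))\<^sup>2)
        = (\<Sum>i\<in>?X. c i * \<gamma> i) * (\<Sum>j\<in>?X. cnj (c j) * cnj (\<gamma> j))"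
      by (simp only: complex_norm_square) (simp add: lincomb_def char_value_def)
    also have "\<dots> = (\<Sum>i\<in>?X. \<Sum>j\<in>?X. c i * cnj (c j) * char_value (i - j) \<gamma>)"
      unfolding sum_product
      by (intro sum.cong refl) (use X(2) dual_diff[OF \<gamma>] in \<open>auto simp: char_value_def subset_iff\<close>)
    finally show "complex_of_real ((cmod (trig_poly c \<gamma>))\<^sup>2)
        = (\<Sum>i\<in>?X. \<Sum>j\<in>?X. c i * cnj (c j) * char_value (i - j) \<gamma>)" .
  qed simp
  also have "\<dots> = (\<Sum>i\<in>?X. \<Sum>j\<in>?X. c i * cnj (c j) * (\<integral>\<gamma>. char_value (i - j) \<gamma> \<partial>\<nu>))"
    using X(2)
    by (subst Bochner_Integration.integral_sum, force intro!: integrable_char_value diff_H)+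
      (auto intro!: sum.cong Bochner_Integration.integral_sum[THEN trans] integrable_char_value diff_H)
  also have "\<dots> = (\<Sum>i\<in>?X. \<Sum>j\<in>?X. if i = j then c i * cnj (c j) else 0)"
    using X(2) by (intro sum.cong refl) (auto simp: integral_char_value diff_H subset_iff)
  also have "\<dots> = (\<Sum>i\<in>?X. complex_of_real ((cmod (c i))\<^sup>2))"
    using X(1) by (intro sum.cong refl) (simp add: complex_norm_square[symmetric])
  also have "\<dots> = complex_of_real (coeff_norm2 c)"
    by (simp add: coeff_norm2_def)
  finally show ?thesis
    by (simp only: of_real_eq_iff)
qed

lemma riesz_bounds_characters: "riesz_bounds \<nu> H char_value 1 1"
  by (simp add: riesz_bounds_def char_value_L2 L2_norm_trig_polynomial)

end

section \<open>Density of trigonometric polynomials\<close>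

lemma L2_closed_span_cong:
  assumes "u \<in> L2_closed_span M I f" "\<And>x. x \<in> space M \<Longrightarrow> u x = v x"
  shows "v \<in> L2_closed_span M I f"
proof -
  have u: "u \<in> L2 M"
    using assms(1) by (rule L2_closed_span_in_L2)
  have "v \<in> borel_measurable M"
    using measurable_cong[of M u v borel] assms(2) L2_measurable[OF u] by blast
  then have "v \<in> L2 M"
    using assms(2) by (intro L2_cong_AE[OF u]) auto
  moreover have "L2_norm M (\<lambda>x. u x - w x) = L2_norm M (\<lambda>x. v x - w x)" for w
    unfolding L2_norm_def using assms(2)
    by (intro arg_cong[where f=sqrt] Bochner_Integration.integral_cong) auto
  ultimately show ?thesis
    using assms(1) by (simp add: L2_closed_span_iff)
qed

text \<open>Multiplication by a bounded function is continuous, so that it preserves the closed span as soon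
  as it maps the generators into it. Applied twice, first to a character and then to any bounded
  function in the closed span of the characters, it shows that those functions form an algebra.\<close>

lemma L2_closed_span_mult:
  assumes f: "\<And>i. i \<in> I \<Longrightarrow> f i \<in> L2 M" and u: "u \<in> L2_closed_span M I f"
    and w: "w \<in> borel_measurable M" "\<And>x. x \<in> space M \<Longrightarrow> cmod (w x) \<le> C" "0 \<le> C"
    and gen: "\<And>i. i \<in> I \<Longrightarrow> (\<lambda>x. w x * f i x) \<in> L2_closed_span M I f"
  shows "(\<lambda>x. w x * u x) \<in> L2_closed_span M I f"
proof -
  have AE: "AE x in M. cmod (w x) \<le> C"
    using w(2) by simp
  obtain c where c: "\<And>n. c n \<in> fin_coeffs I"
      "(\<lambda>n. L2_norm M (\<lambda>x. lincomb f (c n) x - u x)) \<longlonglongrightarrow> 0"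
    using L2_closed_span_sequence[OF u] by blast
  note L2 = lincomb_L2[OF c(1) f] L2_closed_span_in_L2[OF u]
  show ?thesis
  proof (rule L2_closed_span_tendsto[OF f])
    show "(\<lambda>x. w x * u x) \<in> L2 M"
      using w(1) L2(2) AE by (rule L2_mult_bounded)
    have "(\<lambda>x. \<Sum>i | c n i \<noteq> 0. c n i * (w x * f i x)) \<in> L2_closed_span M I f" for n
      using c(1)[of n]
      by (intro L2_closed_span_sum L2_closed_span_cmult f gen) (auto simp: fin_coeffs_def)
    then show "\<forall>\<^sub>F n in sequentially. (\<lambda>x. w x * lincomb f (c n) x) \<in> L2_closed_span M I f"
      by (simp add: lincomb_def sum_distrib_left mult_ac)
    have "(\<lambda>n. C * L2_norm M (\<lambda>x. lincomb f (c n) x - u x)) \<longlonglongrightarrow> C * 0"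
      by (intro tendsto_intros c(2))
    then have lim: "(\<lambda>n. C * L2_norm M (\<lambda>x. lincomb f (c n) x - u x)) \<longlonglongrightarrow> 0"
      by simp
    show "(\<lambda>n. L2_norm M (\<lambda>x. w x * lincomb f (c n) x - w x * u x)) \<longlonglongrightarrow> 0"
    proof (rule Lim_null_comparison[OF always_eventually[OF allI] lim])
      fix n
      have "L2_norm M (\<lambda>x. w x * (lincomb f (c n) x - u x)) \<le> C * L2_norm M (\<lambda>x. lincomb f (c n) x - u x)"
        using w(1,3) L2 AE by (intro L2_norm_mult_bounded_le L2_diff) auto
      then show "norm (L2_norm M (\<lambda>x. w x * lincomb f (c n) x - w x * u x))
          \<le> C * L2_norm M (\<lambda>x. lincomb f (c n) x - u x)"
        by (simp add: right_diff_distrib)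
    qed
  qed auto
qed

lemma (in finite_measure) bounded_in_L2:
  assumes "f \<in> borel_measurable M" "\<And>x. x \<in> space M \<Longrightarrow> cmod (f x) \<le> C"
  shows "f \<in> L2 M"
proof -
  have "integrable M (\<lambda>x. (cmod (f x))\<^sup>2)"
    by (rule integrable_const_bound[of _ "C\<^sup>2"]) (use assms in \<open>auto intro!: power_mono\<close>)
  then show ?thesis
    using assms(1) by (simp add: L2_def)
qed

lemma (in finite_measure) L2_bounded_convergence:
  assumes u: "\<And>n. u n \<in> borel_measurable M" and f: "f \<in> borel_measurable M"
    and lim: "\<And>x. x \<in> space M \<Longrightarrow> (\<lambda>n. u n x) \<longlonglongrightarrow> f x"
    and bound: "\<And>n x. x \<in> space M \<Longrightarrow> cmod (u n x) \<le> C"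
  shows "f \<in> L2 M" "(\<lambda>n. L2_norm M (\<lambda>x. u n x - f x)) \<longlonglongrightarrow> 0"
proof -
  have fC: "cmod (f x) \<le> C" if "x \<in> space M" for x
    by (rule LIMSEQ_le_const2[OF tendsto_norm[OF lim[OF that]]]) (use bound that in auto)
  show "f \<in> L2 M"
    using bounded_in_L2[OF f fC] .
  have "(\<lambda>n. \<integral>x. (cmod (u n x - f x))\<^sup>2 \<partial>M) \<longlonglongrightarrow> (\<integral>x. 0 \<partial>M)"
  proof (rule integral_dominated_convergence[where w="\<lambda>_. (2 * C)\<^sup>2"])
    show "AE x in M. (\<lambda>n. (cmod (u n x - f x))\<^sup>2) \<longlonglongrightarrow> 0"
    proof (rule AE_I2)
      fix x assume "x \<in> space M"
      then have "(\<lambda>n. (cmod (u n x - f x))\<^sup>2) \<longlonglongrightarrow> (cmod (f x - f x))\<^sup>2"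
        by (intro tendsto_intros lim)
      then show "(\<lambda>n. (cmod (u n x - f x))\<^sup>2) \<longlonglongrightarrow> 0"
        by simp
    qed
    show "AE x in M. norm ((cmod (u n x - f x))\<^sup>2) \<le> (2 * C)\<^sup>2" for n
    proof (rule AE_I2)
      fix x assume x: "x \<in> space M"
      have "cmod (u n x - f x) \<le> 2 * C"
        using norm_triangle_ineq4[of "u n x" "f x"] bound[OF x, of n] fC[OF x] by linarith
      from power_mono[OF this norm_ge_zero, of 2]
      show "norm ((cmod (u n x - f x))\<^sup>2) \<le> (2 * C)\<^sup>2"
        by simp
    qed
  qed (use u f in auto)
  then have "(\<lambda>n. sqrt (\<integral>x. (cmod (u n x - f x))\<^sup>2 \<partial>M)) \<longlonglongrightarrow> sqrt 0"
    by (intro tendsto_real_sqrt) simp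
  then show "(\<lambda>n. L2_norm M (\<lambda>x. u n x - f x)) \<longlonglongrightarrow> 0"
    by (simp add: L2_norm_def)
qed

text \<open>Let \<open>\<mu>\<close> be any finite Borel measure on the dual, for instance the Haar measure weighted by an
  integrable function. The bounded functions in the closed span of the characters form an algebra
  closed under bounded pointwise limits. By the Weierstrass theorem on the unit circle this algebra
  contains all continuous functions of a single coordinate, hence indicators of cylinders, hence
  indicators of all Borel sets.\<close>

locale lattice_dual_measure = lattice_dual H \<nu> + finite_measure \<mu>
  for H :: "'g::topological_ab_group_add set" and \<nu> and \<mu> :: "('g \<Rightarrow> complex) measure" +
  assumes sets_\<mu>: "sets \<mu> = sets \<nu>"
begin

abbreviation trig_closure :: "(('g \<Rightarrow> complex) \<Rightarrow> complex) set" where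
  "trig_closure \<equiv> L2_closed_span \<mu> H char_value"

lemma space_\<mu>: "space \<mu> = dual_group H"
  using sets_eq_imp_space_eq[OF sets_\<mu>] by (simp add: space_dual)

lemma measurable_\<mu>: "borel_measurable \<mu> = borel_measurable \<nu>"
  by (rule measurable_cong_sets[OF sets_\<mu> refl])

lemma char_value_L2_\<mu>: "h \<in> H \<Longrightarrow> char_value h \<in> L2 \<mu>"
  by (rule bounded_in_L2[of _ 1])
    (simp_all add: measurable_\<mu> char_value_measurable space_\<mu> char_value_def dual_norm)

lemmas trig_closure_add = L2_closed_span_add[OF char_value_L2_\<mu>]
  and trig_closure_cmult = L2_closed_span_cmult[OF char_value_L2_\<mu>]
  and trig_closure_diff = L2_closed_span_diff[OF char_value_L2_\<mu>]
  and trig_closure_sum = L2_closed_span_sum[OF char_value_L2_\<mu>]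
  and trig_closure_tendsto = L2_closed_span_tendsto[OF char_value_L2_\<mu>]
  and trig_closure_char_value = L2_closed_span_generator[OF _ char_value_L2_\<mu>]

lemma trig_closure_const: "(\<lambda>\<gamma>. k) \<in> trig_closure"
proof -
  have "(\<lambda>\<gamma>. k * char_value 0 \<gamma>) \<in> trig_closure"
    by (intro trig_closure_cmult trig_closure_char_value) simp_all
  then show ?thesis
    by (rule L2_closed_span_cong) (simp add: space_\<mu> char_value_def dual_zero)
qed

lemma trig_closure_mult_char_value:
  assumes k: "k \<in> H" and f: "f \<in> trig_closure"
  shows "(\<lambda>\<gamma>. char_value k \<gamma> * f \<gamma>) \<in> trig_closure"
proof -
  have gen: "(\<lambda>\<gamma>. char_value k \<gamma> * char_value i \<gamma>) \<in> trig_closure" if i: "i \<in> H" for i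
    by (rule L2_closed_span_cong[OF trig_closure_char_value[OF add_H[OF k i]]])
      (use k i in \<open>simp_all add: space_\<mu> char_value_def dual_add\<close>)
  show ?thesis
    by (rule L2_closed_span_mult[OF char_value_L2_\<mu> f L2_measurable[OF char_value_L2_\<mu>[OF k]] _ zero_le_one gen])
      (use k in \<open>simp_all add: space_\<mu> char_value_def dual_norm\<close>)
qed

lemma trig_closure_mult:
  assumes f: "f \<in> trig_closure" and bound: "\<And>\<gamma>. \<gamma> \<in> dual_group H \<Longrightarrow> cmod (f \<gamma>) \<le> C"
    and g: "g \<in> trig_closure"
  shows "(\<lambda>\<gamma>. f \<gamma> * g \<gamma>) \<in> trig_closure"
proof -
  have gen: "(\<lambda>\<gamma>. f \<gamma> * char_value i \<gamma>) \<in> trig_closure" if "i \<in> H" for i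
    using trig_closure_mult_char_value[OF that f] by (simp add: mult.commute)
  show ?thesis
  proof (rule L2_closed_span_mult[OF char_value_L2_\<mu> g _ _ _ gen])
    show "f \<in> borel_measurable \<mu>"
      using f by (intro L2_measurable L2_closed_span_in_L2)
    show "cmod (f \<gamma>) \<le> max C 0" if "\<gamma> \<in> space \<mu>" for \<gamma>
      using bound[of \<gamma>] that by (simp add: space_\<mu> le_max_iff_disj)
  qed simp_all
qed

lemma trig_closure_bounded_limit:
  assumes u: "\<And>n. u n \<in> trig_closure"
    and lim: "\<And>\<gamma>. \<gamma> \<in> dual_group H \<Longrightarrow> (\<lambda>n. u n \<gamma>) \<longlonglongrightarrow> f \<gamma>"
    and bound: "\<And>n \<gamma>. \<gamma> \<in> dual_group H \<Longrightarrow> cmod (u n \<gamma>) \<le> C"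
  shows "f \<in> trig_closure"
proof -
  have meas: "u n \<in> borel_measurable \<mu>" for n
    using u by (intro L2_measurable L2_closed_span_in_L2)
  have f: "f \<in> borel_measurable \<mu>"
    by (rule borel_measurable_LIMSEQ_metric[OF meas]) (use lim in \<open>simp add: space_\<mu>\<close>)
  have lim': "\<And>\<gamma>. \<gamma> \<in> space \<mu> \<Longrightarrow> (\<lambda>n. u n \<gamma>) \<longlonglongrightarrow> f \<gamma>"
    and bound': "\<And>n \<gamma>. \<gamma> \<in> space \<mu> \<Longrightarrow> cmod (u n \<gamma>) \<le> C"
    using lim bound by (simp_all add: space_\<mu>)
  show ?thesis
    by (rule trig_closure_tendsto[OF _ _ _ _ L2_bounded_convergence(2)[OF meas f lim' bound']])
      (use L2_bounded_convergence(1)[OF meas f lim' bound'] u in auto)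
qed

lemma trig_closure_polynomial:
  assumes h: "h \<in> H" and p: "real_polynomial_function (p :: complex \<Rightarrow> real)"
  shows "(\<lambda>\<gamma>. of_real (p (\<gamma> h))) \<in> trig_closure"
  using p
proof (induction rule: real_polynomial_function.induct)
  case (linear p)
  then interpret p: bounded_linear p .
  \<comment> \<open>Real and imaginary part of \<open>\<gamma> h\<close> are combinations of \<open>\<gamma> h\<close> and its conjugate \<open>\<gamma> (- h)\<close>.\<close>
  have "(\<lambda>\<gamma>. (p 1 / 2 - \<i> * p \<i> / 2) * char_value h \<gamma> + (p 1 / 2 + \<i> * p \<i> / 2) * char_value (- h) \<gamma>)
      \<in> trig_closure"
    using h by (intro trig_closure_add trig_closure_cmult trig_closure_char_value minus_H)
  then show ?case
  proof (rule L2_closed_span_cong)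
    fix \<gamma> assume "\<gamma> \<in> space \<mu>"
    then have \<gamma>: "\<gamma> \<in> dual_group H"
      by (simp add: space_\<mu>)
    have "\<gamma> h = Re (\<gamma> h) *\<^sub>R 1 + Im (\<gamma> h) *\<^sub>R \<i>"
      by (simp add: complex_eq_iff)
    then have "p (\<gamma> h) = p (Re (\<gamma> h) *\<^sub>R 1 + Im (\<gamma> h) *\<^sub>R \<i>)"
      by (rule arg_cong)
    then have "p (\<gamma> h) = Re (\<gamma> h) * p 1 + Im (\<gamma> h) * p \<i>"
      by (simp only: p.add p.scaleR real_scaleR_def)
    then show "(p 1 / 2 - \<i> * p \<i> / 2) * char_value h \<gamma> + (p 1 / 2 + \<i> * p \<i> / 2) * char_value (- h) \<gamma>
        = of_real (p (\<gamma> h))"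
      by (simp add: char_value_def dual_minus[OF \<gamma> h] complex_eq_iff field_simps)
  qed
next
  case (const c)
  then show ?case
    by (rule trig_closure_const)
next
  case (add p q)
  then show ?case
    using trig_closure_add[OF _ add.IH] by simp
next
  case (mult p q)
  have "compact (p ` sphere 0 1)"
    using mult.hyps(1) by (intro compact_continuous_image compact_sphere continuous_on_polymonial_function)
      (simp add: real_polynomial_function_eq)
  then obtain C where "\<And>z. z \<in> sphere 0 1 \<Longrightarrow> \<bar>p z\<bar> \<le> C"
    using compact_imp_bounded[of "p ` sphere 0 1"] unfolding bounded_iff by (metis imageI real_norm_def)
  then show ?case
    using trig_closure_mult[OF mult.IH(1) _ mult.IH(2), of C] h by (simp add: dual_norm)
qed

text \<open>Only the values of \<open>\<phi>\<close> on the unit circle matter, and there it is a uniform limit of polynomials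
  in the real and imaginary part.\<close>

lemma trig_closure_continuous:
  assumes h: "h \<in> H" and \<phi>: "continuous_on UNIV (\<phi> :: complex \<Rightarrow> real)"
  shows "(\<lambda>\<gamma>. of_real (\<phi> (\<gamma> h))) \<in> trig_closure"
proof -
  have cont: "continuous_on (sphere 0 1) \<phi>"
    using \<phi> by (rule continuous_on_subset) simp
  have "\<exists>p. real_polynomial_function p \<and> (\<forall>z\<in>sphere 0 1. \<bar>\<phi> z - p z\<bar> < inverse (real (Suc n)))" for n
    using Stone_Weierstrass_real_polynomial_function[OF compact_sphere cont, of "inverse (real (Suc n))"]
    by (metis inverse_positive_iff_positive of_nat_0_less_iff zero_less_Suc)
  then obtain p where p: "\<And>n. real_polynomial_function (p n)"
      "\<And>n z. z \<in> sphere 0 1 \<Longrightarrow> \<bar>\<phi> z - p n z\<bar> < inverse (real (Suc n))"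
    by metis
  obtain C where C: "\<And>z. z \<in> sphere 0 1 \<Longrightarrow> \<bar>\<phi> z\<bar> \<le> C"
    using compact_imp_bounded[OF compact_continuous_image[OF cont compact_sphere]]
    unfolding bounded_iff by (metis imageI real_norm_def)
  show ?thesis
  proof (rule trig_closure_bounded_limit[OF trig_closure_polynomial[OF h p(1)]])
    fix \<gamma> assume "\<gamma> \<in> dual_group H"
    then have z: "\<gamma> h \<in> sphere 0 1"
      using h by (simp add: dual_norm)
    have "(\<lambda>n. p n (\<gamma> h)) \<longlonglongrightarrow> \<phi> (\<gamma> h)"
    proof (rule LIM_zero_cancel, rule Lim_null_comparison[OF _ LIMSEQ_inverse_real_of_nat])
      show "\<forall>\<^sub>F n in sequentially. norm (p n (\<gamma> h) - \<phi> (\<gamma> h)) \<le> inverse (real (Suc n))"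
        using p(2)[OF z] by (simp add: abs_minus_commute less_imp_le)
    qed
    then show "(\<lambda>n. complex_of_real (p n (\<gamma> h))) \<longlonglongrightarrow> complex_of_real (\<phi> (\<gamma> h))"
      by (rule tendsto_of_real)
    fix n
    have "inverse (real (Suc n)) \<le> 1"
      by (simp add: field_simps)
    then show "cmod (complex_of_real (p n (\<gamma> h))) \<le> C + 1"
      using p(2)[OF z, of n] C[OF z] by (simp del: of_nat_Suc)
  qed
qed

lemma trig_closure_closed_cylinder:
  assumes h: "h \<in> H" and K: "closed K" "K \<noteq> {}"
  shows "(\<lambda>\<gamma>. of_real (indicator K (\<gamma> h))) \<in> trig_closure"
proof (rule trig_closure_bounded_limit)
  \<comment> \<open>Continuous functions decreasing to the indicator of \<open>K\<close>.\<close>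
  let ?\<phi> = "\<lambda>n z. max 0 (1 - real n * infdist z K)"
  show "(\<lambda>\<gamma>. of_real (?\<phi> n (\<gamma> h))) \<in> trig_closure" for n
    by (rule trig_closure_continuous[OF h]) (intro continuous_intros)
  fix \<gamma> :: "'g \<Rightarrow> complex"
  have "(\<lambda>n. ?\<phi> n (\<gamma> h)) \<longlonglongrightarrow> indicator K (\<gamma> h)"
  proof (cases "\<gamma> h \<in> K")
    case True
    then show ?thesis
      by simp
  next
    case False
    then have d: "0 < infdist (\<gamma> h) K"
      using K in_closed_iff_infdist_zero[OF K] infdist_nonneg[of "\<gamma> h" K] by force
    obtain N where N: "1 / infdist (\<gamma> h) K < real N"
      using reals_Archimedean2 by blast
    have "?\<phi> n (\<gamma> h) = 0" if "n \<ge> N" for n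
    proof -
      have "1 / infdist (\<gamma> h) K < real n"
        using N that by linarith
      then show ?thesis
        using d by (simp add: field_simps max_def)
    qed
    then have "\<forall>\<^sub>F n in sequentially. ?\<phi> n (\<gamma> h) = 0"
      unfolding eventually_sequentially by blast
    then show ?thesis
      using False by (simp add: tendsto_eventually)
  qed
  then show "(\<lambda>n. complex_of_real (?\<phi> n (\<gamma> h))) \<longlonglongrightarrow> of_real (indicator K (\<gamma> h))"
    by (rule tendsto_of_real)
  show "cmod (complex_of_real (?\<phi> n (\<gamma> h))) \<le> 1" for n
    using infdist_nonneg[of "\<gamma> h" K] by (simp add: max_def)
qed

text \<open>The sets with indicator in the closure form a \<open>\<sigma>\<close>-algebra: products of bounded functions give
  intersections, and bounded limits of partial sums give disjoint countable unions.\<close>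

lemma trig_closure_indicator:
  assumes "A \<in> sets \<mu>"
  shows "indicator A \<in> trig_closure"
proof -
  let ?S = "{A. A \<in> sets \<mu> \<and> indicator A \<in> trig_closure}"
  have compl: "dual_group H - A \<in> ?S" if A: "A \<in> ?S" for A
  proof -
    have "(\<lambda>\<gamma>. 1 - indicator A \<gamma>) \<in> trig_closure"
      using A by (intro trig_closure_diff trig_closure_const) auto
    then have "indicator (dual_group H - A) \<in> trig_closure"
      by (rule L2_closed_span_cong) (simp add: space_\<mu> indicator_def)
    then show ?thesis
      using A sets.compl_sets[of A \<mu>] by (simp add: space_\<mu>)
  qed
  have inter: "A \<inter> B \<in> ?S" if A: "A \<in> ?S" and B: "B \<in> ?S" for A B
  proof -
    have "cmod (indicator A \<gamma>) \<le> 1" for \<gamma>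
      by (simp add: indicator_def)
    then have "(\<lambda>\<gamma>. indicator A \<gamma> * indicator B \<gamma>) \<in> trig_closure"
      using A B by (intro trig_closure_mult[of _ 1]) auto
    then have "indicator (A \<inter> B) \<in> trig_closure"
      by (rule L2_closed_span_cong) (simp add: indicator_inter_arith)
    then show ?thesis
      using A B by auto
  qed
  have "algebra (dual_group H) ?S"
    unfolding algebra_iff_Int
  proof (intro conjI ballI)
    show "?S \<subseteq> Pow (dual_group H)"
      using sets.sets_into_space[of _ \<mu>] by (auto simp: space_\<mu>)
    show "{} \<in> ?S"
      using trig_closure_const[of 0] by (simp add: indicator_def[abs_def])
  qed (use compl inter in auto)
  moreover have "(\<Union>i::nat. A i) \<in> ?S" if A: "range A \<subseteq> ?S" "disjoint_family A" for A
  proof -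
    have partial: "(\<Sum>i<n. indicator (A i) \<gamma>) = indicator (\<Union>i<n. A i) \<gamma>" for n and \<gamma> :: "'g \<Rightarrow> complex"
      using disjoint_family_on_mono[OF subset_UNIV A(2)]
      by (simp add: indicator_UN_disjoint)
    have "indicator (\<Union>i. A i) \<in> trig_closure"
    proof (rule trig_closure_bounded_limit)
      show "(\<lambda>\<gamma>. \<Sum>i<n. indicator (A i) \<gamma>) \<in> trig_closure" for n
        using A(1) by (intro trig_closure_sum) auto
      fix \<gamma> :: "'g \<Rightarrow> complex"
      show "(\<lambda>n. \<Sum>i<n. indicator (A i) \<gamma>) \<longlonglongrightarrow> (indicator (\<Union>i. A i) \<gamma> :: complex)"
        unfolding partial by (rule LIMSEQ_indicator_UN)
      show "cmod (\<Sum>i<n. indicator (A i) \<gamma>) \<le> 1" for n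
        unfolding partial by (simp add: indicator_def)
    qed
    then show ?thesis
      using A(1) by auto
  qed
  ultimately have "sigma_algebra (dual_group H) ?S"
    by (simp add: sigma_algebra_disjoint_iff)
  moreover have "{\<gamma> \<in> dual_group H. \<gamma> h \<in> V} \<in> ?S" if h: "h \<in> H" and V: "open V" for h V
  proof (cases "V = UNIV")
    case True
    have "{} \<in> ?S"
      using trig_closure_const[of 0] by (simp add: indicator_def[abs_def])
    from compl[OF this] show ?thesis
      using True by simp
  next
    case False
    let ?A = "{\<gamma> \<in> dual_group H. \<gamma> h \<in> V}"
    have "(\<lambda>\<gamma>. 1 - of_real (indicator (- V) (\<gamma> h))) \<in> trig_closure"
      using h V False
      by (intro trig_closure_diff trig_closure_const trig_closure_closed_cylinder) auto
    then have "indicator ?A \<in> trig_closure"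
      by (rule L2_closed_span_cong) (simp add: space_\<mu> indicator_def)
    then show ?thesis
      using cylinder_in_sets[OF h V] by (simp add: sets_\<mu>)
  qed
  ultimately have "sets \<nu> \<subseteq> ?S"
    by (rule sets_dual_subset)
  then show ?thesis
    using assms by (auto simp: sets_\<mu>)
qed

lemma bounded_in_trig_closure:
  assumes f: "f \<in> borel_measurable \<mu>" and bound: "\<And>\<gamma>. \<gamma> \<in> dual_group H \<Longrightarrow> cmod (f \<gamma>) \<le> C"
  shows "f \<in> trig_closure"
proof -
  obtain F where F: "\<And>i. simple_function \<mu> (F i)" "\<And>\<gamma>. \<gamma> \<in> space \<mu> \<Longrightarrow> (\<lambda>i. F i \<gamma>) \<longlonglongrightarrow> f \<gamma>"
      "\<And>i \<gamma>. \<gamma> \<in> space \<mu> \<Longrightarrow> dist (F i \<gamma>) 0 \<le> 2 * dist (f \<gamma>) 0"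
    using borel_measurable_implies_sequence_metric[OF f, of 0] by blast
  show ?thesis
  proof (rule trig_closure_bounded_limit)
    fix i
    have "(\<lambda>\<gamma>. \<Sum>y\<in>F i ` space \<mu>. y * indicator (F i -` {y} \<inter> space \<mu>) \<gamma>) \<in> trig_closure"
      using simple_functionD(2)[OF F(1)]
      by (intro trig_closure_sum trig_closure_cmult trig_closure_indicator) auto
    then show "F i \<in> trig_closure"
    proof (rule L2_closed_span_cong)
      fix \<gamma> assume \<gamma>: "\<gamma> \<in> space \<mu>"
      have "(\<Sum>y\<in>F i ` space \<mu>. y * indicator (F i -` {y} \<inter> space \<mu>) \<gamma>)
          = (\<Sum>y\<in>F i ` space \<mu>. if y = F i \<gamma> then y else 0)"
        using \<gamma> by (intro sum.cong) (auto simp: indicator_def)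
      then show "(\<Sum>y\<in>F i ` space \<mu>. y * indicator (F i -` {y} \<inter> space \<mu>) \<gamma>) = F i \<gamma>"
        using \<gamma> simple_functionD(1)[OF F(1), of i] by simp
    qed
  next
    fix \<gamma> assume "\<gamma> \<in> dual_group H"
    then have \<gamma>: "\<gamma> \<in> space \<mu>"
      by (simp add: space_\<mu>)
    show "(\<lambda>i. F i \<gamma>) \<longlonglongrightarrow> f \<gamma>"
      by (rule F(2)[OF \<gamma>])
    show "cmod (F i \<gamma>) \<le> 2 * C" for i
      using F(3)[OF \<gamma>, of i] bound[OF \<open>\<gamma> \<in> dual_group H\<close>] by simp
  qed
qed

end

section \<open>Haar measure\<close>

context
  fixes M :: "'g::{topological_ab_group_add, second_countable_topology} measure"
  assumes haar: "haar_measure M"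
begin

lemma sets_haar: "sets M = sets borel"
  using haar by (simp add: haar_measure_def)

lemma space_haar: "space M = UNIV"
  using sets_eq_imp_space_eq[OF sets_haar] by simp

lemma measurable_haar: "borel_measurable M = borel_measurable borel"
  by (rule measurable_cong_sets[OF sets_haar refl])

lemma continuous_haar_measurable:
  fixes f :: "'g \<Rightarrow> complex"
  shows "continuous_on UNIV f \<Longrightarrow> f \<in> borel_measurable M"
  by (simp add: measurable_haar borel_measurable_continuous_onI)

lemma continuous_shift: "continuous_on UNIV (\<lambda>x::'g. x - h)"
  by (intro continuous_intros)

lemma shift_measurable: "(\<lambda>x. x - h) \<in> measurable M M"
proof -
  have "(\<lambda>x::'g. x - h) \<in> measurable borel borel"
    by (rule borel_measurable_continuous_onI[OF continuous_shift])
  then show ?thesis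
    using measurable_cong_sets[OF sets_haar sets_haar] by simp
qed

lemma vimage_shift: "(\<lambda>x. x - h) -` A = (\<lambda>x::'g. h + x) ` A"
  by (auto simp: image_iff algebra_simps intro!: bexI[of _ "_ - h"])

lemma emeasure_translate: "A \<in> sets M \<Longrightarrow> emeasure M ((\<lambda>x. h + x) ` A) = emeasure M A"
  using haar by (simp add: haar_measure_def)

lemma distr_shift: "distr M M (\<lambda>x. x - h) = M"
  by (rule measure_eqI)
    (simp_all add: emeasure_distr[OF shift_measurable] space_haar vimage_shift emeasure_translate)

lemma L2_translate:
  assumes f: "f \<in> L2 M"
  shows "translate h f \<in> L2 M" and "L2_norm M (translate h f) = L2_norm M f"
proof -
  have f_meas: "f \<in> borel_measurable M"
    using f by (rule L2_measurable)
  then have sq: "(\<lambda>x. (cmod (f x))\<^sup>2) \<in> borel_measurable M"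
    by simp
  have "translate h f \<in> borel_measurable M"
    unfolding translate_def by (rule measurable_compose[OF shift_measurable f_meas])
  moreover have "integrable M (\<lambda>x. (cmod (translate h f x))\<^sup>2)"
    using integrable_distr_eq[OF shift_measurable sq, of h] L2_integrable[OF f]
    by (simp add: distr_shift translate_def)
  ultimately show "translate h f \<in> L2 M"
    by (simp add: L2_def)
  show "L2_norm M (translate h f) = L2_norm M f"
    using integral_distr[OF shift_measurable sq, of h] by (simp add: L2_norm_def distr_shift translate_def)
qed

text \<open>Countably many translates of a nonempty open set cover the group, so it cannot be null.\<close>

lemma haar_open_pos:
  assumes "open U" "U \<noteq> {}"
  shows "emeasure M U \<noteq> 0"
proof
  assume null: "emeasure M U = 0"
  obtain u where u: "u \<in> U"
    using assms(2) by blast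
  let ?F = "range (\<lambda>h. (\<lambda>x. h + x) ` U)"
  have "open ((\<lambda>x. h + x) ` U)" for h
    unfolding vimage_shift[symmetric] by (rule open_vimage[OF assms(1) continuous_shift])
  then obtain F' where F': "F' \<subseteq> ?F" "countable F'" "\<Union>F' = \<Union>?F"
    using Lindelof[of ?F] by (metis (no_types, lifting) imageE)
  have "g \<in> \<Union>?F" for g
    using u by (auto intro!: exI[of _ "g - u"] rev_image_eqI)
  then have UNIV: "UNIV = (\<Union>V\<in>F'. V)"
    using F'(3) by auto
  have "V \<in> null_sets M" if V: "V \<in> F'" for V
  proof -
    obtain h where "V = (\<lambda>x. h + x) ` U"
      using V F'(1) by blast
    moreover have "U \<in> sets M"
      using assms(1) by (simp add: sets_haar)
    moreover have "open V"
      using \<open>V = _\<close> \<open>\<And>h. open ((\<lambda>x. h + x) ` U)\<close> by simp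
    ultimately show ?thesis
      using null by (simp add: null_sets_def emeasure_translate sets_haar)
  qed
  then have "(\<Union>V\<in>F'. V) \<in> null_sets M"
    using F'(2) by (intro null_sets_UN') auto
  then have "emeasure M UNIV = 0"
    unfolding UNIV[symmetric] by (simp add: null_sets_def)
  then show False
    using haar by (simp add: haar_measure_def)
qed

lemma continuous_AE_eq:
  fixes x y :: "'g \<Rightarrow> complex"
  assumes x: "continuous_on UNIV x" and y: "continuous_on UNIV y" and "AE g in M. x g = y g"
  shows "x = y"
proof -
  have "open {g. x g \<noteq> y g}"
    by (rule open_Collect_neq[OF x y])
  moreover have "emeasure M {g. x g \<noteq> y g} = 0"
    using assms(3) AE_iff_measurable[of "{g. x g \<noteq> y g}" M "\<lambda>g. x g = y g"] \<open>open {g. x g \<noteq> y g}\<close>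
    by (simp add: space_haar sets_haar)
  ultimately show ?thesis
    using haar_open_pos by fastforce
qed

end

section \<open>The shift-invariant space\<close>

locale shift_invariant_space = lattice_dual H \<nu>
  for H :: "'g::{topological_ab_group_add, second_countable_topology} set" and \<nu> +
  fixes M :: "'g measure" and a :: "'g \<Rightarrow> complex"
  assumes haar: "haar_measure M" and generates: "generates_continuous_shift_space M H a"
begin

definition shift :: "'g \<Rightarrow> 'g \<Rightarrow> complex" where
  "shift h = translate h a"

abbreviation shift_comb :: "('g \<Rightarrow> complex) \<Rightarrow> 'g \<Rightarrow> complex" where
  "shift_comb \<equiv> lincomb shift"

abbreviation CS :: "('g \<Rightarrow> complex) set" where
  "CS \<equiv> continuous_shift_space M H a"

lemma continuous_a: "continuous_on UNIV a"
  using generates by (simp add: generates_continuous_shift_space_def)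

lemma continuous_translate: "continuous_on UNIV f \<Longrightarrow> continuous_on UNIV (translate h (f :: 'g \<Rightarrow> complex))"
  unfolding translate_def
  by (rule continuous_on_compose2[OF _ continuous_shift[OF haar]]) auto

lemma shift_L2: "shift h \<in> L2 M"
  using generates L2_translate(1)[OF haar] by (simp add: generates_continuous_shift_space_def shift_def)

lemma lincomb_shift_L2: "c \<in> fin_coeffs H \<Longrightarrow> shift_comb c \<in> L2 M"
  by (rule lincomb_L2[OF _ shift_L2])

lemma riesz_bounds_shift:
  obtains A B where "0 < A" "0 < B" "riesz_bounds M H shift A B"
  using generates unfolding generates_continuous_shift_space_def riesz_sequence_iff shift_def[abs_def]
  by blast

lemma shift_space_eq: "shift_space M H a = L2_closed_span M H shift"
  by (simp add: shift_space_def shift_def[abs_def])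

lemma CS_iff: "x \<in> CS \<longleftrightarrow> x \<in> L2_closed_span M H shift \<and> continuous_on UNIV x"
  by (simp add: continuous_shift_space_def shift_space_eq)

lemma CS_L2: "x \<in> CS \<Longrightarrow> x \<in> L2 M"
  by (auto simp: CS_iff intro: L2_closed_span_in_L2)

lemma lincomb_shift_CS:
  assumes "c \<in> fin_coeffs H"
  shows "shift_comb c \<in> CS"
proof -
  have "continuous_on UNIV (\<lambda>g. \<Sum>i | c i \<noteq> 0. c i * shift i g)"
    by (intro continuous_on_sum continuous_on_mult continuous_on_const)
      (simp add: shift_def continuous_translate continuous_a)
  then show ?thesis
    using lincomb_in_closed_span[OF assms shift_L2] by (simp add: CS_iff lincomb_def[abs_def])
qed

lemma CS_diff: "x \<in> CS \<Longrightarrow> y \<in> CS \<Longrightarrow> (\<lambda>g. x g - y g) \<in> CS"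
  unfolding CS_iff using L2_closed_span_diff[where I=H and f=shift, OF shift_L2] by (auto intro: continuous_on_diff)

lemma CS_cmult: "x \<in> CS \<Longrightarrow> (\<lambda>g. k * x g) \<in> CS"
  unfolding CS_iff using L2_closed_span_cmult[where I=H and f=shift, OF shift_L2]
  by (auto intro!: continuous_on_mult continuous_on_const)

lemma CS_sum: "(\<And>j. j \<in> X \<Longrightarrow> x j \<in> CS) \<Longrightarrow> (\<lambda>g. \<Sum>j\<in>X. x j g) \<in> CS"
  unfolding CS_iff by (intro conjI L2_closed_span_sum shift_L2 continuous_on_sum) auto

lemma CS_eqI:
  assumes "x \<in> CS" "y \<in> CS" "L2_norm M (\<lambda>g. x g - y g) = 0"
  shows "x = y"
proof -
  have "AE g in M. x g - y g = 0"
    using assms by (intro L2_norm_eq_0_AE L2_diff CS_L2)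
  then have "AE g in M. x g = y g"
    by simp
  then show ?thesis
    using continuous_AE_eq[OF haar] assms(1,2) by (simp add: CS_iff)
qed

lemma CS_translate:
  assumes x: "x \<in> CS" and m: "m \<in> H"
  shows "translate m x \<in> CS"
proof -
  have xs: "x \<in> L2_closed_span M H shift"
    using x by (simp add: CS_iff)
  obtain c where c: "\<And>n. c n \<in> fin_coeffs H" "(\<lambda>n. L2_norm M (\<lambda>g. shift_comb (c n) g - x g)) \<longlonglongrightarrow> 0"
    using L2_closed_span_sequence[OF xs] by blast
  have "translate m x \<in> L2_closed_span M H shift"
  proof (rule L2_closed_span_tendsto[OF shift_L2])
    show "translate m x \<in> L2 M"
      by (rule L2_translate[OF haar CS_L2[OF x]])
    have "translate m (shift_comb (c n)) = (\<lambda>g. \<Sum>i | c n i \<noteq> 0. c n i * shift (m + i) g)" for n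
      by (rule ext) (simp add: translate_def lincomb_def shift_def algebra_simps)
    moreover have "(\<lambda>g. \<Sum>i | c n i \<noteq> 0. c n i * shift (m + i) g) \<in> L2_closed_span M H shift" for n
      using c(1)[of n] m
      by (intro L2_closed_span_sum L2_closed_span_cmult L2_closed_span_generator shift_L2)
        (auto simp: fin_coeffs_def intro: add_H)
    ultimately show "\<forall>\<^sub>F n in sequentially. translate m (shift_comb (c n)) \<in> L2_closed_span M H shift"
      by simp
    have "L2_norm M (\<lambda>g. translate m (shift_comb (c n)) g - translate m x g)
        = L2_norm M (\<lambda>g. shift_comb (c n) g - x g)" for n
      using L2_translate(2)[OF haar L2_diff[OF lincomb_shift_L2[OF c(1)[of n]] CS_L2[OF x]], of m]
      by (simp add: translate_def)
    then show "(\<lambda>n. L2_norm M (\<lambda>g. translate m (shift_comb (c n)) g - translate m x g)) \<longlonglongrightarrow> 0"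
      using c(2) by simp
  qed auto
  then show ?thesis
    using x by (simp add: CS_iff continuous_translate)
qed

text \<open>Square-summability of the generator, uniformly in the base point, turns the lower Riesz
  bound into a bound of the supremum norm by the \<open>L\<^sup>2\<close>-norm. This is the reproducing kernel property,
  first for finite combinations.\<close>

lemma lincomb_shift_sup_bound:
  obtains C where "0 < C" "\<And>c g. c \<in> fin_coeffs H \<Longrightarrow> cmod (shift_comb c g) \<le> C * L2_norm M (shift_comb c)"
proof -
  obtain A B where AB: "0 < A" "0 < B" and rb: "riesz_bounds M H shift A B"
    by (rule riesz_bounds_shift)
  obtain K where K: "(\<Sum>\<^sub>\<infinity>h\<in>H. (cmod (a (g - h)))\<^sup>2) \<le> K" for g
    using generates unfolding generates_continuous_shift_space_def bdd_above_def by blast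
  \<comment> \<open>Adding \<open>1\<close> keeps the constant positive, which later divisions by it require.\<close>
  define C where "C = sqrt ((max K 0 + 1) / A)"
  have "0 < C"
    using AB by (simp add: C_def)
  moreover have "cmod (shift_comb c g) \<le> C * L2_norm M (shift_comb c)" if c: "c \<in> fin_coeffs H" for c g
  proof (rule power2_le_imp_le)
    let ?X = "{i. c i \<noteq> 0}"
    have X: "finite ?X" "?X \<subseteq> H"
      using c by (auto simp: fin_coeffs_def)
    have sq: "(\<Sum>i\<in>?X. (cmod (a (g - i)))\<^sup>2) \<le> max K 0 + 1"
    proof -
      have "(\<Sum>i\<in>?X. (cmod (a (g - i)))\<^sup>2) \<le> (\<Sum>\<^sub>\<infinity>h\<in>H. (cmod (a (g - h)))\<^sup>2)"
        using generates X by (intro finite_sum_le_infsum) (auto simp: generates_continuous_shift_space_def)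
      then show ?thesis
        using K[of g] by simp
    qed
    have "cmod (shift_comb c g) \<le> (\<Sum>i\<in>?X. cmod (c i) * cmod (a (g - i)))"
      unfolding lincomb_def shift_def translate_def
      by (rule order_trans[OF norm_sum]) (simp add: norm_mult)
    then have "(cmod (shift_comb c g))\<^sup>2 \<le> (\<Sum>i\<in>?X. cmod (c i) * cmod (a (g - i)))\<^sup>2"
      by (rule power_mono) simp
    also have "\<dots> \<le> (\<Sum>i\<in>?X. (cmod (c i))\<^sup>2) * (\<Sum>i\<in>?X. (cmod (a (g - i)))\<^sup>2)"
      by (rule Cauchy_Schwarz_ineq_sum)
    also have "\<dots> \<le> coeff_norm2 c * (max K 0 + 1)"
      unfolding coeff_norm2_def by (intro mult_left_mono sq sum_nonneg) auto
    also have "\<dots> \<le> ((L2_norm M (shift_comb c))\<^sup>2 / A) * (max K 0 + 1)"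
      using riesz_boundsD(2)[OF rb c] AB by (intro mult_right_mono) (auto simp: field_simps)
    also have "\<dots> = (C * L2_norm M (shift_comb c))\<^sup>2"
      using AB by (simp add: C_def power_mult_distrib)
    finally show "(cmod (shift_comb c g))\<^sup>2 \<le> (C * L2_norm M (shift_comb c))\<^sup>2" .
  qed (use \<open>0 < C\<close> in simp)
  ultimately show ?thesis
    by (rule that)
qed

text \<open>Consequently \<open>L\<^sup>2\<close>-Cauchy sequences of finite combinations converge uniformly, and the
  continuous elements are complete.\<close>

lemma CS_complete:
  assumes c: "\<And>n. c n \<in> fin_coeffs H"
    and Cauchy: "\<And>e. 0 < e \<Longrightarrow> \<exists>N. \<forall>m\<ge>N. \<forall>n\<ge>N.
      L2_norm M (\<lambda>g. shift_comb (c m) g - shift_comb (c n) g) < e"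
  obtains x where "x \<in> CS" "uniform_limit UNIV (\<lambda>n. shift_comb (c n)) x sequentially"
    "(\<lambda>n. L2_norm M (\<lambda>g. shift_comb (c n) g - x g)) \<longlonglongrightarrow> 0"
proof -
  obtain C where C: "0 < C" "\<And>c g. c \<in> fin_coeffs H \<Longrightarrow> cmod (shift_comb c g) \<le> C * L2_norm M (shift_comb c)"
    by (rule lincomb_shift_sup_bound) blast
  have "uniformly_Cauchy_on UNIV (\<lambda>n. shift_comb (c n))"
  proof (rule uniformly_Cauchy_onI)
    fix e :: real assume "0 < e"
    then obtain N where N: "\<forall>m\<ge>N. \<forall>n\<ge>N. L2_norm M (\<lambda>g. shift_comb (c m) g - shift_comb (c n) g) < e / C"
      using Cauchy[of "e / C"] C(1) by auto
    have "dist (shift_comb (c m) g) (shift_comb (c n) g) < e" if mn: "m \<ge> N" "n \<ge> N" for m n g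
    proof -
      have "cmod (shift_comb (c m) g - shift_comb (c n) g)
          \<le> C * L2_norm M (\<lambda>g. shift_comb (c m) g - shift_comb (c n) g)"
        using C(2)[OF fin_coeffs_diff(1)[OF c[of m] c[of n]], of g]
        by (simp add: fin_coeffs_diff(2)[OF c c])
      also have "\<dots> < C * (e / C)"
        using N mn C(1) by (intro mult_strict_left_mono) auto
      finally show ?thesis
        using C(1) by (simp add: dist_norm)
    qed
    then show "\<exists>N. \<forall>g\<in>UNIV. \<forall>m\<ge>N. \<forall>n\<ge>N. dist (shift_comb (c m) g) (shift_comb (c n) g) < e"
      by blast
  qed
  then obtain x where x: "uniform_limit UNIV (\<lambda>n. shift_comb (c n)) x sequentially"
    using Cauchy_uniformly_convergent by (metis uniformly_convergent_on_def)
  have cont: "continuous_on UNIV x"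
    by (rule uniform_limit_theorem[OF _ x])
      (use lincomb_shift_CS[OF c] in \<open>auto simp: CS_iff\<close>)
  have "AE g in M. (\<lambda>n. shift_comb (c n) g) \<longlonglongrightarrow> x g"
    using tendsto_uniform_limitI[OF x] by simp
  note lim = L2_Cauchy_limit[OF lincomb_shift_L2[OF c] continuous_haar_measurable[OF haar cont] this Cauchy]
  have "x \<in> L2_closed_span M H shift"
    by (rule L2_closed_span_tendsto[OF shift_L2 lim(1) _ _ lim(2)])
      (use lincomb_in_closed_span[OF c shift_L2] in auto)
  then show ?thesis
    using that x lim(2) cont by (simp add: CS_iff)
qed

text \<open>The approximating combinations are Cauchy and hence converge uniformly to some continuous element;
  it agrees with \<open>x\<close> almost everywhere, hence everywhere.\<close>

lemma CS_approximation:
  assumes x: "x \<in> CS"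
  obtains c where "\<And>n. c n \<in> fin_coeffs H"
    "uniform_limit UNIV (\<lambda>n. shift_comb (c n)) x sequentially"
    "(\<lambda>n. L2_norm M (\<lambda>g. shift_comb (c n) g - x g)) \<longlonglongrightarrow> 0"
proof -
  have xs: "x \<in> L2_closed_span M H shift"
    using x by (simp add: CS_iff)
  obtain c where c: "\<And>n. c n \<in> fin_coeffs H" "(\<lambda>n. L2_norm M (\<lambda>g. shift_comb (c n) g - x g)) \<longlonglongrightarrow> 0"
    using L2_closed_span_sequence[OF xs] by blast
  have "\<exists>N. \<forall>m\<ge>N. \<forall>n\<ge>N. L2_norm M (\<lambda>g. shift_comb (c m) g - shift_comb (c n) g) < e" if "0 < e" for e
    by (rule L2_convergent_Cauchy[OF lincomb_shift_L2[OF c(1)] CS_L2[OF x] c(2) that])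
  then obtain y where y: "y \<in> CS" "uniform_limit UNIV (\<lambda>n. shift_comb (c n)) y sequentially"
      "(\<lambda>n. L2_norm M (\<lambda>g. shift_comb (c n) g - y g)) \<longlonglongrightarrow> 0"
    by (rule CS_complete[OF c(1)])
  have "(\<lambda>n. L2_norm M (\<lambda>g. shift_comb (c n) g - x g) + L2_norm M (\<lambda>g. shift_comb (c n) g - y g)) \<longlonglongrightarrow> 0 + 0"
    by (intro tendsto_add c(2) y(3))
  moreover have "L2_norm M (\<lambda>g. x g - y g)
      \<le> L2_norm M (\<lambda>g. shift_comb (c n) g - x g) + L2_norm M (\<lambda>g. shift_comb (c n) g - y g)" for n
    using L2_norm_triangle_diff[OF CS_L2[OF x] lincomb_shift_L2[OF c(1)[of n]] CS_L2[OF y(1)]]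
    by (simp add: L2_norm_minus_commute[of M x])
  ultimately have "L2_norm M (\<lambda>g. x g - y g) \<le> 0 + 0"
    by (intro LIMSEQ_le_const) auto
  then have "x = y"
    using CS_eqI[OF x y(1)] L2_norm_nonneg[of M "\<lambda>g. x g - y g"] by linarith
  then show ?thesis
    using that c y(2) by blast
qed

lemma CS_sup_bound:
  obtains C where "0 < C" "\<And>x g. x \<in> CS \<Longrightarrow> cmod (x g) \<le> C * L2_norm M x"
proof -
  obtain C where C: "0 < C" "\<And>c g. c \<in> fin_coeffs H \<Longrightarrow> cmod (shift_comb c g) \<le> C * L2_norm M (shift_comb c)"
    by (rule lincomb_shift_sup_bound) blast
  have "cmod (x g) \<le> C * L2_norm M x" if x: "x \<in> CS" for x g
  proof -
    obtain c where c: "\<And>n. c n \<in> fin_coeffs H"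
      "uniform_limit UNIV (\<lambda>n. shift_comb (c n)) x sequentially"
      "(\<lambda>n. L2_norm M (\<lambda>g. shift_comb (c n) g - x g)) \<longlonglongrightarrow> 0"
      using CS_approximation[OF x] by blast
    show ?thesis
    proof (rule LIMSEQ_le)
      show "(\<lambda>n. cmod (shift_comb (c n) g)) \<longlonglongrightarrow> cmod (x g)"
        by (intro tendsto_norm tendsto_uniform_limitI[OF c(2)]) simp
      show "(\<lambda>n. C * L2_norm M (shift_comb (c n))) \<longlonglongrightarrow> C * L2_norm M x"
        by (intro tendsto_mult tendsto_const L2_norm_tendsto lincomb_shift_L2 c CS_L2 x)
      show "\<exists>N. \<forall>n\<ge>N. cmod (shift_comb (c n) g) \<le> C * L2_norm M (shift_comb (c n))"
        using C(2)[OF c(1)] by blast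
    qed
  qed
  with C(1) show ?thesis
    by (rule that)
qed

text \<open>Any \<open>L\<^sup>2\<close>-convergent sum of continuous elements therefore converges uniformly and, being
  unconditionally convergent at every point, absolutely.\<close>

lemma has_L2_sum_CS_uniform:
  assumes f: "\<And>m. m \<in> H \<Longrightarrow> f m \<in> CS" and x: "x \<in> CS" and sum: "has_L2_sum M H f x"
  shows "uniform_limit UNIV (\<lambda>X g. \<Sum>m\<in>X. f m g) x (finite_subsets_at_top H)"
    and "(\<lambda>m. cmod (f m g)) summable_on H"
proof -
  obtain C where C: "0 < C" "\<And>x g. x \<in> CS \<Longrightarrow> cmod (x g) \<le> C * L2_norm M x"
    by (rule CS_sup_bound) blast
  show unif: "uniform_limit UNIV (\<lambda>X g. \<Sum>m\<in>X. f m g) x (finite_subsets_at_top H)"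
  proof (rule uniform_limitI)
    fix e :: real assume "0 < e"
    then have "\<forall>\<^sub>F X in finite_subsets_at_top H. L2_norm M (\<lambda>g. (\<Sum>m\<in>X. f m g) - x g) < e / C"
      using C(1) by (intro order_tendstoD(2)[OF has_L2_sumD(3)[OF sum]]) simp
    then show "\<forall>\<^sub>F X in finite_subsets_at_top H. \<forall>g\<in>UNIV. dist (\<Sum>m\<in>X. f m g) (x g) < e"
      using eventually_finite_subset[of H]
    proof eventually_elim
      case (elim X)
      then have "(\<lambda>g. (\<Sum>m\<in>X. f m g) - x g) \<in> CS"
        using f by (intro CS_diff CS_sum x) auto
      from C(2)[OF this] show ?case
        using elim(1) C(1) by (auto simp: dist_norm field_simps intro: le_less_trans)
    qed
  qed
  have "((\<lambda>m. f m g) has_sum x g) H"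
    unfolding has_sum_def using tendsto_uniform_limitI[OF unif, of g] by simp
  then have "(\<lambda>m. f m g) summable_on H"
    by (auto simp: summable_on_def)
  then show "(\<lambda>m. cmod (f m g)) summable_on H"
    by (simp add: summable_on_iff_abs_summable_on_complex)
qed

end

section \<open>Samples and the symbol\<close>

lemma L2_norm_count_space_cong:
  assumes "\<And>i. i \<in> I \<Longrightarrow> c i = d i"
  shows "L2_norm (count_space I) c = L2_norm (count_space I) d"
  unfolding L2_norm_def using assms
  by (intro arg_cong[where f=sqrt] Bochner_Integration.integral_cong) auto

lemma L2_norm_count_space_fin_coeffs:
  assumes "c \<in> fin_coeffs I"
  shows "(L2_norm (count_space I) c)\<^sup>2 = coeff_norm2 c"
proof -
  have eq: "{i \<in> I. (cmod (c i))\<^sup>2 \<noteq> 0} = {i. c i \<noteq> 0}"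
    using assms by (auto simp: fin_coeffs_def)
  then show ?thesis
    using lebesgue_integral_count_space_finite_support[of I "\<lambda>i. (cmod (c i))\<^sup>2"] fin_coeffs_finite[OF assms]
    by (simp only: L2_norm_square coeff_norm2_def)
qed

lemma L2_count_space_summable:
  assumes "d \<in> L2 (count_space I)"
  shows "(\<lambda>i. (cmod (d i))\<^sup>2) summable_on I"
  using sum_le_L2_norm_count_space[OF assms]
  by (intro nonneg_bdd_above_summable_on bdd_aboveI) auto

lemma has_L2_sum_unique:
  assumes "has_L2_sum M I f u" "has_L2_sum M I f v"
  shows "L2_norm M (\<lambda>x. u x - v x) = 0"
proof -
  have "has_L2_sum M I (\<lambda>i x. 0) (\<lambda>x. u x - v x)"
    using has_L2_sum_diff[OF assms] by simp
  from has_L2_sumD(3)[OF this] show ?thesis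
    by (simp add: L2_norm_minus_commute[of M u v] tendsto_const_iff)
qed

lemma has_L2_sum_cong_space:
  assumes "has_L2_sum M I f u" "\<And>i x. i \<in> I \<Longrightarrow> x \<in> space M \<Longrightarrow> f i x = g i x"
  shows "has_L2_sum M I g u"
proof -
  note f = has_L2_sumD[OF assms(1)]
  have g: "g i \<in> L2 M" if i: "i \<in> I" for i
  proof (rule L2_cong_AE[OF f(2)[OF i]])
    show "g i \<in> borel_measurable M"
      using L2_measurable[OF f(2)[OF i]] measurable_cong[of M "f i" "g i"] assms(2)[OF i] by blast
  qed (use assms(2)[OF i] in auto)
  have "\<forall>\<^sub>F X in finite_subsets_at_top I.
      L2_norm M (\<lambda>x. (\<Sum>i\<in>X. f i x) - u x) = L2_norm M (\<lambda>x. (\<Sum>i\<in>X. g i x) - u x)"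
    using eventually_finite_subset
  proof eventually_elim
    case (elim X)
    have "(\<Sum>i\<in>X. f i x) = (\<Sum>i\<in>X. g i x)" if "x \<in> space M" for x
      using elim that assms(2) by (intro sum.cong) auto
    then show ?case
      unfolding L2_norm_def
      by (intro arg_cong[where f=sqrt] Bochner_Integration.integral_cong) auto
  qed
  from tendsto_cong[OF this] show ?thesis
    using f g by (simp add: has_L2_sum_def)
qed

context shift_invariant_space
begin

context
  fixes g\<^sub>0 :: 'g
begin

abbreviation symbol :: "('g \<Rightarrow> complex) \<Rightarrow> complex" where
  "symbol \<equiv> sampling_symbol \<nu> H a g\<^sub>0"

abbreviation samples :: "('g \<Rightarrow> complex) \<Rightarrow> 'g \<Rightarrow> complex" where
  "samples x \<equiv> (\<lambda>m. x (g\<^sub>0 + m))"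

lemma generator_samples_summable: "(\<lambda>h. (cmod (a (g\<^sub>0 + h)))\<^sup>2) summable_on H"
proof -
  have "(\<lambda>h. (cmod (a (g\<^sub>0 - h)))\<^sup>2) summable_on H"
    using generates by (simp add: generates_continuous_shift_space_def)
  moreover have "bij_betw uminus H H"
    by (rule bij_betw_byWitness[where f'=uminus]) (auto intro: minus_H)
  ultimately show ?thesis
    using summable_on_reindex_bij_betw[of uminus H H "\<lambda>h. (cmod (a (g\<^sub>0 + h)))\<^sup>2"] by simp
qed

lemma symbol_sum: "has_L2_sum \<nu> H (\<lambda>h \<gamma>. a (g\<^sub>0 + h) * \<gamma> h) symbol"
  unfolding sampling_symbol_def
  using someI_ex[OF summable_square_has_L2_sum[OF finite_measure_dual riesz_bounds_characters _
    generator_samples_summable]]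
  by (simp add: char_value_def)

lemma symbol_L2: "symbol \<in> L2 \<nu>"
  using symbol_sum by (rule has_L2_sumD(1))

text \<open>Multiplying the symbol by a trigonometric polynomial convolves its Fourier coefficients
  \<open>a (g\<^sub>0 + h)\<close> with the coefficients of the polynomial, and this convolution computes the
  samples of the corresponding combination of translates.\<close>

lemma samples_symbol_product:
  assumes c: "c \<in> fin_coeffs H"
  shows "has_L2_sum \<nu> H (\<lambda>m \<gamma>. shift_comb c (g\<^sub>0 + m) * char_value m \<gamma>)
    (\<lambda>\<gamma>. trig_poly c \<gamma> * symbol \<gamma>)"
proof -
  let ?X = "{i. c i \<noteq> 0}"
  have shifted: "has_L2_sum \<nu> H (\<lambda>m \<gamma>. c h * (a (g\<^sub>0 + (m - h)) * char_value m \<gamma>))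
      (\<lambda>\<gamma>. c h * (char_value h \<gamma> * symbol \<gamma>))" if h: "h \<in> H" for h
  proof (rule has_L2_sum_cmult)
    have "has_L2_sum \<nu> H (\<lambda>i \<gamma>. char_value h \<gamma> * (a (g\<^sub>0 + i) * \<gamma> i)) (\<lambda>\<gamma>. char_value h \<gamma> * symbol \<gamma>)"
      by (rule has_L2_sum_mult_bounded[OF symbol_sum char_value_measurable[OF h], of 1])
        (use h in \<open>auto simp: space_dual char_value_def dual_norm\<close>)
    moreover have "bij_betw (\<lambda>m. m - h) H H"
      by (rule bij_betw_byWitness[where f'="\<lambda>m. m + h"]) (use h in \<open>auto intro: add_H diff_H\<close>)
    ultimately have "has_L2_sum \<nu> H (\<lambda>m \<gamma>. char_value h \<gamma> * (a (g\<^sub>0 + (m - h)) * \<gamma> (m - h)))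
        (\<lambda>\<gamma>. char_value h \<gamma> * symbol \<gamma>)"
      by (rule has_L2_sum_reindex)
    then show "has_L2_sum \<nu> H (\<lambda>m \<gamma>. a (g\<^sub>0 + (m - h)) * char_value m \<gamma>) (\<lambda>\<gamma>. char_value h \<gamma> * symbol \<gamma>)"
    proof (rule has_L2_sum_cong_space)
      fix m \<gamma> assume m: "m \<in> H" and "\<gamma> \<in> space \<nu>"
      then have \<gamma>: "\<gamma> \<in> dual_group H"
        by (simp add: space_dual)
      have "\<gamma> m = \<gamma> h * \<gamma> (m - h)"
        using dual_add[OF \<gamma> h diff_H[OF m h]] by simp
      then show "char_value h \<gamma> * (a (g\<^sub>0 + (m - h)) * \<gamma> (m - h)) = a (g\<^sub>0 + (m - h)) * char_value m \<gamma>"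
        by (simp add: char_value_def)
    qed
  qed
  have "has_L2_sum \<nu> H (\<lambda>m \<gamma>. \<Sum>h\<in>?X. c h * (a (g\<^sub>0 + (m - h)) * char_value m \<gamma>))
      (\<lambda>\<gamma>. \<Sum>h\<in>?X. c h * (char_value h \<gamma> * symbol \<gamma>))"
    by (rule has_L2_sum_sum) (use c shifted in \<open>auto simp: fin_coeffs_def\<close>)
  then show ?thesis
    by (simp add: lincomb_def shift_def translate_def sum_distrib_right mult.assoc add_diff_eq)
qed

lemma samples_isometry:
  assumes c: "c \<in> fin_coeffs H"
  shows "samples (shift_comb c) \<in> L2 (count_space H)"
    and "L2_norm (count_space H) (samples (shift_comb c))
      = L2_norm \<nu> (\<lambda>\<gamma>. trig_poly c \<gamma> * symbol \<gamma>)"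
proof -
  note coeffs = riesz_bounds_has_L2_sum[OF riesz_bounds_characters zero_less_one zero_less_one
    samples_symbol_product[OF c]]
  show "samples (shift_comb c) \<in> L2 (count_space H)"
    by (rule coeffs(1))
  have "(L2_norm (count_space H) (samples (shift_comb c)))\<^sup>2
      = (L2_norm \<nu> (\<lambda>\<gamma>. trig_poly c \<gamma> * symbol \<gamma>))\<^sup>2"
    using coeffs(2,3) by linarith
  then show "L2_norm (count_space H) (samples (shift_comb c))
      = L2_norm \<nu> (\<lambda>\<gamma>. trig_poly c \<gamma> * symbol \<gamma>)"
    by (rule power2_eq_imp_eq) simp_all
qed

lemma product_L2: "c \<in> fin_coeffs H \<Longrightarrow> (\<lambda>\<gamma>. trig_poly c \<gamma> * symbol \<gamma>) \<in> L2 \<nu>"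
  using samples_symbol_product by (rule has_L2_sumD(1))

section \<open>From a bounded and invertible symbol to a sampling function\<close>

context
  fixes k1 k2 :: real
  assumes k: "0 < k1" "0 < k2"
    and symbol_bounds: "AE \<gamma> in \<nu>. k1 \<le> cmod (symbol \<gamma>) \<and> cmod (symbol \<gamma>) \<le> k2"
begin

text \<open>The norms of \<open>p\<close> and \<open>P\<close> are equivalent by the Riesz bounds of the translates, those of \<open>P\<close> and
  \<open>P G\<close> by the bounds of the symbol, and the norm of \<open>P G\<close> is that of the samples of \<open>p\<close>.\<close>

lemma samples_frame_lincomb:
  obtains \<alpha> \<beta> where "0 < \<alpha>" "0 < \<beta>"
    "\<And>c. c \<in> fin_coeffs H \<Longrightarrow> \<alpha> * L2_norm M (shift_comb c)
      \<le> L2_norm (count_space H) (samples (shift_comb c))"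
    "\<And>c. c \<in> fin_coeffs H \<Longrightarrow> L2_norm (count_space H) (samples (shift_comb c))
      \<le> \<beta> * L2_norm M (shift_comb c)"
proof -
  obtain A B where AB: "0 < A" "0 < B" and rb: "riesz_bounds M H shift A B"
    by (rule riesz_bounds_shift)
  show ?thesis
  proof (rule that[of "k1 / sqrt B" "k2 / sqrt A"])
    fix c assume c: "c \<in> fin_coeffs H"
    let ?P = "L2_norm \<nu> (trig_poly c)" and ?p = "L2_norm M (shift_comb c)"
    let ?PG = "L2_norm \<nu> (\<lambda>\<gamma>. trig_poly c \<gamma> * symbol \<gamma>)"
    have P: "trig_poly c \<in> L2 \<nu>"
      by (rule lincomb_L2[OF c char_value_L2])
    have "?p\<^sup>2 \<le> (sqrt B * ?P)\<^sup>2" "(sqrt A * ?P)\<^sup>2 \<le> ?p\<^sup>2"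
      using riesz_boundsD(2,3)[OF rb c] AB
      by (simp_all add: power_mult_distrib L2_norm_trig_polynomial[OF c])
    then have *: "?p \<le> sqrt B * ?P" "sqrt A * ?P \<le> ?p"
      using AB by (auto elim!: power2_le_imp_le)
    have "?P \<le> (1 / k1) * ?PG"
    proof (rule L2_norm_mono_AE[OF product_L2[OF c] P])
      show "AE \<gamma> in \<nu>. cmod (trig_poly c \<gamma>) \<le> 1 / k1 * cmod (trig_poly c \<gamma> * symbol \<gamma>)"
        using symbol_bounds
      proof eventually_elim
        case (elim \<gamma>)
        then have "k1 * cmod (trig_poly c \<gamma>) \<le> cmod (symbol \<gamma>) * cmod (trig_poly c \<gamma>)"
          by (intro mult_right_mono) auto
        then show ?case
          using k by (simp add: norm_mult field_simps)
      qed
    qed (use k in simp)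
    then have "k1 * ?P \<le> ?PG"
      using k by (simp add: field_simps)
    moreover have "k1 / sqrt B * ?p \<le> k1 * ?P"
      using *(1) k AB by (simp add: field_simps)
    ultimately show "k1 / sqrt B * ?p \<le> L2_norm (count_space H) (samples (shift_comb c))"
      by (simp add: samples_isometry[OF c])
    have "?PG \<le> k2 * ?P"
    proof (rule L2_norm_mono_AE[OF P product_L2[OF c]])
      show "AE \<gamma> in \<nu>. cmod (trig_poly c \<gamma> * symbol \<gamma>) \<le> k2 * cmod (trig_poly c \<gamma>)"
        using symbol_bounds
      proof eventually_elim
        case (elim \<gamma>)
        then show ?case
          by (simp add: norm_mult mult.commute[of k2] mult_left_mono)
      qed
    qed (use k in simp)
    also have "\<dots> \<le> k2 / sqrt A * ?p"
      using *(2) k AB by (simp add: field_simps)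
    finally show "L2_norm (count_space H) (samples (shift_comb c)) \<le> k2 / sqrt A * ?p"
      by (simp add: samples_isometry[OF c])
  qed (use k AB in auto)
qed

text \<open>The inequalities extend to limits: the samples of approximating combinations are Cauchy by the
  upper bound, and uniform convergence identifies their limit as the samples of \<open>x\<close>.\<close>

lemma samples_frame:
  obtains \<alpha> \<beta> where "0 < \<alpha>" "0 < \<beta>"
    "\<And>x. x \<in> CS \<Longrightarrow> samples x \<in> L2 (count_space H)"
    "\<And>x. x \<in> CS \<Longrightarrow> \<alpha> * L2_norm M x \<le> L2_norm (count_space H) (samples x)"
    "\<And>x. x \<in> CS \<Longrightarrow> L2_norm (count_space H) (samples x) \<le> \<beta> * L2_norm M x"
proof -
  obtain \<alpha> \<beta> where \<alpha>\<beta>: "0 < \<alpha>" "0 < \<beta>"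
    and lower: "\<And>c. c \<in> fin_coeffs H \<Longrightarrow> \<alpha> * L2_norm M (shift_comb c)
      \<le> L2_norm (count_space H) (samples (shift_comb c))"
    and upper: "\<And>c. c \<in> fin_coeffs H \<Longrightarrow> L2_norm (count_space H) (samples (shift_comb c))
      \<le> \<beta> * L2_norm M (shift_comb c)"
    by (rule samples_frame_lincomb) blast
  have "samples x \<in> L2 (count_space H) \<and>
      \<alpha> * L2_norm M x \<le> L2_norm (count_space H) (samples x) \<and>
      L2_norm (count_space H) (samples x) \<le> \<beta> * L2_norm M x" if x: "x \<in> CS" for x
  proof -
    obtain c where c: "\<And>n. c n \<in> fin_coeffs H"
        "uniform_limit UNIV (\<lambda>n. shift_comb (c n)) x sequentially"
        "(\<lambda>n. L2_norm M (\<lambda>g. shift_comb (c n) g - x g)) \<longlonglongrightarrow> 0"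
      by (rule CS_approximation[OF x]) blast
    have Cauchy: "\<exists>N. \<forall>m\<ge>N. \<forall>n\<ge>N. L2_norm (count_space H)
        (\<lambda>i. shift_comb (c m) (g\<^sub>0 + i) - shift_comb (c n) (g\<^sub>0 + i)) < e" if e: "0 < e" for e
    proof -
      obtain N where N: "\<forall>m\<ge>N. \<forall>n\<ge>N. L2_norm M (\<lambda>g. shift_comb (c m) g - shift_comb (c n) g) < e / \<beta>"
        using L2_convergent_Cauchy[OF lincomb_shift_L2[OF c(1)] CS_L2[OF x] c(3), of "e / \<beta>"] e \<alpha>\<beta> by auto
      have "L2_norm (count_space H) (\<lambda>i. shift_comb (c m) (g\<^sub>0 + i) - shift_comb (c n) (g\<^sub>0 + i)) < e"
        if mn: "m \<ge> N" "n \<ge> N" for m n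
      proof -
        have "L2_norm (count_space H) (\<lambda>i. shift_comb (c m) (g\<^sub>0 + i) - shift_comb (c n) (g\<^sub>0 + i))
            \<le> \<beta> * L2_norm M (\<lambda>g. shift_comb (c m) g - shift_comb (c n) g)"
          using upper[OF fin_coeffs_diff(1)[OF c(1)[of m] c(1)[of n]]]
          by (simp add: fin_coeffs_diff(2)[OF c(1) c(1)])
        also have "\<dots> < \<beta> * (e / \<beta>)"
          using N mn \<alpha>\<beta> by (intro mult_strict_left_mono) auto
        finally show ?thesis
          using \<alpha>\<beta> by simp
      qed
      then show ?thesis
        by blast
    qed
    have "AE i in count_space H. (\<lambda>n. shift_comb (c n) (g\<^sub>0 + i)) \<longlonglongrightarrow> x (g\<^sub>0 + i)"
      using tendsto_uniform_limitI[OF c(2)] by simp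
    note lim = L2_Cauchy_limit[OF samples_isometry(1)[OF c(1)] _ this Cauchy, simplified]
    have N: "(\<lambda>n. L2_norm (count_space H) (\<lambda>m. shift_comb (c n) (g\<^sub>0 + m)))
        \<longlonglongrightarrow> L2_norm (count_space H) (samples x)"
      by (intro L2_norm_tendsto samples_isometry(1) c(1) lim)
    have L: "(\<lambda>n. L2_norm M (shift_comb (c n))) \<longlonglongrightarrow> L2_norm M x"
      by (intro L2_norm_tendsto lincomb_shift_L2 c CS_L2 x)
    have "\<alpha> * L2_norm M x \<le> L2_norm (count_space H) (samples x)"
      by (rule LIMSEQ_le[OF tendsto_mult_left[OF L] N]) (use lower[OF c(1)] in blast)
    moreover have "L2_norm (count_space H) (samples x) \<le> \<beta> * L2_norm M x"
      by (rule LIMSEQ_le[OF N tendsto_mult_left[OF L]]) (use upper[OF c(1)] in blast)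
    ultimately show ?thesis
      using lim(1) by blast
  qed
  with \<alpha>\<beta> that show ?thesis
    by blast
qed

text \<open>Trigonometric polynomials \<open>P\<^sub>n\<close> approximating the reciprocal of the symbol give combinations of
  translates whose samples converge to the Fourier coefficients of the constant function \<open>1\<close>.\<close>

lemma interpolating_function_exists:
  obtains S where "S \<in> CS" "\<And>m. m \<in> H \<Longrightarrow> S (g\<^sub>0 + m) = (if m = 0 then 1 else 0)"
proof -
  interpret lattice_dual_measure H \<nu> \<nu>
    by (intro lattice_dual_measure.intro lattice_dual_axioms finite_measure_dual lattice_dual_measure_axioms.intro refl)
  obtain A B where AB: "0 < A" "0 < B" and rb: "riesz_bounds M H shift A B"
    by (rule riesz_bounds_shift)
  have symbol_meas: "symbol \<in> borel_measurable \<nu>"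
    using symbol_L2 by (rule L2_measurable)
  define R where "R \<gamma> = (if k1 \<le> cmod (symbol \<gamma>) then inverse (symbol \<gamma>) else 0)" for \<gamma>
  have R_meas: "R \<in> borel_measurable \<nu>"
    unfolding R_def using symbol_meas by measurable
  have R_bound: "cmod (R \<gamma>) \<le> inverse k1" for \<gamma>
    using k by (auto simp: R_def norm_inverse intro: le_imp_inverse_le)
  have R: "R \<in> trig_closure"
    by (rule bounded_in_trig_closure[OF R_meas R_bound])
  then have R_L2: "R \<in> L2 \<nu>"
    by (rule L2_closed_span_in_L2)
  obtain c where c: "\<And>n. c n \<in> fin_coeffs H"
      "(\<lambda>n. L2_norm \<nu> (\<lambda>\<gamma>. trig_poly (c n) \<gamma> - R \<gamma>)) \<longlonglongrightarrow> 0"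
    using L2_closed_span_sequence[OF R] by blast
  let ?P = "\<lambda>n. trig_poly (c n)" and ?p = "\<lambda>n. shift_comb (c n)"
  have P: "?P n \<in> L2 \<nu>" for n
    by (rule lincomb_L2[OF c(1) char_value_L2])
  have "\<exists>N. \<forall>m\<ge>N. \<forall>n\<ge>N. L2_norm M (\<lambda>g. ?p m g - ?p n g) < e" if e: "0 < e" for e
  proof -
    obtain N where N: "\<forall>m\<ge>N. \<forall>n\<ge>N. L2_norm \<nu> (\<lambda>\<gamma>. ?P m \<gamma> - ?P n \<gamma>) < e / sqrt B"
      using L2_convergent_Cauchy[OF P R_L2 c(2), of "e / sqrt B"] e AB by auto
    have "L2_norm M (\<lambda>g. ?p m g - ?p n g) < e" if mn: "m \<ge> N" "n \<ge> N" for m n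
    proof -
      have cd: "(\<lambda>i. c m i - c n i) \<in> fin_coeffs H"
        by (rule fin_coeffs_diff(1)[OF c(1) c(1)])
      have "(L2_norm M (\<lambda>g. ?p m g - ?p n g))\<^sup>2 \<le> (sqrt B * L2_norm \<nu> (\<lambda>\<gamma>. ?P m \<gamma> - ?P n \<gamma>))\<^sup>2"
        using riesz_boundsD(3)[OF rb cd] L2_norm_trig_polynomial[OF cd] AB
        by (simp add: fin_coeffs_diff(2)[OF c(1) c(1)] power_mult_distrib)
      then have "L2_norm M (\<lambda>g. ?p m g - ?p n g) \<le> sqrt B * L2_norm \<nu> (\<lambda>\<gamma>. ?P m \<gamma> - ?P n \<gamma>)"
        by (rule power2_le_imp_le) (use AB in simp)
      also have "\<dots> < sqrt B * (e / sqrt B)"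
        using N mn AB by (intro mult_strict_left_mono) auto
      also have "\<dots> = e"
        using AB by simp
      finally show ?thesis .
    qed
    then show ?thesis
      by blast
  qed
  then obtain S where S: "S \<in> CS" "uniform_limit UNIV ?p S sequentially"
    by (rule CS_complete[OF c(1)]) blast
  let ?\<delta> = "\<lambda>m::'g. if m = 0 then 1 else (0::complex)"
  have "S (g\<^sub>0 + m) = ?\<delta> m" if m: "m \<in> H" for m
  proof -
    have one: "has_L2_sum \<nu> H (\<lambda>m \<gamma>. ?\<delta> m * char_value m \<gamma>) (\<lambda>\<gamma>. \<Sum>m\<in>{0}. ?\<delta> m * char_value m \<gamma>)"
      by (rule has_L2_sum_finite) (auto intro: char_value_L2)
    have bound: "cmod (?p n (g\<^sub>0 + m) - ?\<delta> m) \<le> k2 * L2_norm \<nu> (\<lambda>\<gamma>. ?P n \<gamma> - R \<gamma>)" for n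
    proof -
      let ?d = "\<lambda>m. ?p n (g\<^sub>0 + m) - ?\<delta> m" and ?u = "\<lambda>\<gamma>. ?P n \<gamma> * symbol \<gamma> - (\<Sum>m\<in>{0}. ?\<delta> m * char_value m \<gamma>)"
      have sum: "has_L2_sum \<nu> H (\<lambda>m \<gamma>. ?d m * char_value m \<gamma>) ?u"
        using has_L2_sum_diff[OF samples_symbol_product[OF c(1)] one] by (simp only: left_diff_distrib)
      note coeffs = riesz_bounds_has_L2_sum[OF riesz_bounds_characters zero_less_one zero_less_one sum]
      have "cmod (?d m) \<le> L2_norm (count_space H) ?d"
        by (rule norm_le_L2_norm_count_space[OF coeffs(1) m])
      also have "\<dots> \<le> L2_norm \<nu> ?u"
        by (rule power2_le_imp_le) (use coeffs(2) in simp_all)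
      also have "\<dots> \<le> k2 * L2_norm \<nu> (\<lambda>\<gamma>. ?P n \<gamma> - R \<gamma>)"
      proof (rule L2_norm_mono_AE)
        show "AE \<gamma> in \<nu>. cmod (?u \<gamma>) \<le> k2 * cmod (?P n \<gamma> - R \<gamma>)"
          using symbol_bounds AE_space
        proof eventually_elim
          case (elim \<gamma>)
          then have "symbol \<gamma> \<noteq> 0"
            using k by auto
          then have "R \<gamma> * symbol \<gamma> = 1"
            using elim by (simp add: R_def)
          then have "?u \<gamma> = (?P n \<gamma> - R \<gamma>) * symbol \<gamma>"
            using elim by (simp add: char_value_def space_dual dual_zero left_diff_distrib)
          then show ?case
            using elim by (simp add: norm_mult mult.commute[of k2] mult_left_mono)
        qed
      qed (use sum P R_L2 k in \<open>auto dest: has_L2_sumD(1)\<close>)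
      finally show ?thesis .
    qed
    have "(\<lambda>n. k2 * L2_norm \<nu> (\<lambda>\<gamma>. ?P n \<gamma> - R \<gamma>)) \<longlonglongrightarrow> k2 * 0"
      by (intro tendsto_intros c(2))
    then have "(\<lambda>n. ?p n (g\<^sub>0 + m) - ?\<delta> m) \<longlonglongrightarrow> 0"
      using bound by (intro Lim_null_comparison[of "\<lambda>n. ?p n (g\<^sub>0 + m) - ?\<delta> m"]) auto
    then have "(\<lambda>n. ?p n (g\<^sub>0 + m)) \<longlonglongrightarrow> ?\<delta> m"
      by (rule LIM_zero_cancel)
    moreover have "(\<lambda>n. ?p n (g\<^sub>0 + m)) \<longlonglongrightarrow> S (g\<^sub>0 + m)"
      by (rule tendsto_uniform_limitI[OF S(2)]) simp
    ultimately show ?thesis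
      using LIMSEQ_unique by blast
  qed
  with S(1) show ?thesis
    by (rule that)
qed

text \<open>Let \<open>S\<close> be the interpolating function. Combinations of its translates have their coefficients as
  samples, so the frame inequalities are Riesz bounds. The difference between \<open>x\<close> and a partial sum
  of its sampling series has as samples the remaining samples of \<open>x\<close>, so the lower frame inequality
  makes the series converge. If \<open>S'\<close> is another sampling function, then its formula
  for \<open>x = S\<close> reads \<open>S = S'\<close>.\<close>

lemma sampling_function_exists:
  obtains S where "sampling_function M H a g\<^sub>0 S" "\<And>S'. sampling_function M H a g\<^sub>0 S' \<Longrightarrow> S' = S"
proof -
  obtain S where S: "S \<in> CS" "\<And>m. m \<in> H \<Longrightarrow> S (g\<^sub>0 + m) = (if m = 0 then 1 else 0)"
    by (rule interpolating_function_exists) blast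
  obtain \<alpha> \<beta> where \<alpha>\<beta>: "0 < \<alpha>" "0 < \<beta>"
    and samples: "\<And>x. x \<in> CS \<Longrightarrow> samples x \<in> L2 (count_space H)"
    and lower: "\<And>x. x \<in> CS \<Longrightarrow> \<alpha> * L2_norm M x \<le> L2_norm (count_space H) (samples x)"
    and upper: "\<And>x. x \<in> CS \<Longrightarrow> L2_norm (count_space H) (samples x) \<le> \<beta> * L2_norm M x"
    by (rule samples_frame) blast
  let ?T = "\<lambda>m. translate m S"
  have T: "?T m \<in> CS" if "m \<in> H" for m
    using S(1) that by (rule CS_translate)
  have T_L2: "?T m \<in> L2 M" if "m \<in> H" for m
    using T[OF that] by (rule CS_L2)
  have comb: "lincomb ?T c \<in> CS" "\<And>i. i \<in> H \<Longrightarrow> lincomb ?T c (g\<^sub>0 + i) = c i" if c: "c \<in> fin_coeffs H" for c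
  proof -
    have X: "finite {i. c i \<noteq> 0}" "\<And>i. c i \<noteq> 0 \<Longrightarrow> i \<in> H"
      using c by (auto simp: fin_coeffs_def)
    have "(\<lambda>g. \<Sum>i | c i \<noteq> 0. c i * ?T i g) \<in> CS"
      using X(2) by (intro CS_sum CS_cmult T) auto
    then show "lincomb ?T c \<in> CS"
      by (simp add: lincomb_def[abs_def])
    fix i assume i: "i \<in> H"
    have "lincomb ?T c (g\<^sub>0 + i) = (\<Sum>j | c j \<noteq> 0. if i = j then c j else 0)"
      unfolding lincomb_def
    proof (intro sum.cong refl)
      fix j assume "j \<in> {j. c j \<noteq> 0}"
      then have "j \<in> H"
        using X(2) by simp
      then show "c j * ?T j (g\<^sub>0 + i) = (if i = j then c j else 0)"
        using S(2)[OF diff_H[OF i]] by (simp add: translate_def add_diff_eq)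
    qed
    then show "lincomb ?T c (g\<^sub>0 + i) = c i"
      using X(1) by simp
  qed
  have rb: "riesz_bounds M H ?T (1 / \<beta>\<^sup>2) (1 / \<alpha>\<^sup>2)"
    unfolding riesz_bounds_def
  proof (intro conjI ballI T_L2)
    fix c assume c: "c \<in> fin_coeffs H"
    let ?y = "L2_norm M (lincomb ?T c)" and ?s = "L2_norm (count_space H) (\<lambda>m. lincomb ?T c (g\<^sub>0 + m))"
    have s: "?s\<^sup>2 = coeff_norm2 c"
      using L2_norm_count_space_cong[of H "\<lambda>m. lincomb ?T c (g\<^sub>0 + m)" c] comb(2)[OF c]
        L2_norm_count_space_fin_coeffs[OF c] by simp
    have "(\<alpha> * ?y)\<^sup>2 \<le> ?s\<^sup>2" "?s\<^sup>2 \<le> (\<beta> * ?y)\<^sup>2"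
      using lower[OF comb(1)[OF c]] upper[OF comb(1)[OF c]] \<alpha>\<beta> by (intro power_mono; simp)+
    then show "1 / \<beta>\<^sup>2 * coeff_norm2 c \<le> ?y\<^sup>2" "?y\<^sup>2 \<le> 1 / \<alpha>\<^sup>2 * coeff_norm2 c"
      using \<alpha>\<beta> unfolding s by (simp_all add: power_mult_distrib field_simps)
  qed
  then have riesz: "riesz_sequence M H ?T"
    unfolding riesz_sequence_iff using \<alpha>\<beta> by (intro exI[of _ "1 / \<beta>\<^sup>2"] exI[of _ "1 / \<alpha>\<^sup>2"] conjI) auto
  have formula: "has_L2_sum M H (\<lambda>m g. x (g\<^sub>0 + m) * S (g - m)) x" if x: "x \<in> CS" for x
    unfolding has_L2_sum_def
  proof (intro conjI ballI)
    show "x \<in> L2 M"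
      using x by (rule CS_L2)
    show "(\<lambda>g. x (g\<^sub>0 + m) * S (g - m)) \<in> L2 M" if "m \<in> H" for m
      using L2_cmult[OF T_L2[OF that]] by (simp add: translate_def)
    let ?d = "\<lambda>m. x (g\<^sub>0 + m)"
    show "((\<lambda>X. L2_norm M (\<lambda>g. (\<Sum>m\<in>X. x (g\<^sub>0 + m) * S (g - m)) - x g)) \<longlongrightarrow> 0) (finite_subsets_at_top H)"
    proof (rule tendstoI)
      fix e :: real assume e: "0 < e"
      obtain F where F: "finite F" "F \<subseteq> H"
          "\<And>Y. finite Y \<Longrightarrow> Y \<subseteq> H \<Longrightarrow> Y \<inter> F = {} \<Longrightarrow> (\<Sum>m\<in>Y. (cmod (?d m))\<^sup>2) < (\<alpha> * e / 2)\<^sup>2"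
        by (rule summable_on_tail[OF L2_count_space_summable[OF samples[OF x]], of "(\<alpha> * e / 2)\<^sup>2"])
          (use e \<alpha>\<beta> in auto)
      have "L2_norm M (\<lambda>g. (\<Sum>m\<in>X. ?d m * S (g - m)) - x g) < e" if X: "finite X" "F \<subseteq> X" "X \<subseteq> H" for X
      proof -
        let ?y = "lincomb ?T (cutoff ?d X)"
        note cut = cutoff_fin_coeffs[OF X(1,3), where c = ?d]
        have y: "?y = (\<lambda>g. \<Sum>m\<in>X. ?d m * S (g - m))"
          by (simp add: cut(2) translate_def)
        have diff: "(\<lambda>g. ?y g - x g) \<in> CS"
          by (intro CS_diff comb(1) cut(1) x)
        have "(\<Sum>m\<in>Y. (cmod (?y (g\<^sub>0 + m) - x (g\<^sub>0 + m)))\<^sup>2) \<le> (\<alpha> * e / 2)\<^sup>2" if Y: "finite Y" "Y \<subseteq> H" for Y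
        proof -
          have "(\<Sum>m\<in>Y. (cmod (?y (g\<^sub>0 + m) - x (g\<^sub>0 + m)))\<^sup>2) = (\<Sum>m\<in>Y - X. (cmod (?d m))\<^sup>2)"
          proof (rule sum.mono_neutral_cong_right[OF Y(1)])
            have val: "?y (g\<^sub>0 + m) = cutoff ?d X m" if "m \<in> Y" for m
              using Y(2) that by (intro comb(2)[OF cut(1)]) auto
            show "\<forall>m\<in>Y - (Y - X). (cmod (?y (g\<^sub>0 + m) - x (g\<^sub>0 + m)))\<^sup>2 = 0"
              using val by (auto simp: cutoff_def)
            show "(cmod (?y (g\<^sub>0 + m) - x (g\<^sub>0 + m)))\<^sup>2 = (cmod (?d m))\<^sup>2" if "m \<in> Y - X" for m
              using val that by (simp add: cutoff_def)
          qed auto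
          also have "\<dots> \<le> (\<alpha> * e / 2)\<^sup>2"
            by (rule less_imp_le[OF F(3)]) (use Y X in auto)
          finally show ?thesis .
        qed
        from L2_count_spaceI(2)[OF this]
        have sq: "(L2_norm (count_space H) (\<lambda>m. ?y (g\<^sub>0 + m) - x (g\<^sub>0 + m)))\<^sup>2 \<le> (\<alpha> * e / 2)\<^sup>2" .
        have "0 \<le> \<alpha> * e / 2"
          using mult_pos_pos[OF \<alpha>\<beta>(1) e] by simp
        with sq have "L2_norm (count_space H) (\<lambda>m. ?y (g\<^sub>0 + m) - x (g\<^sub>0 + m)) \<le> \<alpha> * e / 2"
          by (rule power2_le_imp_le)
        then have "\<alpha> * L2_norm M (\<lambda>g. ?y g - x g) \<le> \<alpha> * (e / 2)"
          using lower[OF diff] by simp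
        then show ?thesis
          using \<alpha>\<beta> e by (simp add: y)
      qed
      then show "\<forall>\<^sub>F X in finite_subsets_at_top H.
          dist (L2_norm M (\<lambda>g. (\<Sum>m\<in>X. x (g\<^sub>0 + m) * S (g - m)) - x g)) 0 < e"
        unfolding eventually_finite_subsets_at_top using F(1,2) by (intro exI[of _ F]) auto
    qed
  qed
  have span: "L2_closed_span M H ?T = shift_space M H a"
    unfolding shift_space_eq
  proof
    show "L2_closed_span M H ?T \<subseteq> L2_closed_span M H shift"
      by (rule L2_closed_span_subset[OF _ shift_L2]) (use T in \<open>simp add: CS_iff\<close>)
    show "L2_closed_span M H shift \<subseteq> L2_closed_span M H ?T"
    proof (rule L2_closed_span_subset[OF _ T_L2])
      fix h assume h: "h \<in> H"
      have CS: "shift h \<in> CS"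
        unfolding CS_iff
      proof
        show "shift h \<in> L2_closed_span M H shift"
          by (rule L2_closed_span_generator[OF h shift_L2])
        show "continuous_on UNIV (shift h)"
          unfolding shift_def by (rule continuous_translate[OF continuous_a])
      qed
      show "shift h \<in> L2_closed_span M H ?T"
      proof (rule L2_closed_span_tendsto[OF T_L2 shift_L2 _ _ has_L2_sumD(3)[OF formula[OF CS]]])
        show "\<forall>\<^sub>F X in finite_subsets_at_top H.
            (\<lambda>g. \<Sum>m\<in>X. shift h (g\<^sub>0 + m) * S (g - m)) \<in> L2_closed_span M H ?T"
          using eventually_finite_subset
        proof eventually_elim
          case (elim X)
          have "(\<lambda>g. \<Sum>m\<in>X. shift h (g\<^sub>0 + m) * ?T m g) \<in> L2_closed_span M H ?T"
            using elim
            by (intro L2_closed_span_sum L2_closed_span_cmult L2_closed_span_generator T_L2) auto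
          then show ?case
            by (simp add: translate_def)
        qed
      qed auto
    qed
  qed
  have "sampling_function M H a g\<^sub>0 S"
    using S(1) riesz span formula by (simp add: sampling_function_def riesz_basis_def)
  moreover have "S' = S" if S': "sampling_function M H a g\<^sub>0 S'" for S'
  proof -
    have S'CS: "S' \<in> CS"
      using S' by (simp add: sampling_function_def)
    have "has_L2_sum M H (\<lambda>m g. S (g\<^sub>0 + m) * S' (g - m)) (\<lambda>g. \<Sum>m\<in>{0}. S (g\<^sub>0 + m) * S' (g - m))"
    proof (rule has_L2_sum_finite)
      show "(\<lambda>g. S (g\<^sub>0 + i) * S' (g - i)) \<in> L2 M" for i
        using L2_cmult[OF L2_translate(1)[OF haar CS_L2[OF S'CS]]] by (simp add: translate_def)
    qed (use S(2) in auto)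
    then have "has_L2_sum M H (\<lambda>m g. S (g\<^sub>0 + m) * S' (g - m)) S'"
      using S(2)[of 0] by simp
    moreover have "has_L2_sum M H (\<lambda>m g. S (g\<^sub>0 + m) * S' (g - m)) S"
      using S' S(1) by (simp add: sampling_function_def)
    ultimately show ?thesis
      by (intro CS_eqI S'CS S(1) has_L2_sum_unique)
  qed
  ultimately show ?thesis
    by (rule that)
qed

end

section \<open>From a sampling function to bounds of the symbol\<close>

text \<open>The Riesz bounds of both families make multiplication by the symbol bounded above and below
  on trigonometric polynomials.\<close>

lemma symbol_multiplication_bounds:
  assumes S: "sampling_function M H a g\<^sub>0 S"
  obtains k1 k2 where "0 < k1" "0 < k2"
    "\<And>c. c \<in> fin_coeffs H \<Longrightarrow> k1 * L2_norm \<nu> (trig_poly c)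
      \<le> L2_norm \<nu> (\<lambda>\<gamma>. trig_poly c \<gamma> * symbol \<gamma>)"
    "\<And>c. c \<in> fin_coeffs H \<Longrightarrow> L2_norm \<nu> (\<lambda>\<gamma>. trig_poly c \<gamma> * symbol \<gamma>)
      \<le> k2 * L2_norm \<nu> (trig_poly c)"
proof -
  obtain A B where AB: "0 < A" "0 < B" and rb: "riesz_bounds M H shift A B"
    by (rule riesz_bounds_shift)
  obtain A' B' where AB': "0 < A'" "0 < B'" and rb': "riesz_bounds M H (\<lambda>m. translate m S) A' B'"
    using S unfolding sampling_function_def riesz_basis_def riesz_sequence_iff by blast
  show ?thesis
  proof (rule that[of "sqrt (A / B')" "sqrt (B / A')"])
    fix c assume c: "c \<in> fin_coeffs H"
    let ?P = "L2_norm \<nu> (trig_poly c)" and ?p = "L2_norm M (shift_comb c)"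
    let ?PG = "L2_norm \<nu> (\<lambda>\<gamma>. trig_poly c \<gamma> * symbol \<gamma>)"
    have "has_L2_sum M H (\<lambda>m g. shift_comb c (g\<^sub>0 + m) * translate m S g) (shift_comb c)"
      using S lincomb_shift_CS[OF c] by (simp add: sampling_function_def translate_def)
    note bounds' = riesz_bounds_has_L2_sum(2,3)[OF rb' AB' this, unfolded samples_isometry(2)[OF c]]
    have bounds: "A * ?P\<^sup>2 \<le> ?p\<^sup>2" "?p\<^sup>2 \<le> B * ?P\<^sup>2"
      using riesz_boundsD(2,3)[OF rb c] by (simp_all add: L2_norm_trig_polynomial[OF c])
    have "A * ?P\<^sup>2 \<le> B' * ?PG\<^sup>2" "A' * ?PG\<^sup>2 \<le> B * ?P\<^sup>2"
      using bounds bounds' by linarith+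
    then have "A / B' * ?P\<^sup>2 \<le> ?PG\<^sup>2" "?PG\<^sup>2 \<le> B / A' * ?P\<^sup>2"
      using AB AB' by (simp_all add: field_simps)
    then have "(sqrt (A / B') * ?P)\<^sup>2 \<le> ?PG\<^sup>2" "?PG\<^sup>2 \<le> (sqrt (B / A') * ?P)\<^sup>2"
      using AB AB' by (simp_all add: power_mult_distrib)
    then show "sqrt (A / B') * ?P \<le> ?PG" "?PG \<le> sqrt (B / A') * ?P"
      using AB AB' by (auto elim!: power2_le_imp_le)
  qed (use AB AB' in simp_all)
qed

text \<open>Density in \<open>L\<^sup>2\<close> of the measure with density \<open>1 + \<bar>G\<bar>\<^sup>2\<close> approximates an indicator \<open>f\<close> by
  trigonometric polynomials \<open>P\<close> so that \<open>P\<close> and \<open>P G\<close> converge simultaneously, to \<open>f\<close> and \<open>f G\<close>.\<close>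

lemma symbol_multiplication_bounds_indicator:
  assumes lower: "\<And>c. c \<in> fin_coeffs H \<Longrightarrow> k1 * L2_norm \<nu> (trig_poly c)
      \<le> L2_norm \<nu> (\<lambda>\<gamma>. trig_poly c \<gamma> * symbol \<gamma>)"
    and upper: "\<And>c. c \<in> fin_coeffs H \<Longrightarrow> L2_norm \<nu> (\<lambda>\<gamma>. trig_poly c \<gamma> * symbol \<gamma>)
      \<le> k2 * L2_norm \<nu> (trig_poly c)"
    and E: "E \<in> sets \<nu>"
  shows "k1 * L2_norm \<nu> (indicator E) \<le> L2_norm \<nu> (\<lambda>\<gamma>. indicator E \<gamma> * symbol \<gamma>)"
    and "L2_norm \<nu> (\<lambda>\<gamma>. indicator E \<gamma> * symbol \<gamma>) \<le> k2 * L2_norm \<nu> (indicator E)"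
proof -
  interpret \<nu>: prob_space \<nu>
    by (rule prob_space_dual)
  note [measurable] = L2_measurable[OF symbol_L2] E
  define w where "w \<gamma> = 1 + (cmod (symbol \<gamma>))\<^sup>2" for \<gamma>
  have w_meas [measurable]: "w \<in> borel_measurable \<nu>"
    unfolding w_def by measurable
  have w_pos: "0 \<le> w \<gamma>" for \<gamma>
    by (simp add: w_def)
  have w_int: "integrable \<nu> w"
    unfolding w_def using L2_integrable[OF symbol_L2] by simp
  define \<mu> where "\<mu> = density \<nu> w"
  have "emeasure \<mu> (space \<mu>) = (\<integral>\<^sup>+\<gamma>. ennreal (w \<gamma>) \<partial>\<nu>)"
    by (simp add: \<mu>_def emeasure_density nn_integral_set_ennreal[symmetric] cong: nn_integral_cong)
  then have fm: "finite_measure \<mu>"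
    using w_int w_pos by (intro finite_measureI) (simp add: nn_integral_eq_integral)
  interpret lattice_dual_measure H \<nu> \<mu>
    by (intro lattice_dual_measure.intro lattice_dual_axioms fm lattice_dual_measure_axioms.intro) (simp add: \<mu>_def)
  have weighted: "f \<in> L2 \<nu>" "(\<lambda>\<gamma>. f \<gamma> * symbol \<gamma>) \<in> L2 \<nu>"
      "L2_norm \<nu> f \<le> L2_norm \<mu> f" "L2_norm \<nu> (\<lambda>\<gamma>. f \<gamma> * symbol \<gamma>) \<le> L2_norm \<mu> f"
    if f: "f \<in> L2 \<mu>" for f
  proof -
    have f_meas [measurable]: "f \<in> borel_measurable \<nu>"
      using L2_measurable[OF f] by (simp add: measurable_\<mu>)
    have int: "integrable \<nu> (\<lambda>\<gamma>. w \<gamma> * (cmod (f \<gamma>))\<^sup>2)"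
      using L2_integrable[OF f] w_pos by (simp add: \<mu>_def integrable_density)
    have norm: "L2_norm \<mu> f = sqrt (\<integral>\<gamma>. w \<gamma> * (cmod (f \<gamma>))\<^sup>2 \<partial>\<nu>)"
      using w_pos by (simp add: L2_norm_def \<mu>_def integral_density)
    have le: "(cmod (f \<gamma>))\<^sup>2 \<le> w \<gamma> * (cmod (f \<gamma>))\<^sup>2" "(cmod (f \<gamma> * symbol \<gamma>))\<^sup>2 \<le> w \<gamma> * (cmod (f \<gamma>))\<^sup>2" for \<gamma>
      by (simp_all add: w_def norm_mult power_mult_distrib algebra_simps)
    have int1: "integrable \<nu> (\<lambda>\<gamma>. (cmod (f \<gamma>))\<^sup>2)"
      by (rule Bochner_Integration.integrable_bound[OF int]) (use le(1) w_pos in auto)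
    have int2: "integrable \<nu> (\<lambda>\<gamma>. (cmod (f \<gamma> * symbol \<gamma>))\<^sup>2)"
      by (rule Bochner_Integration.integrable_bound[OF int])
        (use le(2) w_pos in \<open>auto simp: abs_mult\<close>)
    show "f \<in> L2 \<nu>" "(\<lambda>\<gamma>. f \<gamma> * symbol \<gamma>) \<in> L2 \<nu>"
      using int1 int2 by (simp_all add: L2_def)
    show "L2_norm \<nu> f \<le> L2_norm \<mu> f"
      unfolding norm unfolding L2_norm_def by (intro real_sqrt_le_mono integral_mono int1 int le)
    show "L2_norm \<nu> (\<lambda>\<gamma>. f \<gamma> * symbol \<gamma>) \<le> L2_norm \<mu> f"
      unfolding norm unfolding L2_norm_def by (intro real_sqrt_le_mono integral_mono int2 int le)
  qed
  let ?f = "indicator E :: _ \<Rightarrow> complex"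
  have f: "?f \<in> trig_closure"
    by (rule trig_closure_indicator) (simp add: sets_\<mu>)
  then have f_L2: "?f \<in> L2 \<mu>"
    by (rule L2_closed_span_in_L2)
  obtain c where c: "\<And>n. c n \<in> fin_coeffs H"
      "(\<lambda>n. L2_norm \<mu> (\<lambda>\<gamma>. trig_poly (c n) \<gamma> - ?f \<gamma>)) \<longlonglongrightarrow> 0"
    using L2_closed_span_sequence[OF f] by blast
  have P: "trig_poly (c n) \<in> L2 \<mu>" for n
    by (rule lincomb_L2[OF c(1) char_value_L2_\<mu>])
  note diff = L2_diff[OF P f_L2]
  have "(\<lambda>n. L2_norm \<nu> (\<lambda>\<gamma>. trig_poly (c n) \<gamma> - ?f \<gamma>)) \<longlonglongrightarrow> 0"
    by (rule Lim_null_comparison[OF _ c(2)]) (simp add: weighted(3)[OF diff])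
  then have lim1: "(\<lambda>n. L2_norm \<nu> (trig_poly (c n))) \<longlonglongrightarrow> L2_norm \<nu> ?f"
    by (intro L2_norm_tendsto weighted(1) P f_L2)
  have "(\<lambda>n. L2_norm \<nu> (\<lambda>\<gamma>. trig_poly (c n) \<gamma> * symbol \<gamma> - ?f \<gamma> * symbol \<gamma>)) \<longlonglongrightarrow> 0"
    by (rule Lim_null_comparison[OF _ c(2)]) (simp add: weighted(4)[OF diff] left_diff_distrib[symmetric])
  then have lim2: "(\<lambda>n. L2_norm \<nu> (\<lambda>\<gamma>. trig_poly (c n) \<gamma> * symbol \<gamma>))
      \<longlonglongrightarrow> L2_norm \<nu> (\<lambda>\<gamma>. ?f \<gamma> * symbol \<gamma>)"
    by (intro L2_norm_tendsto weighted(2) P f_L2)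
  show "k1 * L2_norm \<nu> ?f \<le> L2_norm \<nu> (\<lambda>\<gamma>. ?f \<gamma> * symbol \<gamma>)"
    by (rule LIMSEQ_le[OF tendsto_mult_left[OF lim1] lim2]) (use lower[OF c(1)] in blast)
  show "L2_norm \<nu> (\<lambda>\<gamma>. ?f \<gamma> * symbol \<gamma>) \<le> k2 * L2_norm \<nu> ?f"
    by (rule LIMSEQ_le[OF lim2 tendsto_mult_left[OF lim1]]) (use upper[OF c(1)] in blast)
qed

text \<open>On the set where \<open>\<bar>G\<bar>\<close> is less than \<open>k1 / 2\<close>, multiplication by \<open>G\<close> violates the lower bound \<open>k1\<close>
  unless the set is null; halving gives the strict gap that this needs. The set where \<open>\<bar>G\<bar>\<close> exceeds
  \<open>2 k2\<close> is treated in the same way.\<close>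

lemma symbol_bounds_of_sampling_function:
  assumes S: "sampling_function M H a g\<^sub>0 S"
  obtains k1 k2 where "0 < k1" "0 < k2" "AE \<gamma> in \<nu>. k1 \<le> cmod (symbol \<gamma>) \<and> cmod (symbol \<gamma>) \<le> k2"
proof -
  interpret \<nu>: prob_space \<nu>
    by (rule prob_space_dual)
  note [measurable] = L2_measurable[OF symbol_L2]
  obtain k1 k2 where k: "0 < k1" "0 < k2"
    and lower: "\<And>c. c \<in> fin_coeffs H \<Longrightarrow> k1 * L2_norm \<nu> (trig_poly c)
      \<le> L2_norm \<nu> (\<lambda>\<gamma>. trig_poly c \<gamma> * symbol \<gamma>)"
    and upper: "\<And>c. c \<in> fin_coeffs H \<Longrightarrow> L2_norm \<nu> (\<lambda>\<gamma>. trig_poly c \<gamma> * symbol \<gamma>)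
      \<le> k2 * L2_norm \<nu> (trig_poly c)"
    by (rule symbol_multiplication_bounds[OF S]) blast
  have bounds: "k1 * L2_norm \<nu> (indicator E) \<le> L2_norm \<nu> (\<lambda>\<gamma>. indicator E \<gamma> * symbol \<gamma>)"
      "L2_norm \<nu> (\<lambda>\<gamma>. indicator E \<gamma> * symbol \<gamma>) \<le> k2 * L2_norm \<nu> (indicator E)" if "E \<in> sets \<nu>" for E
    by (rule symbol_multiplication_bounds_indicator[of k1 k2], use lower upper that in auto)+
  have ind_L2: "indicator E \<in> L2 \<nu>" if "E \<in> sets \<nu>" for E
    by (rule \<nu>.bounded_in_L2[of _ 1]) (use that in \<open>auto simp: indicator_def\<close>)
  have null: "AE \<gamma> in \<nu>. \<gamma> \<notin> E" if "E \<in> sets \<nu>" "L2_norm \<nu> (indicator E) = 0" for E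
    using L2_norm_eq_0_AE[OF ind_L2[OF that(1)] that(2)] by (auto simp: indicator_def split: if_splits)
  define E where "E = {\<gamma> \<in> space \<nu>. cmod (symbol \<gamma>) < k1 / 2}"
  have E: "E \<in> sets \<nu>"
    unfolding E_def by measurable
  have [measurable]: "indicator E \<in> borel_measurable \<nu>"
    using E by simp
  have le: "AE \<gamma> in \<nu>. cmod (indicator E \<gamma> * symbol \<gamma>) \<le> k1 / 2 * cmod (indicator E \<gamma>)"
    using k by (auto simp: E_def indicator_def)
  have prod_L2: "(\<lambda>\<gamma>. indicator F \<gamma> * symbol \<gamma>) \<in> L2 \<nu>" if "F \<in> sets \<nu>" for F
    by (rule L2_mult_bounded[OF _ symbol_L2, of _ 1]) (use that in \<open>auto simp: indicator_def\<close>)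
  have "k1 * L2_norm \<nu> (indicator E) \<le> k1 / 2 * L2_norm \<nu> (indicator E)"
    using bounds(1)[OF E] L2_norm_mono_AE[OF ind_L2[OF E] prod_L2[OF E] le] k by linarith
  then have "L2_norm \<nu> (indicator E) = 0"
    using k L2_norm_nonneg[of \<nu> "indicator E"] by (simp add: field_simps)
  then have AE1: "AE \<gamma> in \<nu>. k1 / 2 \<le> cmod (symbol \<gamma>)"
    using null[OF E] AE_space by (auto simp: E_def elim!: eventually_elim2)
  define F where "F = {\<gamma> \<in> space \<nu>. 2 * k2 < cmod (symbol \<gamma>)}"
  have F: "F \<in> sets \<nu>"
    unfolding F_def by measurable
  have le: "AE \<gamma> in \<nu>. cmod (indicator F \<gamma>) \<le> 1 / (2 * k2) * cmod (indicator F \<gamma> * symbol \<gamma>)"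
    using k by (auto simp: F_def indicator_def field_simps)
  have "L2_norm \<nu> (indicator F) \<le> 1 / (2 * k2) * (k2 * L2_norm \<nu> (indicator F))"
    using L2_norm_mono_AE[OF prod_L2[OF F] ind_L2[OF F] le] k
      mult_left_mono[OF bounds(2)[OF F], of "1 / (2 * k2)"] by simp
  then have "L2_norm \<nu> (indicator F) = 0"
    using k L2_norm_nonneg[of \<nu> "indicator F"] by (simp add: field_simps)
  then have AE2: "AE \<gamma> in \<nu>. cmod (symbol \<gamma>) \<le> 2 * k2"
    using null[OF F] AE_space by (auto simp: F_def elim!: eventually_elim2)
  show ?thesis
    by (rule that[of "k1 / 2" "2 * k2"]) (use k AE1 AE2 in auto)
qed

end

end

lemma (in prob_space) essential_bounds_iff:
  assumes f: "f \<in> borel_measurable M" "\<And>x. 0 \<le> f x"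
  shows "0 < essinf M (\<lambda>x. ereal (f x)) \<and> essinf M (\<lambda>x. ereal (f x)) \<le> esssup M (\<lambda>x. ereal (f x)) \<and>
      esssup M (\<lambda>x. ereal (f x)) < \<infinity> \<longleftrightarrow> (\<exists>k\<^sub>1>0. \<exists>k\<^sub>2>0. AE x in M. k\<^sub>1 \<le> f x \<and> f x \<le> k\<^sub>2)"
    (is "?L \<longleftrightarrow> ?R")
proof -
  let ?f = "\<lambda>x. ereal (f x)"
  have meas: "?f \<in> borel_measurable M" "(\<lambda>x. - ?f x) \<in> borel_measurable M"
    using f(1) by simp_all
  have inf: "AE x in M. essinf M ?f \<le> ?f x"
    using esssup_AE[of "\<lambda>x. - ?f x" M] by (simp add: essinf_def ereal_uminus_le_reorder)
  have sup: "AE x in M. ?f x \<le> esssup M ?f"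
    by (rule esssup_AE)
  show ?thesis
  proof
    assume L: ?L
    obtain k\<^sub>1 where k1: "0 < ereal k\<^sub>1" "ereal k\<^sub>1 < essinf M ?f"
      using L ereal_dense2[of 0 "essinf M ?f"] by auto
    obtain k\<^sub>2 where k2: "max 0 (esssup M ?f) < ereal k\<^sub>2"
      using L ereal_dense2[of "max 0 (esssup M ?f)" \<infinity>] by auto
    have "AE x in M. k\<^sub>1 \<le> f x \<and> f x \<le> k\<^sub>2"
      using inf sup
    proof eventually_elim
      case (elim x)
      have "ereal k\<^sub>1 \<le> ereal (f x)" "ereal (f x) \<le> ereal k\<^sub>2"
        using less_le_trans[OF k1(2) elim(1)] le_less_trans[OF elim(2), of "ereal k\<^sub>2"] k2 by simp_all
      then show ?case
        by simp
    qed
    then show ?R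
      using k1(1) k2 by (intro exI[of _ k\<^sub>1] exI[of _ k\<^sub>2] conjI) auto
  next
    assume ?R
    then obtain k\<^sub>1 k\<^sub>2 where k: "0 < k\<^sub>1" "0 < k\<^sub>2" "AE x in M. k\<^sub>1 \<le> f x \<and> f x \<le> k\<^sub>2"
      by blast
    have "esssup M (\<lambda>x. - ?f x) \<le> - ereal k\<^sub>1"
      by (rule esssup_I[OF meas(2)]) (use k(3) in \<open>auto elim: eventually_mono\<close>)
    then have "- (- ereal k\<^sub>1) \<le> essinf M ?f"
      unfolding essinf_def by (simp only: ereal_minus_le_minus)
    then have "ereal k\<^sub>1 \<le> essinf M ?f"
      by simp
    then have "0 < essinf M ?f"
      using k(1) by (auto intro: less_le_trans[of 0 "ereal k\<^sub>1"])
    moreover have "esssup M ?f \<le> ereal k\<^sub>2"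
      by (rule esssup_I[OF meas(1)]) (use k(3) in \<open>auto elim: eventually_mono\<close>)
    then have "esssup M ?f < \<infinity>"
      by (rule le_less_trans) simp
    moreover have "AE x in M. essinf M ?f \<le> esssup M ?f"
      using inf sup by eventually_elim (rule order_trans)
    then have "essinf M ?f \<le> esssup M ?f"
      by simp
    ultimately show ?L
      by blast
  qed
qed

theorem theorem3:
  fixes M :: "'g::{topological_ab_group_add, second_countable_topology, t2_space} measure"
    and H :: "'g set"
    and \<nu> :: "('g \<Rightarrow> complex) measure"
    and a :: "'g \<Rightarrow> complex"
    and g\<^sub>0 :: 'g
  assumes "locally_compact_space (euclidean :: 'g topology)"
    and "haar_measure M"
    and "uniform_lattice H" and "countable H"
    and "normalized_dual_haar_measure H \<nu>"
    and "generates_continuous_shift_space M H a"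
  defines "G \<equiv> sampling_symbol \<nu> H a g\<^sub>0"
  defines "cond_i \<equiv> 0 < essinf \<nu> (\<lambda>\<gamma>. ereal (cmod (G \<gamma>))) \<and>
      essinf \<nu> (\<lambda>\<gamma>. ereal (cmod (G \<gamma>))) \<le> esssup \<nu> (\<lambda>\<gamma>. ereal (cmod (G \<gamma>))) \<and>
      esssup \<nu> (\<lambda>\<gamma>. ereal (cmod (G \<gamma>))) < \<infinity>"
  shows "has_L2_sum \<nu> H (\<lambda>h \<gamma>. a (g\<^sub>0 + h) * \<gamma> h) G \<and>
    (cond_i \<longleftrightarrow> (\<exists>!S. sampling_function M H a g\<^sub>0 S)) \<and>
    (cond_i \<longrightarrow> (\<forall>S. sampling_function M H a g\<^sub>0 S \<longrightarrow>
       (\<forall>x\<in>continuous_shift_space M H a.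
          (\<forall>g. (\<lambda>m. cmod (x (g\<^sub>0 + m) * S (g - m))) summable_on H) \<and>
          uniform_limit UNIV (\<lambda>X g. \<Sum>m\<in>X. x (g\<^sub>0 + m) * S (g - m)) x
            (finite_subsets_at_top H))))"
proof -
  interpret shift_invariant_space H \<nu> M a
    by (intro shift_invariant_space.intro lattice_dual.intro shift_invariant_space_axioms.intro assms)
  interpret \<nu>: prob_space \<nu>
    by (rule prob_space_dual)
  have G_L2: "G \<in> L2 \<nu>"
    unfolding G_def by (rule symbol_L2)
  have "(\<lambda>\<gamma>. cmod (G \<gamma>)) \<in> borel_measurable \<nu>"
    using L2_measurable[OF G_L2] by simp
  from \<nu>.essential_bounds_iff[OF this]
  have cond: "cond_i \<longleftrightarrow> (\<exists>k\<^sub>1>0. \<exists>k\<^sub>2>0. AE \<gamma> in \<nu>. k\<^sub>1 \<le> cmod (G \<gamma>) \<and> cmod (G \<gamma>) \<le> k\<^sub>2)"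
    by (simp add: cond_i_def)
  have "\<exists>!S. sampling_function M H a g\<^sub>0 S" if invertible: cond_i
  proof -
    obtain k\<^sub>1 k\<^sub>2 where "0 < k\<^sub>1" "0 < k\<^sub>2"
        "AE \<gamma> in \<nu>. k\<^sub>1 \<le> cmod (sampling_symbol \<nu> H a g\<^sub>0 \<gamma>) \<and> cmod (sampling_symbol \<nu> H a g\<^sub>0 \<gamma>) \<le> k\<^sub>2"
      using invertible unfolding cond G_def by blast
    from sampling_function_exists[OF this] show ?thesis
      by metis
  qed
  moreover have cond_i if "sampling_function M H a g\<^sub>0 S" for S
    unfolding cond G_def using symbol_bounds_of_sampling_function[OF that] by metis
  moreover have "(\<forall>g. (\<lambda>m. cmod (x (g\<^sub>0 + m) * S (g - m))) summable_on H) \<and>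
      uniform_limit UNIV (\<lambda>X g. \<Sum>m\<in>X. x (g\<^sub>0 + m) * S (g - m)) x (finite_subsets_at_top H)"
    if S: "sampling_function M H a g\<^sub>0 S" and x: "x \<in> CS" for S x
  proof -
    have S_CS: "S \<in> CS" and sum: "has_L2_sum M H (\<lambda>m g. x (g\<^sub>0 + m) * S (g - m)) x"
      using S x by (simp_all add: sampling_function_def)
    have "(\<lambda>g. x (g\<^sub>0 + m) * S (g - m)) \<in> CS" if "m \<in> H" for m
      using CS_cmult[OF CS_translate[OF S_CS that]] by (simp add: translate_def)
    from has_L2_sum_CS_uniform[OF this x sum] show ?thesis
      by blast
  qed
  ultimately show ?thesis
    using symbol_sum[of g\<^sub>0] unfolding G_def by blast
qed

end
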